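(* Let $A$ be a commutative C*-algebra which is generated by a family of (mutually commuting) projections $\{q_i\}_{i\in I}$. Denote by $\mathcal{R}_0$ the set of all finite algebraic relations in $A$ involving the generators in $\{q_i\}_{i\in I}$, i.e., $\mathcal{R}_0$ is the set of all relations of the form $$\sum_m\lambda_m\prod_n q_{i_{mn}}=0$$ (finite sums, with $\lambda_m\in\mathbb{C}$, of finite products) that are satisfied in $A$. Consider a set of symbols $\{p_i\}_{i\in I}$ with the same cardinality as $I$ and define $$\mathcal{R}_1=\{p_i=p_i^*=p_i^2\mid i\in I\}\cup\{p_{i_1}p_{i_2}=p_{i_2}p_{i_1}\mid i_1,i_2\in I\}$$ and $$\mathcal{R}_2=\left\{\sum_m\lambda_m\prod_n p_{i_{mn}}=0\ \Big|\ \sum_m\lambda_m\prod_n q_{i_{mn}}=0\in\mathcal{R}_0\right\}.$$ Then $C^*(\{p_i\}_{i\in I},\mathcal{R}_1\cup\mathcal{R}_2)$ is *-isomorphic to $A$ by the map $p_i\mapsto q_i$.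
   Context: For a non-empty set $\mathcal{G}$, $\mathcal{B}_{\mathcal{G}}=\mathbb{C}\langle\mathcal{G}\cup\mathcal{G}^*\rangle$ is the free (non-unital) complex *-algebra generated by $\mathcal{G}$ (where $\mathcal{G}^*=\{g^*:g\in\mathcal{G}\}$ is a disjoint copy of $\mathcal{G}$). Finite products are products of at least one factor. A norm relation is a pair $(x,\eta)\in\mathcal{B}_{\mathcal{G}}\times[0,\infty)$; an equality $x=y$ with $x,y\in\mathcal{B}_{\mathcal{G}}$ is regarded as the norm relation $(x-y,0)$. Given a set $\mathcal{R}$ of norm relations, a representation of $(\mathcal{G},\mathcal{R})$ on a Hilbert space $H$ is a *-homomorphism $\rho:\mathcal{B}_{\mathcal{G}}\to B(H)$ with $\|\rho(x)\|\le\eta$ for all $(x,\eta)\in\mathcal{R}$. $(\mathcal{G},\mathcal{R})$ is admissible if for every family of representations of $(\mathcal{G},\mathcal{R})$ the direct sum $x\mapsto\bigoplus_\alpha\rho_\alpha(x)$ is a well-defined representation (into bounded operators) of $(\mathcal{G},\mathcal{R})$. In that case $C^*(\mathcal{G},\mathcal{R})$, the universal C*-algebra of generators $\mathcal{G}$ and relations $\mathcal{R}$, is the completion of $\mathcal{B}_{\mathcal{G}}/\mathcal{N}$ in the norm induced by the C*-seminorm $|||x|||=\sup\{\|\rho(x)\|:\rho\text{ a representation of }(\mathcal{G},\mathcal{R})\}$, where $\mathcal{N}=\{x:|||x|||=0\}$. The elements of $\mathcal{G}$ are identified with their images in $C^*(\mathcal{G},\mathcal{R})$. *)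

theory Defs
  imports
    "HOL-Analysis.Analysis"
    "HOL-Algebra.QuotRing"
    "HOL-Algebra.Module"
    "HOL-Library.Poly_Mapping"
begin

section \<open>Complex *-algebras and C*-algebras\<close>

definition complex_field :: "complex ring" where
  "complex_field = \<lparr>carrier = UNIV, mult = (*), one = 1, zero = 0, add = (+)\<rparr>"

text \<open>
  *-algebras are not assumed to be unital. The field \<open>one\<close>, which is inherited from the
  \<open>ring\<close> record, is never constrained and never used.
\<close>

record 'a star_algebra = "(complex, 'a) module" +
  star :: "'a \<Rightarrow> 'a"

record 'a normed_star_algebra = "'a star_algebra" +
  nrm :: "'a \<Rightarrow> real"

text \<open>
  The locale \<open>Metric_space\<close> wants a distance that is nonnegative and symmetric on the whole
  type, hence the value \<open>0\<close> off the carrier.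
\<close>

definition alg_dist :: "('a, 'm) normed_star_algebra_scheme \<Rightarrow> 'a \<Rightarrow> 'a \<Rightarrow> real" where
  "alg_dist A x y =
    (if x \<in> carrier A \<and> y \<in> carrier A then nrm A (x \<ominus>\<^bsub>A\<^esub> y) else 0)"

locale cstar_algebra = Module.module complex_field A
  for A :: "('a, 'm) normed_star_algebra_scheme" (structure) +
  assumes mult_closed: "x \<in> carrier A \<Longrightarrow> y \<in> carrier A \<Longrightarrow> x \<otimes> y \<in> carrier A"
    and mult_assoc: "x \<in> carrier A \<Longrightarrow> y \<in> carrier A \<Longrightarrow> z \<in> carrier A \<Longrightarrow>
      (x \<otimes> y) \<otimes> z = x \<otimes> (y \<otimes> z)"
    and mult_add_left: "x \<in> carrier A \<Longrightarrow> y \<in> carrier A \<Longrightarrow> z \<in> carrier A \<Longrightarrow>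
      (x \<oplus> y) \<otimes> z = (x \<otimes> z) \<oplus> (y \<otimes> z)"
    and mult_add_right: "x \<in> carrier A \<Longrightarrow> y \<in> carrier A \<Longrightarrow> z \<in> carrier A \<Longrightarrow>
      x \<otimes> (y \<oplus> z) = (x \<otimes> y) \<oplus> (x \<otimes> z)"
    and smult_mult_left: "x \<in> carrier A \<Longrightarrow> y \<in> carrier A \<Longrightarrow>
      (c \<odot> x) \<otimes> y = c \<odot> (x \<otimes> y)"
    and smult_mult_right: "x \<in> carrier A \<Longrightarrow> y \<in> carrier A \<Longrightarrow>
      x \<otimes> (c \<odot> y) = c \<odot> (x \<otimes> y)"
    and star_closed: "x \<in> carrier A \<Longrightarrow> star A x \<in> carrier A"
    and star_star: "x \<in> carrier A \<Longrightarrow> star A (star A x) = x"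
    and star_add: "x \<in> carrier A \<Longrightarrow> y \<in> carrier A \<Longrightarrow>
      star A (x \<oplus> y) = star A x \<oplus> star A y"
    and star_smult: "x \<in> carrier A \<Longrightarrow> star A (c \<odot> x) = cnj c \<odot> star A x"
    and star_mult: "x \<in> carrier A \<Longrightarrow> y \<in> carrier A \<Longrightarrow>
      star A (x \<otimes> y) = star A y \<otimes> star A x"
    and nrm_nonneg: "x \<in> carrier A \<Longrightarrow> 0 \<le> nrm A x"
    and nrm_eq_0_iff: "x \<in> carrier A \<Longrightarrow> nrm A x = 0 \<longleftrightarrow> x = \<zero>"
    and nrm_triangle: "x \<in> carrier A \<Longrightarrow> y \<in> carrier A \<Longrightarrow>
      nrm A (x \<oplus> y) \<le> nrm A x + nrm A y"
    and nrm_smult: "x \<in> carrier A \<Longrightarrow> nrm A (c \<odot> x) = cmod c * nrm A x"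
    and nrm_mult: "x \<in> carrier A \<Longrightarrow> y \<in> carrier A \<Longrightarrow>
      nrm A (x \<otimes> y) \<le> nrm A x * nrm A y"
    and cstar_identity: "x \<in> carrier A \<Longrightarrow> nrm A (star A x \<otimes> x) = (nrm A x)\<^sup>2"
    and complete: "Metric_space.mcomplete (carrier A) (alg_dist A)"

locale commutative_cstar_algebra = cstar_algebra +
  assumes mult_commute: "x \<in> carrier A \<Longrightarrow> y \<in> carrier A \<Longrightarrow> x \<otimes> y = y \<otimes> x"

definition is_projection :: "('a, 'm) star_algebra_scheme \<Rightarrow> 'a \<Rightarrow> bool" where
  "is_projection A x \<longleftrightarrow> x \<in> carrier A \<and> star A x = x \<and> x \<otimes>\<^bsub>A\<^esub> x = x"

definition star_subalgebra :: "('a, 'm) star_algebra_scheme \<Rightarrow> 'a set \<Rightarrow> bool" where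
  "star_subalgebra A B \<longleftrightarrow>
    B \<subseteq> carrier A \<and> \<zero>\<^bsub>A\<^esub> \<in> B \<and>
    (\<forall>x\<in>B. \<forall>y\<in>B. x \<oplus>\<^bsub>A\<^esub> y \<in> B \<and> x \<otimes>\<^bsub>A\<^esub> y \<in> B) \<and>
    (\<forall>c. \<forall>x\<in>B. c \<odot>\<^bsub>A\<^esub> x \<in> B) \<and>
    (\<forall>x\<in>B. star A x \<in> B)"

definition generates_cstar :: "('a, 'm) normed_star_algebra_scheme \<Rightarrow> 'a set \<Rightarrow> bool" where
  "generates_cstar A S \<longleftrightarrow>
    S \<subseteq> carrier A \<and>
    \<Inter> {B. star_subalgebra A B \<and> closedin (Metric_space.mtopology (carrier A) (alg_dist A)) B
          \<and> S \<subseteq> B} = carrier A"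

definition star_hom ::
  "('a, 'm) star_algebra_scheme \<Rightarrow> ('b, 'n) star_algebra_scheme \<Rightarrow> ('a \<Rightarrow> 'b) \<Rightarrow> bool" where
  "star_hom A B \<phi> \<longleftrightarrow>
    \<phi> \<in> carrier A \<rightarrow> carrier B \<and>
    (\<forall>x\<in>carrier A. \<forall>y\<in>carrier A.
       \<phi> (x \<oplus>\<^bsub>A\<^esub> y) = \<phi> x \<oplus>\<^bsub>B\<^esub> \<phi> y \<and> \<phi> (x \<otimes>\<^bsub>A\<^esub> y) = \<phi> x \<otimes>\<^bsub>B\<^esub> \<phi> y) \<and>
    (\<forall>c. \<forall>x\<in>carrier A. \<phi> (c \<odot>\<^bsub>A\<^esub> x) = c \<odot>\<^bsub>B\<^esub> \<phi> x) \<and>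
    (\<forall>x\<in>carrier A. \<phi> (star A x) = star B (\<phi> x))"

definition star_iso ::
  "('a, 'm) star_algebra_scheme \<Rightarrow> ('b, 'n) star_algebra_scheme \<Rightarrow> ('a \<Rightarrow> 'b) \<Rightarrow> bool" where
  "star_iso A B \<phi> \<longleftrightarrow> star_hom A B \<phi> \<and> bij_betw \<phi> (carrier A) (carrier B)"


section \<open>The free *-algebra\<close>

datatype 'g letter = Gen 'g | Adj 'g

primrec letter_adj :: "'g letter \<Rightarrow> 'g letter" where
  "letter_adj (Gen g) = Adj g"
| "letter_adj (Adj g) = Gen g"

primrec letter_gen :: "'g letter \<Rightarrow> 'g" where
  "letter_gen (Gen g) = g"
| "letter_gen (Adj g) = g"

datatype 'g star_word = Word (letters: "'g letter list")

instantiation star_word :: (type) monoid_add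
begin

definition zero_star_word :: "'a star_word" where
  "zero_star_word = Word []"

definition plus_star_word :: "'a star_word \<Rightarrow> 'a star_word \<Rightarrow> 'a star_word" where
  "plus_star_word v w = Word (letters v @ letters w)"

instance
  by intro_classes (simp_all add: zero_star_word_def plus_star_word_def)

end

definition word_adj :: "'g star_word \<Rightarrow> 'g star_word" where
  "word_adj w = Word (rev (map letter_adj (letters w)))"

text \<open>
  With concatenation of words as (noncommutative) addition, the product of \<open>Poly_Mapping\<close> on the
  following type is the convolution product of the monoid algebra of the free monoid. The free
  non-unital *-algebra consists of its elements without constant term, i.e. with coefficient
  \<open>0\<close> at the empty word.
\<close>

type_synonym 'g star_poly = "'g star_word \<Rightarrow>\<^sub>0 complex"

definition free_star_algebra :: "'g set \<Rightarrow> 'g star_poly star_algebra" where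
  "free_star_algebra G =
    \<lparr>carrier = {x. \<forall>w\<in>Poly_Mapping.keys x. letters w \<noteq> [] \<and> letter_gen ` set (letters w) \<subseteq> G},
     mult = (*), one = undefined, zero = 0, add = (+),
     smult = (\<lambda>c. Poly_Mapping.map ((*) c)),
     star = (\<lambda>x. \<Sum>w\<in>Poly_Mapping.keys x.
                Poly_Mapping.single (word_adj w) (cnj (Poly_Mapping.lookup x w)))\<rparr>"

definition free_gen :: "'g \<Rightarrow> 'g star_poly" where
  "free_gen g = Poly_Mapping.single (Word [Gen g]) 1"


section \<open>Hilbert spaces and bounded operators\<close>

text \<open>
  The inner product is linear in the first argument. The fields \<open>mult\<close> and \<open>one\<close> inherited
  from the \<open>module\<close> record play no role.
\<close>

record 'h inner_space = "(complex, 'h) module" +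
  inner_prod :: "'h \<Rightarrow> 'h \<Rightarrow> complex"

definition vec_norm :: "('h, 'm) inner_space_scheme \<Rightarrow> 'h \<Rightarrow> real" where
  "vec_norm H v = sqrt (Re (inner_prod H v v))"

definition vec_dist :: "('h, 'm) inner_space_scheme \<Rightarrow> 'h \<Rightarrow> 'h \<Rightarrow> real" where
  "vec_dist H u v =
    (if u \<in> carrier H \<and> v \<in> carrier H then vec_norm H (u \<ominus>\<^bsub>H\<^esub> v) else 0)"

locale hilbert_space = Module.module complex_field H
  for H :: "('h, 'm) inner_space_scheme" (structure) +
  assumes inner_add: "u \<in> carrier H \<Longrightarrow> v \<in> carrier H \<Longrightarrow> w \<in> carrier H \<Longrightarrow>
      inner_prod H (u \<oplus> v) w = inner_prod H u w + inner_prod H v w"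
    and inner_smult: "u \<in> carrier H \<Longrightarrow> v \<in> carrier H \<Longrightarrow>
      inner_prod H (c \<odot> u) v = c * inner_prod H u v"
    and inner_commute: "u \<in> carrier H \<Longrightarrow> v \<in> carrier H \<Longrightarrow>
      inner_prod H u v = cnj (inner_prod H v u)"
    and inner_nonneg: "u \<in> carrier H \<Longrightarrow> 0 \<le> Re (inner_prod H u u)"
    and inner_eq_0: "u \<in> carrier H \<Longrightarrow> inner_prod H u u = 0 \<Longrightarrow> u = \<zero>"
    and complete: "Metric_space.mcomplete (carrier H) (vec_dist H)"

definition bounded_operator :: "('h, 'm) inner_space_scheme \<Rightarrow> ('h \<Rightarrow> 'h) \<Rightarrow> bool" where
  "bounded_operator H T \<longleftrightarrow>
    T \<in> carrier H \<rightarrow> carrier H \<and>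
    (\<forall>u\<in>carrier H. \<forall>v\<in>carrier H. T (u \<oplus>\<^bsub>H\<^esub> v) = T u \<oplus>\<^bsub>H\<^esub> T v) \<and>
    (\<forall>c. \<forall>v\<in>carrier H. T (c \<odot>\<^bsub>H\<^esub> v) = c \<odot>\<^bsub>H\<^esub> T v) \<and>
    (\<exists>K. \<forall>v\<in>carrier H. vec_norm H (T v) \<le> K * vec_norm H v)"

definition op_norm :: "('h, 'm) inner_space_scheme \<Rightarrow> ('h \<Rightarrow> 'h) \<Rightarrow> real" where
  "op_norm H T = Sup {vec_norm H (T v) | v. v \<in> carrier H \<and> vec_norm H v \<le> 1}"

definition is_adjoint :: "('h, 'm) inner_space_scheme \<Rightarrow> ('h \<Rightarrow> 'h) \<Rightarrow> ('h \<Rightarrow> 'h) \<Rightarrow> bool" where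
  "is_adjoint H T S \<longleftrightarrow>
    (\<forall>u\<in>carrier H. \<forall>v\<in>carrier H. inner_prod H (T u) v = inner_prod H u (S v))"

definition direct_sum :: "'j set \<Rightarrow> ('j \<Rightarrow> 'h inner_space) \<Rightarrow> ('j \<Rightarrow> 'h) inner_space" where
  "direct_sum J H =
    \<lparr>carrier = {f \<in> (\<Pi>\<^sub>E j\<in>J. carrier (H j)). (\<lambda>j. (vec_norm (H j) (f j))\<^sup>2) summable_on J},
     mult = undefined, one = undefined,
     zero = (\<lambda>j\<in>J. \<zero>\<^bsub>H j\<^esub>),
     add = (\<lambda>f g. \<lambda>j\<in>J. f j \<oplus>\<^bsub>H j\<^esub> g j),
     smult = (\<lambda>c f. \<lambda>j\<in>J. c \<odot>\<^bsub>H j\<^esub> f j),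
     inner_prod = (\<lambda>f g. \<Sum>\<^sub>\<infinity>j\<in>J. inner_prod (H j) (f j) (g j))\<rparr>"


section \<open>Norm relations, representations, admissibility\<close>

type_synonym 'g norm_relation = "'g star_poly \<times> real"

definition eq_relation :: "'g star_poly \<Rightarrow> 'g star_poly \<Rightarrow> 'g norm_relation" where
  "eq_relation x y = (x - y, 0)"

text \<open>
  Operators on \<open>H\<close> are functions that matter only on \<open>carrier H\<close>, so the equations which make
  \<open>\<rho>\<close> a homomorphism into the bounded operators are stated pointwise. The condition on
  \<open>is_adjoint\<close> says \<open>\<rho>(x*) = \<rho>(x)*\<close>: on a Hilbert space the adjoint of a bounded
  operator is the unique operator with that property.
\<close>

definition representation ::
  "'g set \<Rightarrow> 'g norm_relation set \<Rightarrow> ('h, 'm) inner_space_scheme \<Rightarrow>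
    ('g star_poly \<Rightarrow> 'h \<Rightarrow> 'h) \<Rightarrow> bool" where
  "representation G R H \<rho> \<longleftrightarrow>
    (let B = free_star_algebra G in
      (\<forall>x\<in>carrier B. bounded_operator H (\<rho> x)) \<and>
      (\<forall>x\<in>carrier B. \<forall>y\<in>carrier B. \<forall>v\<in>carrier H.
         \<rho> (x \<oplus>\<^bsub>B\<^esub> y) v = \<rho> x v \<oplus>\<^bsub>H\<^esub> \<rho> y v \<and> \<rho> (x \<otimes>\<^bsub>B\<^esub> y) v = \<rho> x (\<rho> y v)) \<and>
      (\<forall>c. \<forall>x\<in>carrier B. \<forall>v\<in>carrier H. \<rho> (c \<odot>\<^bsub>B\<^esub> x) v = c \<odot>\<^bsub>H\<^esub> \<rho> x v) \<and>
      (\<forall>x\<in>carrier B. is_adjoint H (\<rho> x) (\<rho> (star B x))) \<and>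
      (\<forall>(x, \<eta>)\<in>R. op_norm H (\<rho> x) \<le> \<eta>))"

definition direct_sum_rep ::
  "'j set \<Rightarrow> ('j \<Rightarrow> 'g star_poly \<Rightarrow> 'h \<Rightarrow> 'h) \<Rightarrow> 'g star_poly \<Rightarrow> ('j \<Rightarrow> 'h) \<Rightarrow> ('j \<Rightarrow> 'h)" where
  "direct_sum_rep J \<rho> x f = (\<lambda>j\<in>J. \<rho> j x (f j))"

text \<open>
  HOL cannot quantify over Hilbert spaces of all types at once. The Hilbert spaces considered here
  are all those whose underlying set is a subset of the type \<open>'h\<close>, and families are indexed by
  arbitrary subsets of the type \<open>'j\<close>; both types are parameters.
\<close>

definition admissible :: "'j itself \<Rightarrow> 'h itself \<Rightarrow> 'g set \<Rightarrow> 'g norm_relation set \<Rightarrow> bool" where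
  "admissible _ _ G R \<longleftrightarrow>
    (\<forall>(J :: 'j set) (H :: 'j \<Rightarrow> 'h inner_space) \<rho>.
       (\<forall>j\<in>J. hilbert_space (H j) \<and> representation G R (H j) (\<rho> j)) \<longrightarrow>
       hilbert_space (direct_sum J H) \<and>
       representation G R (direct_sum J H) (direct_sum_rep J \<rho>))"


section \<open>The universal C*-algebra\<close>

text \<open>
  The supremum does not depend on \<open>'h\<close> once \<open>'h\<close> has at least as many elements as
  \<open>'g star_word \<Rightarrow> complex\<close>: it is determined by cyclic representations, and every cyclic
  representation lives on a Hilbert space of dimension at most the number of words.
\<close>

definition universal_seminorm ::
  "'h itself \<Rightarrow> 'g set \<Rightarrow> 'g norm_relation set \<Rightarrow> 'g star_poly \<Rightarrow> real" where
  "universal_seminorm _ G R x =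
    Sup {op_norm H (\<rho> x) | (H :: 'h inner_space) \<rho>. hilbert_space H \<and> representation G R H \<rho>}"

definition seminorm_kernel :: "'b star_algebra \<Rightarrow> ('b \<Rightarrow> real) \<Rightarrow> 'b set" where
  "seminorm_kernel B s = {x \<in> carrier B. s x = 0}"

definition seminorm_quotient ::
  "'b star_algebra \<Rightarrow> ('b \<Rightarrow> real) \<Rightarrow> 'b set normed_star_algebra" where
  "seminorm_quotient B s =
    (let N = seminorm_kernel B s in
      \<lparr>carrier = a_rcosets\<^bsub>B\<^esub> N,
       mult = rcoset_mult B N, one = undefined, zero = N, add = set_add B,
       smult = (\<lambda>c X. \<Union>x\<in>X. N +>\<^bsub>B\<^esub> (c \<odot>\<^bsub>B\<^esub> x)),
       star = (\<lambda>X. \<Union>x\<in>X. N +>\<^bsub>B\<^esub> star B x),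
       nrm = (\<lambda>X. s (SOME x. x \<in> X))\<rparr>)"

text \<open>Completion of a normed *-algebra: Cauchy sequences modulo null sequences.\<close>

definition cauchy_seqs :: "'a normed_star_algebra \<Rightarrow> (nat \<Rightarrow> 'a) set" where
  "cauchy_seqs A = {\<sigma>. Metric_space.MCauchy (carrier A) (alg_dist A) \<sigma>}"

definition null_rel :: "'a normed_star_algebra \<Rightarrow> ((nat \<Rightarrow> 'a) \<times> (nat \<Rightarrow> 'a)) set" where
  "null_rel A = {(\<sigma>, \<tau>). \<sigma> \<in> cauchy_seqs A \<and> \<tau> \<in> cauchy_seqs A \<and>
     (\<lambda>n. alg_dist A (\<sigma> n) (\<tau> n)) \<longlonglongrightarrow> 0}"

definition completion :: "'a normed_star_algebra \<Rightarrow> (nat \<Rightarrow> 'a) set normed_star_algebra" where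
  "completion A =
    (let cls = (\<lambda>\<sigma>. null_rel A `` {\<sigma>}) in
      \<lparr>carrier = cauchy_seqs A // null_rel A,
       mult = (\<lambda>X Y. \<Union>\<sigma>\<in>X. \<Union>\<tau>\<in>Y. cls (\<lambda>n. \<sigma> n \<otimes>\<^bsub>A\<^esub> \<tau> n)),
       one = undefined,
       zero = cls (\<lambda>_. \<zero>\<^bsub>A\<^esub>),
       add = (\<lambda>X Y. \<Union>\<sigma>\<in>X. \<Union>\<tau>\<in>Y. cls (\<lambda>n. \<sigma> n \<oplus>\<^bsub>A\<^esub> \<tau> n)),
       smult = (\<lambda>c X. \<Union>\<sigma>\<in>X. cls (\<lambda>n. c \<odot>\<^bsub>A\<^esub> \<sigma> n)),
       star = (\<lambda>X. \<Union>\<sigma>\<in>X. cls (\<lambda>n. star A (\<sigma> n))),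
       nrm = (\<lambda>X. lim (\<lambda>n. nrm A ((SOME \<sigma>. \<sigma> \<in> X) n)))\<rparr>)"

definition pre_universal ::
  "'h itself \<Rightarrow> 'g set \<Rightarrow> 'g norm_relation set \<Rightarrow> 'g star_poly set normed_star_algebra" where
  "pre_universal U G R = seminorm_quotient (free_star_algebra G) (universal_seminorm U G R)"

definition universal_cstar ::
  "'h itself \<Rightarrow> 'g set \<Rightarrow> 'g norm_relation set \<Rightarrow>
    (nat \<Rightarrow> 'g star_poly set) set normed_star_algebra" where
  "universal_cstar U G R = completion (pre_universal U G R)"

definition universal_gen ::
  "'h itself \<Rightarrow> 'g set \<Rightarrow> 'g norm_relation set \<Rightarrow> 'g \<Rightarrow> (nat \<Rightarrow> 'g star_poly set) set" where
  "universal_gen U G R g =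
    (let B = free_star_algebra G; N = seminorm_kernel B (universal_seminorm U G R) in
      null_rel (pre_universal U G R) `` {\<lambda>_. N +>\<^bsub>B\<^esub> free_gen g})"


section \<open>Finite algebraic relations\<close>

text \<open>
  The list \<open>[(\<lambda>\<^sub>1, [i\<^sub>1\<^sub>1, i\<^sub>1\<^sub>2, \<dots>]), \<dots>]\<close> is the formal expression
  \<open>\<Sum>\<^sub>m \<lambda>\<^sub>m \<Prod>\<^sub>n x\<^sub>i\<^sub>m\<^sub>n\<close>. Products have at least one factor.
\<close>

type_synonym 'i expression = "(complex \<times> 'i list) list"

definition expressions :: "'i set \<Rightarrow> 'i expression set" where
  "expressions I = {e. \<forall>(c, w)\<in>set e. w \<noteq> [] \<and> set w \<subseteq> I}"

fun monomial :: "('b, 'm) star_algebra_scheme \<Rightarrow> ('i \<Rightarrow> 'b) \<Rightarrow> 'i list \<Rightarrow> 'b" where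
  "monomial B x [] = undefined"
| "monomial B x [i] = x i"
| "monomial B x (i # j # w) = x i \<otimes>\<^bsub>B\<^esub> monomial B x (j # w)"

fun evaluate :: "('b, 'm) star_algebra_scheme \<Rightarrow> ('i \<Rightarrow> 'b) \<Rightarrow> 'i expression \<Rightarrow> 'b" where
  "evaluate B x [] = \<zero>\<^bsub>B\<^esub>"
| "evaluate B x ((c, w) # e) = (c \<odot>\<^bsub>B\<^esub> monomial B x w) \<oplus>\<^bsub>B\<^esub> evaluate B x e"

definition R0 :: "('a, 'm) star_algebra_scheme \<Rightarrow> 'i set \<Rightarrow> ('i \<Rightarrow> 'a) \<Rightarrow> 'i expression set" where
  "R0 A I q = {e \<in> expressions I. evaluate A q e = \<zero>\<^bsub>A\<^esub>}"

definition R1 :: "'i set \<Rightarrow> 'i norm_relation set" where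
  "R1 I =
    {eq_relation (free_gen i) (star (free_star_algebra I) (free_gen i)) | i. i \<in> I} \<union>
    {eq_relation (star (free_star_algebra I) (free_gen i)) (free_gen i * free_gen i) | i. i \<in> I} \<union>
    {eq_relation (free_gen i * free_gen j) (free_gen j * free_gen i) | i j. i \<in> I \<and> j \<in> I}"

definition R2 :: "('a, 'm) star_algebra_scheme \<Rightarrow> 'i set \<Rightarrow> ('i \<Rightarrow> 'a) \<Rightarrow> 'i norm_relation set" where
  "R2 A I q = {eq_relation (evaluate (free_star_algebra I) free_gen e) 0 | e. e \<in> R0 A I q}"

end

theory Submission
  imports Defs
begin

text \<open>
  Evaluation at the \<open>q\<^sub>i\<close> is a *-homomorphism \<open>\<pi>\<close> from the free *-algebra onto a dense subalgebra
  of \<open>A\<close>, so everything reduces to showing that the universal seminorm of \<open>x\<close> is \<open>\<parallel>\<pi>(x)\<parallel>\<close>.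
  Only the finitely many generators occurring in \<open>x\<close> matter. Splitting a vector \<open>v\<close> as
  \<open>p v + (v - p v)\<close> for each of them in turn reduces the bound \<open>\<parallel>\<rho>(x) v\<parallel> \<le> \<parallel>\<pi>(x)\<parallel> \<parallel>v\<parallel>\<close> for a
  representation \<open>\<rho>\<close> to the case of a joint eigenvector, where the eigenvalue of \<open>\<rho>(x)\<close> is also an
  eigenvalue of multiplication by \<open>\<pi>(x)\<close> because \<open>\<rho>\<close> vanishes on the kernel of \<open>\<pi>\<close>. Splitting
  projections of \<open>A\<close> in the same way bounds \<open>\<parallel>\<pi>(x)\<parallel>\<close> by the values of characters, which come from
  maximal filters of projections and are one-dimensional representations. The first bound also
  gives admissibility, being uniform in \<open>\<rho>\<close>.
\<close>

text \<open>Units are missing throughout: \<open>A\<close> need not have one and the free algebra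
  has no constant terms. Complements are therefore relative, p - p r in \<open>A\<close>, v - p v in
  \<open>H\<close>, y - g y in the free algebra. In \<open>A\<close> a joint unit of finitely many
  projections starts the splitting; in \<open>H\<close> a vector annihilated by all generators of x
  is annihilated by x, since every word has a letter. That a representation vanishes on the kernel
  of evaluation is what \<open>R2\<close> says for words in the generators; \<open>R1\<close> turns
  adjoint letters into generators and so extends it to the whole free algebra. Splitting costs no
  constant: in \<open>H\<close> this is Pythagoras, in \<open>A\<close> the C*-identity brings the
  norm of an orthogonal sum down to the maximum of the two norms. The quotient is then a copy of the
  image of evaluation, and the completion is not checked axiom by axiom: its points are matched with
  limits in \<open>A\<close> and all structure is carried over.\<close>

section \<open>Complex scalars, complete metric spaces, and transport of groups and metrics along
  maps\<close>

lemma complex_field_simps [simp]: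
  "carrier complex_field = UNIV" "mult complex_field = (*)" "one complex_field = 1"
  "zero complex_field = 0" "add complex_field = (+)"
  by (simp_all add: complex_field_def)

lemma cring_complex_field: "cring complex_field"
proof (rule cringI)
  show "abelian_group complex_field"
  proof (rule abelian_groupI)
    show "\<exists>y\<in>carrier complex_field. y \<oplus>\<^bsub>complex_field\<^esub> x = \<zero>\<^bsub>complex_field\<^esub>" for x
      by (intro bexI[of _ "- x"]) simp_all
  qed (auto simp: algebra_simps)
  show "comm_monoid complex_field"
    by (rule comm_monoidI) auto
qed (auto simp: algebra_simps)

lemma complex_field_minus [simp]: "\<ominus>\<^bsub>complex_field\<^esub> c = - c"
proof -
  interpret cring complex_field by (rule cring_complex_field)
  have "c \<oplus>\<^bsub>complex_field\<^esub> (- c) = \<zero>\<^bsub>complex_field\<^esub>" by simp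
  then show ?thesis
    using add.inv_equality[of "- c" c] by (simp add: a_inv_def)
qed

context Metric_space
begin

text \<open>Completeness in terms of real null sequences \<open>d (\<sigma> n) x\<close>, so that
  later arguments stay with estimates of norms instead of limits in a topology.\<close>

lemma mcompleteI_tendsto:
  assumes "\<And>\<sigma>. range \<sigma> \<subseteq> M \<Longrightarrow> (\<And>\<epsilon>. \<epsilon> > 0 \<Longrightarrow> \<exists>N. \<forall>m\<ge>N. \<forall>n\<ge>N. d (\<sigma> m) (\<sigma> n) < \<epsilon>) \<Longrightarrow>
    \<exists>x\<in>M. (\<lambda>n. d (\<sigma> n) x) \<longlonglongrightarrow> 0"
  shows mcomplete
  unfolding mcomplete_def
proof safe
  fix \<sigma> :: "nat \<Rightarrow> 'a" assume "MCauchy \<sigma>"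
  then have r: "range \<sigma> \<subseteq> M" and c: "\<And>\<epsilon>. \<epsilon> > 0 \<Longrightarrow> \<exists>N. \<forall>m\<ge>N. \<forall>n\<ge>N. d (\<sigma> m) (\<sigma> n) < \<epsilon>"
    by (simp_all add: MCauchy_def)
  obtain x where "x \<in> M" "(\<lambda>n. d (\<sigma> n) x) \<longlonglongrightarrow> 0"
    using assms[OF r c] by blast
  then show "\<exists>x. limitin mtopology \<sigma> x sequentially"
    unfolding limitin_metric_dist_null using r by (intro exI[of _ x] conjI always_eventually) auto
qed

lemma mcompleteD_tendsto:
  assumes mcomplete "range \<sigma> \<subseteq> M" "\<And>\<epsilon>. \<epsilon> > 0 \<Longrightarrow> \<exists>N. \<forall>m\<ge>N. \<forall>n\<ge>N. d (\<sigma> m) (\<sigma> n) < \<epsilon>"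
  obtains x where "x \<in> M" "(\<lambda>n. d (\<sigma> n) x) \<longlonglongrightarrow> 0"
proof -
  have "MCauchy \<sigma>"
    unfolding MCauchy_def using assms(2,3) by simp
  then obtain x where "limitin mtopology \<sigma> x sequentially"
    using assms(1) unfolding mcomplete_def by auto
  then show ?thesis
    using that unfolding limitin_metric_dist_null by auto
qed

lemma MCauchyI_tendsto:
  assumes "range \<sigma> \<subseteq> M" "x \<in> M" "(\<lambda>n. d (\<sigma> n) x) \<longlonglongrightarrow> 0"
  shows "MCauchy \<sigma>"
proof (rule convergent_imp_MCauchy)
  show "limitin mtopology \<sigma> x sequentially"
    unfolding limitin_metric_dist_null using assms by (intro conjI always_eventually) auto
qed fact

end

context abelian_group
begin

lemma minus_eq_iff: "x \<in> carrier G \<Longrightarrow> y \<in> carrier G \<Longrightarrow> x \<ominus> y = \<zero> \<longleftrightarrow> x = y"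
  by (metis a_minus_def add.inv_closed add.inv_equality add.inv_inv r_neg)

lemma minus_add_minus:
  "x \<in> carrier G \<Longrightarrow> y \<in> carrier G \<Longrightarrow> z \<in> carrier G \<Longrightarrow> (x \<ominus> y) \<oplus> (y \<ominus> z) = x \<ominus> z"
  by (simp add: a_minus_def a_assoc r_neg1)

end

text \<open>The source of group laws for every record that is only a renamed copy of a known group:
  the completion, the quotient by the seminorm kernel, the one-dimensional Hilbert space.
  Differences need a separate conclusion because the inverse of a record is determined only by its
  group laws.\<close>

lemma abelian_group_image:
  assumes "abelian_group G" and S: "S \<subseteq> carrier G" "\<zero>\<^bsub>G\<^esub> \<in> S"
    "\<And>a b. a \<in> S \<Longrightarrow> b \<in> S \<Longrightarrow> a \<oplus>\<^bsub>G\<^esub> b \<in> S" "\<And>a. a \<in> S \<Longrightarrow> \<ominus>\<^bsub>G\<^esub> a \<in> S"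
    and \<psi>: "inj_on \<psi> S" and U: "carrier U = \<psi> ` S" "\<zero>\<^bsub>U\<^esub> = \<psi> \<zero>\<^bsub>G\<^esub>"
    and add: "\<And>a b. a \<in> S \<Longrightarrow> b \<in> S \<Longrightarrow> \<psi> a \<oplus>\<^bsub>U\<^esub> \<psi> b = \<psi> (a \<oplus>\<^bsub>G\<^esub> b)"
  shows "abelian_group U"
    and "a \<in> S \<Longrightarrow> b \<in> S \<Longrightarrow> \<psi> a \<ominus>\<^bsub>U\<^esub> \<psi> b = \<psi> (a \<ominus>\<^bsub>G\<^esub> b)"
proof -
  interpret G: abelian_group G by fact
  have cl: "a \<in> carrier G" if "a \<in> S" for a
    using S(1) that by blast
  show "abelian_group U"
  proof (rule abelian_groupI)
    fix x y z assume "x \<in> carrier U" "y \<in> carrier U" "z \<in> carrier U"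
    then obtain a b c where "a \<in> S" "b \<in> S" "c \<in> S" "x = \<psi> a" "y = \<psi> b" "z = \<psi> c"
      unfolding U by blast
    then show "x \<oplus>\<^bsub>U\<^esub> y \<oplus>\<^bsub>U\<^esub> z = x \<oplus>\<^bsub>U\<^esub> (y \<oplus>\<^bsub>U\<^esub> z)"
      by (simp add: add S cl G.a_assoc)
  next
    fix x y assume "x \<in> carrier U" "y \<in> carrier U"
    then obtain a b where "a \<in> S" "b \<in> S" "x = \<psi> a" "y = \<psi> b"
      unfolding U by blast
    then show "x \<oplus>\<^bsub>U\<^esub> y = y \<oplus>\<^bsub>U\<^esub> x" and "x \<oplus>\<^bsub>U\<^esub> y \<in> carrier U"
      by (simp_all add: add S cl G.a_comm U)
  next
    fix x assume "x \<in> carrier U"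
    then obtain a where a: "a \<in> S" "x = \<psi> a"
      unfolding U by blast
    then show "\<zero>\<^bsub>U\<^esub> \<oplus>\<^bsub>U\<^esub> x = x"
      by (simp add: add S cl U)
    show "\<exists>y\<in>carrier U. y \<oplus>\<^bsub>U\<^esub> x = \<zero>\<^bsub>U\<^esub>"
      using a by (intro bexI[of _ "\<psi> (\<ominus>\<^bsub>G\<^esub> a)"]) (simp_all add: add S cl U G.l_neg)
  qed (simp add: U S)
  then interpret U: abelian_group U .
  assume a: "a \<in> S" and b: "b \<in> S"
  have "\<psi> (\<ominus>\<^bsub>G\<^esub> b) \<oplus>\<^bsub>U\<^esub> \<psi> b = \<zero>\<^bsub>U\<^esub>"
    using b by (simp add: add S cl U G.l_neg)
  then have "\<ominus>\<^bsub>U\<^esub> \<psi> b = \<psi> (\<ominus>\<^bsub>G\<^esub> b)"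
    using b by (intro U.minus_equality) (simp_all add: U S)
  then show "\<psi> a \<ominus>\<^bsub>U\<^esub> \<psi> b = \<psi> (a \<ominus>\<^bsub>G\<^esub> b)"
    using a b by (simp add: a_minus_def add S)
qed

lemma Metric_space_pullback:
  assumes "Metric_space M d" and "inj_on \<theta> M'" and "\<theta> ` M' \<subseteq> M"
    and d': "\<And>x y. d' x y = (if x \<in> M' \<and> y \<in> M' then d (\<theta> x) (\<theta> y) else 0)"
  shows "Metric_space M' d'"
proof -
  interpret Metric_space M d by fact
  have cl: "\<theta> x \<in> M" if "x \<in> M'" for x
    using assms(3) that by blast
  show ?thesis
  proof
    fix x y z
    show "0 \<le> d' x y" "d' x y = d' y x"
      by (simp_all add: d' commute)
    show "x \<in> M' \<Longrightarrow> y \<in> M' \<Longrightarrow> (d' x y = 0) = (x = y)"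
      using assms(2) cl by (auto simp: d' inj_on_eq_iff)
    show "x \<in> M' \<Longrightarrow> y \<in> M' \<Longrightarrow> z \<in> M' \<Longrightarrow> d' x z \<le> d' x y + d' y z"
      using cl by (simp add: d' triangle)
  qed
qed

text \<open>The shape of \<open>d'\<close>, with value 0 off the carrier, is that of
  \<open>alg_dist\<close> and \<open>vec_dist\<close>; an isometric bijection carries Cauchy
  sequences forward and their limits back.\<close>

lemma mcomplete_pullback:
  assumes "Metric_space M d" and "bij_betw \<theta> M' M"
    and d': "\<And>x y. d' x y = (if x \<in> M' \<and> y \<in> M' then d (\<theta> x) (\<theta> y) else 0)"
    and "Metric_space.mcomplete M d"
  shows "Metric_space.mcomplete M' d'"
proof -
  interpret Metric_space M d by fact
  have \<theta>: "inj_on \<theta> M'" "\<theta> ` M' = M"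
    using assms(2) by (simp_all add: bij_betw_def)
  interpret M': Metric_space M' d'
    using assms(1) \<theta>(1) _ d' by (rule Metric_space_pullback) (simp add: \<theta>)
  show ?thesis
  proof (rule M'.mcompleteI_tendsto)
    fix \<sigma> :: "nat \<Rightarrow> _"
    assume r: "range \<sigma> \<subseteq> M'" and c: "\<And>\<epsilon>. \<epsilon> > 0 \<Longrightarrow> \<exists>N. \<forall>m\<ge>N. \<forall>n\<ge>N. d' (\<sigma> m) (\<sigma> n) < \<epsilon>"
    have s: "\<sigma> n \<in> M'" for n using r by blast
    have "range (\<theta> \<circ> \<sigma>) \<subseteq> M" using s \<theta> by auto
    moreover have "\<exists>N. \<forall>m\<ge>N. \<forall>n\<ge>N. d ((\<theta> \<circ> \<sigma>) m) ((\<theta> \<circ> \<sigma>) n) < \<epsilon>" if "\<epsilon> > 0" for \<epsilon>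
      using c[OF that] s by (simp add: d')
    ultimately obtain a where a: "a \<in> M" "(\<lambda>n. d ((\<theta> \<circ> \<sigma>) n) a) \<longlonglongrightarrow> 0"
      using mcompleteD_tendsto assms(4) by metis
    then obtain x where "x \<in> M'" "a = \<theta> x" using \<theta> by blast
    with a s show "\<exists>x\<in>M'. (\<lambda>n. d' (\<sigma> n) x) \<longlonglongrightarrow> 0"
      by (intro bexI[of _ x]) (simp_all add: d')
  qed
qed

section \<open>C*-algebras\<close>

text \<open>Common ground of C*-algebras and inner product spaces: the module laws with the
  operations of \<open>complex_field\<close> replaced by ordinary complex arithmetic.\<close>

locale complex_space = Module.module complex_field V
  for V :: "(complex, 'v, 'm) module_scheme" (structure)
begin

lemma smult_add_left: "x \<in> carrier V \<Longrightarrow> (c + d) \<odot> x = c \<odot> x \<oplus> d \<odot> x"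
  using smult_l_distr[of c d x] by simp

lemma smult_add_right: "x \<in> carrier V \<Longrightarrow> y \<in> carrier V \<Longrightarrow> c \<odot> (x \<oplus> y) = c \<odot> x \<oplus> c \<odot> y"
  using smult_r_distr[of c x y] by simp

lemma smult_smult: "x \<in> carrier V \<Longrightarrow> c \<odot> (d \<odot> x) = (c * d) \<odot> x"
  using smult_assoc1[of c d x] by simp

lemma smult_1 [simp]: "x \<in> carrier V \<Longrightarrow> 1 \<odot> x = x"
  using smult_one by simp

lemma smult_0 [simp]: "x \<in> carrier V \<Longrightarrow> 0 \<odot> x = \<zero>"
  using smult_l_null by simp

lemma smult_zero [simp]: "c \<odot> \<zero> = \<zero>"
  using smult_r_null by simp

lemma smult_minus_1: "x \<in> carrier V \<Longrightarrow> (- 1) \<odot> x = \<ominus> x"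
  using smult_l_minus[of 1 x] by simp

lemma smult_diff: "x \<in> carrier V \<Longrightarrow> y \<in> carrier V \<Longrightarrow> c \<odot> (x \<ominus> y) = c \<odot> x \<ominus> c \<odot> y"
proof -
  assume "x \<in> carrier V" "y \<in> carrier V"
  then have "c \<odot> (\<ominus> y) = \<ominus> (c \<odot> y)"
    by (simp add: smult_smult flip: smult_minus_1)
  then show "x \<in> carrier V \<Longrightarrow> y \<in> carrier V \<Longrightarrow> ?thesis"
    by (simp add: a_minus_def smult_add_right)
qed

lemma diff_swap: "x \<in> carrier V \<Longrightarrow> y \<in> carrier V \<Longrightarrow> y \<ominus> x = \<ominus> (x \<ominus> y)"
  by (simp add: a_minus_def minus_add a_comm)

lemma diff_add_cancel: "x \<in> carrier V \<Longrightarrow> y \<in> carrier V \<Longrightarrow> (x \<ominus> y) \<oplus> y = x"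
  by (simp add: a_minus_def a_assoc l_neg)

end

context cstar_algebra
begin

sublocale complex_space A ..

lemma zero_mult [simp]: "x \<in> carrier A \<Longrightarrow> \<zero> \<otimes> x = \<zero>"
  using smult_mult_left[of x x 0] mult_closed[of x x] by simp

lemma mult_zero [simp]: "x \<in> carrier A \<Longrightarrow> x \<otimes> \<zero> = \<zero>"
  using smult_mult_right[of x x 0] mult_closed[of x x] by simp

lemma mult_minus_right: "x \<in> carrier A \<Longrightarrow> y \<in> carrier A \<Longrightarrow> x \<otimes> (\<ominus> y) = \<ominus> (x \<otimes> y)"
  using smult_mult_right[of x y "-1"] by (simp add: smult_minus_1 mult_closed)

lemma mult_minus_left: "x \<in> carrier A \<Longrightarrow> y \<in> carrier A \<Longrightarrow> (\<ominus> x) \<otimes> y = \<ominus> (x \<otimes> y)"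
  using smult_mult_left[of x y "-1"] by (simp add: smult_minus_1 mult_closed)

lemma mult_diff_right:
  "x \<in> carrier A \<Longrightarrow> y \<in> carrier A \<Longrightarrow> z \<in> carrier A \<Longrightarrow> x \<otimes> (y \<ominus> z) = x \<otimes> y \<ominus> x \<otimes> z"
  by (simp add: a_minus_def mult_add_right mult_minus_right)

lemma mult_diff_left:
  "x \<in> carrier A \<Longrightarrow> y \<in> carrier A \<Longrightarrow> z \<in> carrier A \<Longrightarrow> (x \<ominus> y) \<otimes> z = x \<otimes> z \<ominus> y \<otimes> z"
  by (simp add: a_minus_def mult_add_left mult_minus_left)

lemma star_zero [simp]: "star A \<zero> = \<zero>"
  using star_smult[of \<zero> 0] star_closed[of \<zero>] by simp

lemma star_diff: "x \<in> carrier A \<Longrightarrow> y \<in> carrier A \<Longrightarrow> star A (x \<ominus> y) = star A x \<ominus> star A y"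
  using star_smult[of y "-1"] by (simp add: a_minus_def star_add smult_minus_1 star_closed)

lemma nrm_zero [simp]: "nrm A \<zero> = 0"
  by (simp add: nrm_eq_0_iff)

lemma nrm_minus: "x \<in> carrier A \<Longrightarrow> nrm A (\<ominus> x) = nrm A x"
  using nrm_smult[of x "-1"] by (simp add: smult_minus_1)

lemma nrm_diff_commute: "x \<in> carrier A \<Longrightarrow> y \<in> carrier A \<Longrightarrow> nrm A (x \<ominus> y) = nrm A (y \<ominus> x)"
  using nrm_minus[of "x \<ominus> y"] diff_swap[of x y] by simp

lemma nrm_diff_triangle:
  "x \<in> carrier A \<Longrightarrow> y \<in> carrier A \<Longrightarrow> z \<in> carrier A \<Longrightarrow>
    nrm A (x \<ominus> z) \<le> nrm A (x \<ominus> y) + nrm A (y \<ominus> z)"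
  using nrm_triangle[of "x \<ominus> y" "y \<ominus> z"] by (simp add: minus_add_minus)

lemma abs_nrm_diff:
  assumes "x \<in> carrier A" "y \<in> carrier A"
  shows "\<bar>nrm A x - nrm A y\<bar> \<le> nrm A (x \<ominus> y)"
  using nrm_triangle[of "x \<ominus> y" y] nrm_triangle[of "y \<ominus> x" x] assms
  by (simp add: diff_add_cancel abs_le_iff nrm_diff_commute[of y x])

lemma nrm_star: 
  assumes x: "x \<in> carrier A"
  shows "nrm A (star A x) = nrm A x"
proof -
  have *: "nrm A y \<le> nrm A (star A y)" if y: "y \<in> carrier A" for y
  proof (cases "nrm A y = 0")
    case True
    then show ?thesis using nrm_nonneg star_closed y by simp
  next
    case False
    have "nrm A y * nrm A y \<le> nrm A (star A y) * nrm A y"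
      using nrm_mult[of "star A y" y] cstar_identity[OF y] star_closed[OF y] y
      by (simp add: power2_eq_square)
    then show ?thesis
      using False nrm_nonneg[OF y] by simp
  qed
  show ?thesis
    using *[OF x] *[OF star_closed[OF x]] by (simp add: star_star x)
qed

sublocale metric: Metric_space "carrier A" "alg_dist A"
proof
  fix x y z
  show "0 \<le> alg_dist A x y" "alg_dist A x y = alg_dist A y x"
    by (simp_all add: alg_dist_def nrm_nonneg nrm_diff_commute)
  show "x \<in> carrier A \<Longrightarrow> y \<in> carrier A \<Longrightarrow> (alg_dist A x y = 0) = (x = y)"
    by (simp add: alg_dist_def nrm_eq_0_iff minus_eq_iff)
  show "x \<in> carrier A \<Longrightarrow> y \<in> carrier A \<Longrightarrow> z \<in> carrier A \<Longrightarrow>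
    alg_dist A x z \<le> alg_dist A x y + alg_dist A y z"
    by (simp add: alg_dist_def nrm_diff_triangle)
qed

text \<open>Membership of the sequence and of its limit in the carrier is built in, so that the
  limit laws below compose without side conditions.\<close>

definition tends :: "(nat \<Rightarrow> 'a) \<Rightarrow> 'a \<Rightarrow> bool" where
  "tends \<sigma> a \<longleftrightarrow> (\<forall>n. \<sigma> n \<in> carrier A) \<and> a \<in> carrier A \<and> (\<lambda>n. nrm A (\<sigma> n \<ominus> a)) \<longlonglongrightarrow> 0"

lemma tends_const: "a \<in> carrier A \<Longrightarrow> tends (\<lambda>_. a) a"
  by (simp add: tends_def a_minus_def r_neg)

lemma tendsD:
  "tends \<sigma> a \<Longrightarrow> \<sigma> n \<in> carrier A" "tends \<sigma> a \<Longrightarrow> a \<in> carrier A"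
  "tends \<sigma> a \<Longrightarrow> (\<lambda>n. nrm A (\<sigma> n \<ominus> a)) \<longlonglongrightarrow> 0"
  by (simp_all add: tends_def)

lemma tendsI_le:
  assumes "\<And>n. \<sigma> n \<in> carrier A" "a \<in> carrier A" "g \<longlonglongrightarrow> 0" "\<And>n. nrm A (\<sigma> n \<ominus> a) \<le> g n"
  shows "tends \<sigma> a"
  unfolding tends_def
  using assms
  by (auto simp: nrm_nonneg intro!: always_eventually tendsto_sandwich[OF _ _ tendsto_const assms(3)])

lemma tends_nrm:
  assumes "tends \<sigma> a"
  shows "(\<lambda>n. nrm A (\<sigma> n)) \<longlonglongrightarrow> nrm A a"
proof -
  have "(\<lambda>n. nrm A (\<sigma> n) - nrm A a) \<longlonglongrightarrow> 0"
    using tendsD(3)[OF assms]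
    by (rule tendsto_0_le[where K = 1])
      (simp add: abs_nrm_diff tendsD[OF assms] nrm_nonneg)
  then show ?thesis by (simp add: LIM_zero_iff)
qed

lemma tends_add:
  assumes "tends \<sigma> a" "tends \<tau> b"
  shows "tends (\<lambda>n. \<sigma> n \<oplus> \<tau> n) (a \<oplus> b)"
proof (rule tendsI_le)
  note [simp] = tendsD(1,2)[OF assms(1)] tendsD(1,2)[OF assms(2)]
  show "(\<lambda>n. nrm A (\<sigma> n \<ominus> a) + nrm A (\<tau> n \<ominus> b)) \<longlonglongrightarrow> 0"
    using tendsto_add[OF assms[THEN tendsD(3)]] by simp
  show "nrm A ((\<sigma> n \<oplus> \<tau> n) \<ominus> (a \<oplus> b)) \<le> nrm A (\<sigma> n \<ominus> a) + nrm A (\<tau> n \<ominus> b)" for n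
    using nrm_triangle[of "\<sigma> n \<ominus> a" "\<tau> n \<ominus> b"] by (simp add: a_minus_def minus_add a_ac)
qed (simp_all add: tendsD[OF assms(1)] tendsD[OF assms(2)])

lemma tends_mult:
  assumes "tends \<sigma> a" "tends \<tau> b"
  shows "tends (\<lambda>n. \<sigma> n \<otimes> \<tau> n) (a \<otimes> b)"
proof (rule tendsI_le)
  note [simp] = tendsD(1,2)[OF assms(1)] tendsD(1,2)[OF assms(2)]
  show "(\<lambda>n. nrm A (\<sigma> n) * nrm A (\<tau> n \<ominus> b) + nrm A (\<sigma> n \<ominus> a) * nrm A b) \<longlonglongrightarrow> 0"
    using tendsto_add[OF tendsto_mult[OF tends_nrm[OF assms(1)] tendsD(3)[OF assms(2)]]
      tendsto_mult[OF tendsD(3)[OF assms(1)] tendsto_const]] by simp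
  show "nrm A ((\<sigma> n \<otimes> \<tau> n) \<ominus> (a \<otimes> b)) \<le> nrm A (\<sigma> n) * nrm A (\<tau> n \<ominus> b) + nrm A (\<sigma> n \<ominus> a) * nrm A b" for n
  proof -
    have "(\<sigma> n \<otimes> \<tau> n) \<ominus> (a \<otimes> b) = \<sigma> n \<otimes> (\<tau> n \<ominus> b) \<oplus> (\<sigma> n \<ominus> a) \<otimes> b"
      by (simp add: mult_diff_left mult_diff_right mult_closed minus_add_minus)
    then have "nrm A ((\<sigma> n \<otimes> \<tau> n) \<ominus> (a \<otimes> b)) \<le> nrm A (\<sigma> n \<otimes> (\<tau> n \<ominus> b)) + nrm A ((\<sigma> n \<ominus> a) \<otimes> b)"
      by (simp add: nrm_triangle mult_closed)
    then show ?thesis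
      using nrm_mult[of "\<sigma> n" "\<tau> n \<ominus> b"] nrm_mult[of "\<sigma> n \<ominus> a" b] by simp
  qed
qed (simp_all add: tendsD[OF assms(1)] tendsD[OF assms(2)] mult_closed)

lemma tends_smult:
  assumes "tends \<sigma> a"
  shows "tends (\<lambda>n. c \<odot> \<sigma> n) (c \<odot> a)"
proof (rule tendsI_le)
  show "(\<lambda>n. cmod c * nrm A (\<sigma> n \<ominus> a)) \<longlonglongrightarrow> 0"
    using tendsto_mult[OF tendsto_const tendsD(3)[OF assms]] by simp
  show "nrm A (c \<odot> \<sigma> n \<ominus> c \<odot> a) \<le> cmod c * nrm A (\<sigma> n \<ominus> a)" for n
    by (simp add: tendsD[OF assms] flip: smult_diff nrm_smult)
qed (simp_all add: tendsD[OF assms])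

lemma tends_star:
  assumes "tends \<sigma> a"
  shows "tends (\<lambda>n. star A (\<sigma> n)) (star A a)"
proof (rule tendsI_le)
  show "nrm A (star A (\<sigma> n) \<ominus> star A a) \<le> nrm A (\<sigma> n \<ominus> a)" for n
    by (simp add: tendsD[OF assms] nrm_star flip: star_diff)
qed (simp_all add: tendsD[OF assms] star_closed)

lemma tends_unique:
  assumes "tends \<sigma> a" "tends \<sigma> b"
  shows "a = b"
proof -
  note [simp] = tendsD(1,2)[OF assms(1)] tendsD(1,2)[OF assms(2)]
  have "nrm A (a \<ominus> b) \<le> nrm A (\<sigma> n \<ominus> a) + nrm A (\<sigma> n \<ominus> b)" for n
    using nrm_diff_triangle[of a "\<sigma> n" b] by (simp add: nrm_diff_commute[of a])
  then have "nrm A (a \<ominus> b) \<le> 0"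
    using tendsto_add[OF assms[THEN tendsD(3)]] by (intro LIMSEQ_le_const) auto
  then have "nrm A (a \<ominus> b) = 0"
    using nrm_nonneg[of "a \<ominus> b"] by simp
  then show ?thesis
    by (simp add: nrm_eq_0_iff minus_eq_iff)
qed

end

text \<open>Every axiom is an equation or inequality between values of the operations, hence passes
  along a bijection that respects them; completeness is pulled back along the inverse of
  \<open>\<psi>\<close>. This is how the space of classes of Cauchy sequences becomes a
  C*-algebra.\<close>

lemma cstar_algebra_transport:
  fixes A :: "('a, 'm) normed_star_algebra_scheme" and U :: "('b, 'n) normed_star_algebra_scheme"
  assumes "cstar_algebra A" and \<psi>: "bij_betw \<psi> (carrier A) (carrier U)"
    and zero: "\<zero>\<^bsub>U\<^esub> = \<psi> \<zero>\<^bsub>A\<^esub>"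
    and add: "\<And>a b. a \<in> carrier A \<Longrightarrow> b \<in> carrier A \<Longrightarrow> \<psi> a \<oplus>\<^bsub>U\<^esub> \<psi> b = \<psi> (a \<oplus>\<^bsub>A\<^esub> b)"
    and mult: "\<And>a b. a \<in> carrier A \<Longrightarrow> b \<in> carrier A \<Longrightarrow> \<psi> a \<otimes>\<^bsub>U\<^esub> \<psi> b = \<psi> (a \<otimes>\<^bsub>A\<^esub> b)"
    and smult: "\<And>c a. a \<in> carrier A \<Longrightarrow> c \<odot>\<^bsub>U\<^esub> \<psi> a = \<psi> (c \<odot>\<^bsub>A\<^esub> a)"
    and star: "\<And>a. a \<in> carrier A \<Longrightarrow> star U (\<psi> a) = \<psi> (star A a)"
    and nrm: "\<And>a. a \<in> carrier A \<Longrightarrow> nrm U (\<psi> a) = nrm A a"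
  shows "cstar_algebra U"
proof -
  interpret A: cstar_algebra A by fact
  have inj: "inj_on \<psi> (carrier A)" and U: "carrier U = \<psi> ` carrier A"
    using \<psi> by (auto simp: bij_betw_def)
  have gr: "abelian_group U"
    by (rule abelian_group_image[OF A.M.abelian_group_axioms _ _ _ _ inj U zero])
       (auto simp: add)
  have diff: "\<psi> a \<ominus>\<^bsub>U\<^esub> \<psi> b = \<psi> (a \<ominus>\<^bsub>A\<^esub> b)" if "a \<in> carrier A" "b \<in> carrier A" for a b
    by (rule abelian_group_image[OF A.M.abelian_group_axioms _ _ _ _ inj U zero])
       (auto simp: add that)
  have E: "\<exists>a\<in>carrier A. x = \<psi> a" if "x \<in> carrier U" for x
    using that U by blast
  have cl [simp]: "\<psi> a \<in> carrier U" if "a \<in> carrier A" for a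
    using that U by blast
  note simps = zero add mult smult star nrm A.mult_closed A.star_closed
  let ?\<theta> = "inv_into (carrier A) \<psi>"
  have \<theta>: "?\<theta> (\<psi> a) = a" if "a \<in> carrier A" for a
    using inj that by simp
  have mod: "Module.module complex_field U"
  proof (rule moduleI[OF cring_complex_field gr])
    fix a b :: complex and x y assume x: "x \<in> carrier U" and y: "y \<in> carrier U"
    obtain u where u: "u \<in> carrier A" "x = \<psi> u" using E x by blast
    obtain v where v: "v \<in> carrier A" "y = \<psi> v" using E y by blast
    show "a \<odot>\<^bsub>U\<^esub> (x \<oplus>\<^bsub>U\<^esub> y) = a \<odot>\<^bsub>U\<^esub> x \<oplus>\<^bsub>U\<^esub> a \<odot>\<^bsub>U\<^esub> y"
      using u v by (simp add: simps A.smult_add_right)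
  qed (use E in \<open>force simp: simps A.smult_add_left A.smult_smult\<close>)+
  show ?thesis
  proof (rule cstar_algebra.intro[OF mod], unfold_locales)
    fix x y z c assume x: "x \<in> carrier U" and y: "y \<in> carrier U" and z: "z \<in> carrier U"
    obtain u where u: "u \<in> carrier A" "x = \<psi> u" using E x by blast
    obtain v where v: "v \<in> carrier A" "y = \<psi> v" using E y by blast
    obtain w where w: "w \<in> carrier A" "z = \<psi> w" using E z by blast
    show "(x \<otimes>\<^bsub>U\<^esub> y) \<otimes>\<^bsub>U\<^esub> z = x \<otimes>\<^bsub>U\<^esub> (y \<otimes>\<^bsub>U\<^esub> z)"
      "(x \<oplus>\<^bsub>U\<^esub> y) \<otimes>\<^bsub>U\<^esub> z = (x \<otimes>\<^bsub>U\<^esub> z) \<oplus>\<^bsub>U\<^esub> (y \<otimes>\<^bsub>U\<^esub> z)"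
      "x \<otimes>\<^bsub>U\<^esub> (y \<oplus>\<^bsub>U\<^esub> z) = (x \<otimes>\<^bsub>U\<^esub> y) \<oplus>\<^bsub>U\<^esub> (x \<otimes>\<^bsub>U\<^esub> z)"
      using u v w by (simp_all add: simps A.mult_assoc A.mult_add_left A.mult_add_right)
  next
    fix x y c assume x: "x \<in> carrier U" and y: "y \<in> carrier U"
    obtain u where u: "u \<in> carrier A" "x = \<psi> u" using E x by blast
    obtain v where v: "v \<in> carrier A" "y = \<psi> v" using E y by blast
    show "x \<otimes>\<^bsub>U\<^esub> y \<in> carrier U"
      "(c \<odot>\<^bsub>U\<^esub> x) \<otimes>\<^bsub>U\<^esub> y = c \<odot>\<^bsub>U\<^esub> (x \<otimes>\<^bsub>U\<^esub> y)"
      "x \<otimes>\<^bsub>U\<^esub> (c \<odot>\<^bsub>U\<^esub> y) = c \<odot>\<^bsub>U\<^esub> (x \<otimes>\<^bsub>U\<^esub> y)"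
      "star U (x \<oplus>\<^bsub>U\<^esub> y) = star U x \<oplus>\<^bsub>U\<^esub> star U y"
      "star U (x \<otimes>\<^bsub>U\<^esub> y) = star U y \<otimes>\<^bsub>U\<^esub> star U x"
      "nrm U (x \<oplus>\<^bsub>U\<^esub> y) \<le> nrm U x + nrm U y"
      "nrm U (x \<otimes>\<^bsub>U\<^esub> y) \<le> nrm U x * nrm U y"
      using u v by (simp_all add: simps A.smult_mult_left A.smult_mult_right A.star_add A.star_mult
          A.nrm_triangle A.nrm_mult)
  next
    fix x c assume x: "x \<in> carrier U"
    obtain u where u: "u \<in> carrier A" "x = \<psi> u" using E x by blast
    show "star U x \<in> carrier U" "star U (star U x) = x" "0 \<le> nrm U x"
      "star U (c \<odot>\<^bsub>U\<^esub> x) = cnj c \<odot>\<^bsub>U\<^esub> star U x"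
      "nrm U (c \<odot>\<^bsub>U\<^esub> x) = cmod c * nrm U x"
      "nrm U (star U x \<otimes>\<^bsub>U\<^esub> x) = (nrm U x)\<^sup>2"
      using u by (simp_all add: simps A.star_star A.nrm_nonneg A.star_smult A.nrm_smult
          A.cstar_identity)
    show "(nrm U x = 0) = (x = \<zero>\<^bsub>U\<^esub>)"
      using u inj by (simp add: simps A.nrm_eq_0_iff inj_on_eq_iff)
  next
    have "bij_betw ?\<theta> (carrier U) (carrier A)"
      using \<psi> by (rule bij_betw_inv_into)
    moreover have "alg_dist U x y =
      (if x \<in> carrier U \<and> y \<in> carrier U then alg_dist A (?\<theta> x) (?\<theta> y) else 0)" for x y
    proof (cases "x \<in> carrier U \<and> y \<in> carrier U")
      case True
      then obtain u v where "u \<in> carrier A" "x = \<psi> u" "v \<in> carrier A" "y = \<psi> v"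
        using E by blast
      then show ?thesis
        by (simp add: alg_dist_def diff \<theta> nrm)
    qed (auto simp: alg_dist_def)
    ultimately show "Metric_space.mcomplete (carrier U) (alg_dist U)"
      using mcomplete_pullback A.metric.Metric_space_axioms A.complete by metis
  qed
qed

section \<open>Completion of a dense isometric copy\<close>

text \<open>Meant for \<open>C\<close> the Cauchy sequences and \<open>cl a\<close> those with limit
  \<open>a\<close>: once each class is described by its limit, the quotient is indexed by the points
  of \<open>A\<close>.\<close>

lemma quotient_image_classes:
  assumes "\<And>\<sigma>. \<sigma> \<in> C \<longleftrightarrow> (\<exists>a\<in>S. \<sigma> \<in> cl a)" and "\<And>a \<sigma>. a \<in> S \<Longrightarrow> \<sigma> \<in> cl a \<Longrightarrow> r `` {\<sigma>} = cl a"
    and "\<And>a. a \<in> S \<Longrightarrow> cl a \<noteq> {}"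
  shows "C // r = cl ` S"
proof (intro equalityI subsetI)
  fix X assume "X \<in> C // r"
  then show "X \<in> cl ` S"
    using assms(1,2) by (auto elim!: quotientE)
next
  fix X assume "X \<in> cl ` S"
  then obtain a where a: "a \<in> S" "X = cl a" by blast
  then obtain \<sigma> where "\<sigma> \<in> cl a" using assms(3) by blast
  with a have "\<sigma> \<in> C" "X = r `` {\<sigma>}"
    using assms(1)[of \<sigma>] assms(2)[of a \<sigma>] by blast+
  then show "X \<in> C // r"
    by (simp add: quotientI)
qed

text \<open>Of \<open>P\<close> only the group laws and closure under the operations are recorded;
  everything else about its completion is read off in \<open>A\<close> through
  \<open>\<theta>\<close>.\<close>

locale isometric_dense_embedding = cstar_algebra A
  for A :: "('a, 'm) normed_star_algebra_scheme" (structure) +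
  fixes P :: "'p normed_star_algebra" and \<theta> :: "'p \<Rightarrow> 'a"
  assumes P_group: "abelian_group P"
    and P_closed: "x \<in> carrier P \<Longrightarrow> y \<in> carrier P \<Longrightarrow> x \<otimes>\<^bsub>P\<^esub> y \<in> carrier P"
      "x \<in> carrier P \<Longrightarrow> c \<odot>\<^bsub>P\<^esub> x \<in> carrier P" "x \<in> carrier P \<Longrightarrow> star P x \<in> carrier P"
    and \<theta>_hom: "star_hom P A \<theta>"
    and \<theta>_inj: "inj_on \<theta> (carrier P)"
    and \<theta>_nrm: "x \<in> carrier P \<Longrightarrow> nrm P x = nrm A (\<theta> x)"
    and \<theta>_dense: "a \<in> carrier A \<Longrightarrow> 0 < \<epsilon> \<Longrightarrow> \<exists>x\<in>carrier P. nrm A (\<theta> x \<ominus> a) < \<epsilon>"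
begin

sublocale P: abelian_group P by (rule P_group)

lemma \<theta>_simps [simp]:
  "x \<in> carrier P \<Longrightarrow> \<theta> x \<in> carrier A"
  "x \<in> carrier P \<Longrightarrow> y \<in> carrier P \<Longrightarrow> \<theta> (x \<oplus>\<^bsub>P\<^esub> y) = \<theta> x \<oplus> \<theta> y"
  "x \<in> carrier P \<Longrightarrow> y \<in> carrier P \<Longrightarrow> \<theta> (x \<otimes>\<^bsub>P\<^esub> y) = \<theta> x \<otimes> \<theta> y"
  "x \<in> carrier P \<Longrightarrow> \<theta> (c \<odot>\<^bsub>P\<^esub> x) = c \<odot> \<theta> x"
  "x \<in> carrier P \<Longrightarrow> \<theta> (star P x) = star A (\<theta> x)"
  using \<theta>_hom by (auto simp: star_hom_def)

lemma \<theta>_diff: "x \<in> carrier P \<Longrightarrow> y \<in> carrier P \<Longrightarrow> \<theta> (x \<ominus>\<^bsub>P\<^esub> y) = \<theta> x \<ominus> \<theta> y"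
proof -
  assume x: "x \<in> carrier P" and y: "y \<in> carrier P"
  have "x = (x \<ominus>\<^bsub>P\<^esub> y) \<oplus>\<^bsub>P\<^esub> y"
    using x y by (simp add: a_minus_def P.a_assoc P.l_neg)
  then have "\<theta> x = \<theta> (x \<ominus>\<^bsub>P\<^esub> y) \<oplus> \<theta> y"
    using \<theta>_simps(2)[of "x \<ominus>\<^bsub>P\<^esub> y" y] x y P.minus_closed by simp
  moreover have "z = (z \<oplus> \<theta> y) \<ominus> \<theta> y" if "z \<in> carrier A" for z
    using that y by (simp add: a_minus_def a_assoc r_neg)
  ultimately show ?thesis
    using x y P.minus_closed by simp
qed

lemma \<theta>_zero [simp]: "\<theta> \<zero>\<^bsub>P\<^esub> = \<zero>"
  using \<theta>_diff[of "\<zero>\<^bsub>P\<^esub>" "\<zero>\<^bsub>P\<^esub>"] by (simp add: a_minus_def r_neg P.r_neg)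

lemma alg_dist_pullback:
  "alg_dist P x y = (if x \<in> carrier P \<and> y \<in> carrier P then alg_dist A (\<theta> x) (\<theta> y) else 0)"
  by (simp add: alg_dist_def \<theta>_nrm \<theta>_diff)

sublocale metric_P: Metric_space "carrier P" "alg_dist P"
  using metric.Metric_space_axioms \<theta>_inj _ alg_dist_pullback
  by (rule Metric_space_pullback) auto

text \<open>The point of the completion that corresponds to \<open>a\<close>.\<close>

definition limit_class :: "'a \<Rightarrow> (nat \<Rightarrow> 'p) set" where
  "limit_class a = {\<sigma>. (\<forall>n. \<sigma> n \<in> carrier P) \<and> tends (\<lambda>n. \<theta> (\<sigma> n)) a}"

text \<open>\<open>\<theta>\<close> is isometric, so being Cauchy means the same before and after
  applying it; completeness of \<open>A\<close> supplies the limit.\<close>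

lemma cauchy_seqs_iff: "\<sigma> \<in> cauchy_seqs P \<longleftrightarrow> (\<exists>a\<in>carrier A. \<sigma> \<in> limit_class a)"
proof
  assume "\<sigma> \<in> cauchy_seqs P"
  then have *: "metric_P.MCauchy \<sigma>"
    by (simp add: cauchy_seqs_def)
  then have cl: "\<sigma> n \<in> carrier P" for n
    by (auto simp: metric_P.MCauchy_def)
  have "range (\<lambda>n. \<theta> (\<sigma> n)) \<subseteq> carrier A"
    using cl by auto
  moreover have "\<exists>N. \<forall>m\<ge>N. \<forall>n\<ge>N. alg_dist A (\<theta> (\<sigma> m)) (\<theta> (\<sigma> n)) < \<epsilon>" if "\<epsilon> > 0" for \<epsilon>
  proof -
    have "\<exists>N. \<forall>m n. N \<le> m \<longrightarrow> N \<le> n \<longrightarrow> alg_dist P (\<sigma> m) (\<sigma> n) < \<epsilon>"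
      using * that by (simp add: metric_P.MCauchy_def)
    then show ?thesis
      by (simp add: alg_dist_pullback cl)
  qed
  ultimately obtain a where "a \<in> carrier A" "(\<lambda>n. alg_dist A (\<theta> (\<sigma> n)) a) \<longlonglongrightarrow> 0"
    using metric.mcompleteD_tendsto[OF complete, of "\<lambda>n. \<theta> (\<sigma> n)"] by metis
  then show "\<exists>a\<in>carrier A. \<sigma> \<in> limit_class a"
    using cl by (intro bexI[of _ a]) (simp_all add: limit_class_def tends_def alg_dist_def)
next
  assume "\<exists>a\<in>carrier A. \<sigma> \<in> limit_class a"
  then obtain a where a: "tends (\<lambda>n. \<theta> (\<sigma> n)) a" and cl: "\<And>n. \<sigma> n \<in> carrier P"
    by (auto simp: limit_class_def)
  have "metric.MCauchy (\<lambda>n. \<theta> (\<sigma> n))"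
    using a by (intro metric.MCauchyI_tendsto[of _ a]) (auto simp: tends_def alg_dist_def)
  then have "metric_P.MCauchy \<sigma>"
    using cl by (auto simp: metric_P.MCauchy_def metric.MCauchy_def alg_dist_pullback)
  then show "\<sigma> \<in> cauchy_seqs P"
    by (simp add: cauchy_seqs_def)
qed

text \<open>Since \<open>\<theta>\<close> preserves distances, two Cauchy sequences differ by a null
  sequence exactly if their images have the same limit.\<close>

lemma null_rel_class:
  assumes a: "a \<in> carrier A" and \<sigma>: "\<sigma> \<in> limit_class a"
  shows "null_rel P `` {\<sigma>} = limit_class a"
proof -
  have cl: "\<And>n. \<sigma> n \<in> carrier P" and lim: "tends (\<lambda>n. \<theta> (\<sigma> n)) a"
    using \<sigma> by (auto simp: limit_class_def)
  have \<sigma>C: "\<sigma> \<in> cauchy_seqs P"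
    using a \<sigma> cauchy_seqs_iff by blast
  have dist: "alg_dist P (\<sigma> n) (\<tau> n) = nrm A (\<theta> (\<sigma> n) \<ominus> \<theta> (\<tau> n))" if "\<tau> n \<in> carrier P" for \<tau> n
    using that cl by (simp add: alg_dist_def \<theta>_nrm \<theta>_diff)
  show ?thesis
  proof (intro equalityI subsetI)
    fix \<tau> assume "\<tau> \<in> null_rel P `` {\<sigma>}"
    then obtain b where b: "b \<in> carrier A" "\<tau> \<in> limit_class b"
      and 0: "(\<lambda>n. alg_dist P (\<sigma> n) (\<tau> n)) \<longlonglongrightarrow> 0"
      by (auto simp: null_rel_def cauchy_seqs_iff)
    then have cl': "\<And>n. \<tau> n \<in> carrier P" and lim': "tends (\<lambda>n. \<theta> (\<tau> n)) b"
      by (auto simp: limit_class_def)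
    have "tends (\<lambda>n. \<theta> (\<tau> n)) a"
    proof (rule tendsI_le)
      show "(\<lambda>n. alg_dist P (\<sigma> n) (\<tau> n) + nrm A (\<theta> (\<sigma> n) \<ominus> a)) \<longlonglongrightarrow> 0"
        using tendsto_add[OF 0 tendsD(3)[OF lim]] by simp
      show "nrm A (\<theta> (\<tau> n) \<ominus> a) \<le> alg_dist P (\<sigma> n) (\<tau> n) + nrm A (\<theta> (\<sigma> n) \<ominus> a)" for n
        using nrm_diff_triangle[of "\<theta> (\<tau> n)" "\<theta> (\<sigma> n)" a] cl cl' a
        by (simp add: dist nrm_diff_commute)
    qed (use cl' a in auto)
    then show "\<tau> \<in> limit_class a"
      using cl' by (simp add: limit_class_def)
  next
    fix \<tau> assume \<tau>: "\<tau> \<in> limit_class a"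
    then have cl': "\<And>n. \<tau> n \<in> carrier P" and lim': "tends (\<lambda>n. \<theta> (\<tau> n)) a"
      by (auto simp: limit_class_def)
    have "tends (\<lambda>n. \<theta> (\<sigma> n) \<oplus> (- 1) \<odot> \<theta> (\<tau> n)) (a \<oplus> (- 1) \<odot> a)"
      by (intro tends_add tends_smult lim lim')
    then have "(\<lambda>n. nrm A (\<theta> (\<sigma> n) \<ominus> \<theta> (\<tau> n))) \<longlonglongrightarrow> nrm A (a \<ominus> a)"
      using cl cl' a by (auto dest: tends_nrm simp: smult_minus_1 a_minus_def)
    then have "(\<lambda>n. alg_dist P (\<sigma> n) (\<tau> n)) \<longlonglongrightarrow> 0"
      using cl' a by (simp add: dist a_minus_def r_neg)
    moreover have "\<tau> \<in> cauchy_seqs P"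
      using a \<tau> cauchy_seqs_iff by blast
    ultimately show "\<tau> \<in> null_rel P `` {\<sigma>}"
      using \<sigma>C by (simp add: null_rel_def)
  qed
qed

lemma limit_class_const: "x \<in> carrier P \<Longrightarrow> (\<lambda>_. x) \<in> limit_class (\<theta> x)"
  by (simp add: limit_class_def tends_const)

text \<open>Here density enters: a point of \<open>P\<close> is chosen within 1/(n+1) of
  \<open>a\<close> for each n.\<close>

lemma limit_class_nonempty:
  assumes a: "a \<in> carrier A"
  shows "limit_class a \<noteq> {}"
proof -
  have "\<exists>x\<in>carrier P. nrm A (\<theta> x \<ominus> a) < inverse (real (Suc n))" for n
    using a by (intro \<theta>_dense) simp_all
  then obtain \<sigma> where \<sigma>: "\<And>n. \<sigma> n \<in> carrier P" "\<And>n. nrm A (\<theta> (\<sigma> n) \<ominus> a) < inverse (real (Suc n))"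
    by metis
  have "tends (\<lambda>n. \<theta> (\<sigma> n)) a"
    by (rule tendsI_le[OF _ a LIMSEQ_inverse_real_of_nat]) (use \<sigma> less_imp_le in auto)
  with \<sigma>(1) show ?thesis
    by (auto simp: limit_class_def)
qed

lemma limit_class_inj: "inj_on limit_class (carrier A)"
proof
  fix a b assume "a \<in> carrier A" "b \<in> carrier A" and eq: "limit_class a = limit_class b"
  then obtain \<sigma> where "\<sigma> \<in> limit_class a"
    using limit_class_nonempty by blast
  moreover from this eq have "\<sigma> \<in> limit_class b" by simp
  ultimately show "a = b"
    using tends_unique by (auto simp: limit_class_def)
qed

lemma completion_carrier: "carrier (completion P) = limit_class ` carrier A"
  unfolding completion_def Let_def partial_object.simps
  by (rule quotient_image_classes[OF cauchy_seqs_iff null_rel_class limit_class_nonempty])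

text \<open>Operations of \<open>completion\<close> are unions over all representatives. If
  \<open>f\<close> sends representatives of \<open>a\<close> to representatives of \<open>b\<close>,
  every set in the union is the same class, which is well-definedness in the form needed
  here.\<close>

lemma UN_limit_class:
  assumes "a \<in> carrier A" "b \<in> carrier A" and "\<And>\<sigma>. \<sigma> \<in> limit_class a \<Longrightarrow> f \<sigma> \<in> limit_class b"
  shows "(\<Union>\<sigma>\<in>limit_class a. null_rel P `` {f \<sigma>}) = limit_class b"
  using limit_class_nonempty[OF assms(1)] null_rel_class[OF assms(2) assms(3)] by simp

lemma UN2_limit_class:
  assumes "a \<in> carrier A" "b \<in> carrier A" "c \<in> carrier A"
    and "\<And>\<sigma> \<tau>. \<sigma> \<in> limit_class a \<Longrightarrow> \<tau> \<in> limit_class b \<Longrightarrow> f \<sigma> \<tau> \<in> limit_class c"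
  shows "(\<Union>\<sigma>\<in>limit_class a. \<Union>\<tau>\<in>limit_class b. null_rel P `` {f \<sigma> \<tau>}) = limit_class c"
proof -
  have "(\<Union>\<tau>\<in>limit_class b. null_rel P `` {f \<sigma> \<tau>}) = limit_class c" if "\<sigma> \<in> limit_class a" for \<sigma>
    by (rule UN_limit_class[OF assms(2,3)]) (rule assms(4)[OF that])
  then show ?thesis
    using limit_class_nonempty[OF assms(1)] by simp
qed

lemma completion_bij: "bij_betw limit_class (carrier A) (carrier (completion P))"
  by (simp add: bij_betw_def limit_class_inj completion_carrier)

lemma completion_zero: "\<zero>\<^bsub>completion P\<^esub> = limit_class \<zero>"
  using null_rel_class[OF _ limit_class_const[of "\<zero>\<^bsub>P\<^esub>"]]
  by (simp add: completion_def)

lemma completion_add: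
  assumes "a \<in> carrier A" "b \<in> carrier A"
  shows "limit_class a \<oplus>\<^bsub>completion P\<^esub> limit_class b = limit_class (a \<oplus> b)"
  unfolding completion_def Let_def
  using assms by (simp, intro UN2_limit_class)
    (auto simp: limit_class_def tends_add)

lemma completion_mult:
  assumes "a \<in> carrier A" "b \<in> carrier A"
  shows "limit_class a \<otimes>\<^bsub>completion P\<^esub> limit_class b = limit_class (a \<otimes> b)"
  unfolding completion_def Let_def
  using assms by (simp, intro UN2_limit_class)
    (auto simp: limit_class_def tends_mult P_closed mult_closed)

lemma completion_smult:
  assumes "a \<in> carrier A"
  shows "c \<odot>\<^bsub>completion P\<^esub> limit_class a = limit_class (c \<odot> a)"
  unfolding completion_def Let_def
  using assms by (simp, intro UN_limit_class)
    (auto simp: limit_class_def tends_smult P_closed)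

lemma completion_star:
  assumes "a \<in> carrier A"
  shows "star (completion P) (limit_class a) = limit_class (star A a)"
  unfolding completion_def Let_def
  using assms by (simp, intro UN_limit_class)
    (auto simp: limit_class_def tends_star P_closed star_closed)

text \<open>The norm of a class is computed from a representative picked by \<open>SOME\<close>;
  continuity of the norm makes the limit independent of the choice.\<close>

lemma completion_nrm:
  assumes "a \<in> carrier A"
  shows "nrm (completion P) (limit_class a) = nrm A a"
proof -
  have "(SOME \<sigma>. \<sigma> \<in> limit_class a) \<in> limit_class a"
    using limit_class_nonempty[OF assms] by (simp add: some_in_eq)
  then have "(\<lambda>n. nrm P ((SOME \<sigma>. \<sigma> \<in> limit_class a) n)) \<longlonglongrightarrow> nrm A a"
    by (auto simp: limit_class_def \<theta>_nrm dest: tends_nrm)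
  then show ?thesis
    by (simp add: completion_def limI)
qed

theorem cstar_algebra_completion: "cstar_algebra (completion P)"
  by (rule cstar_algebra_transport[OF cstar_algebra_axioms completion_bij])
    (simp_all add: completion_zero completion_add completion_mult completion_smult
      completion_star completion_nrm)

text \<open>The isomorphism is the inverse of \<open>limit_class\<close>. A constant sequence has
  its own value as limit, which fixes \<open>\<Phi>\<close> on the copy of \<open>P\<close>.\<close>

theorem completion_iso:
  obtains \<Phi> where "star_iso (completion P) A \<Phi>"
    and "\<And>x. x \<in> carrier P \<Longrightarrow> \<Phi> (null_rel P `` {\<lambda>_. x}) = \<theta> x"
proof
  let ?\<Phi> = "inv_into (carrier A) limit_class"
  have \<Phi>: "?\<Phi> (limit_class a) = a" if "a \<in> carrier A" for a
    using limit_class_inj that by simp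
  show "star_iso (completion P) A ?\<Phi>"
    unfolding star_iso_def
  proof
    show "bij_betw ?\<Phi> (carrier (completion P)) (carrier A)"
      using completion_bij by (rule bij_betw_inv_into)
    show "star_hom (completion P) A ?\<Phi>"
      unfolding star_hom_def completion_carrier
      by (auto simp: \<Phi> completion_add completion_mult completion_smult completion_star
          mult_closed star_closed)
  qed
  show "?\<Phi> (null_rel P `` {\<lambda>_. x}) = \<theta> x" if "x \<in> carrier P" for x
    using null_rel_class[OF _ limit_class_const[OF that]] that by (simp add: \<Phi>)
qed

end

section \<open>Evaluation of the free *-algebra\<close>

lemma carrier_free [simp]:
  "x \<in> carrier (free_star_algebra G) \<longleftrightarrow>
    (\<forall>w\<in>Poly_Mapping.keys x. letters w \<noteq> [] \<and> letter_gen ` set (letters w) \<subseteq> G)"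
  by (simp add: free_star_algebra_def)

lemma free_star_algebra_simps [simp]:
  "mult (free_star_algebra G) = (*)" "add (free_star_algebra G) = (+)"
  "zero (free_star_algebra G) = 0" "smult (free_star_algebra G) c = Poly_Mapping.map ((*) c)"
  by (simp_all add: free_star_algebra_def)

lemma lookup_free_smult [simp]:
  "Poly_Mapping.lookup (Poly_Mapping.map ((*) c) x) w = c * Poly_Mapping.lookup x w"
  for c :: "'b :: mult_zero"
  by (simp add: map.rep_eq when_def)

lemma free_smult_add:
  "Poly_Mapping.map ((*) c) (x + y) = Poly_Mapping.map ((*) c) x + Poly_Mapping.map ((*) c) y"
  for c :: "'b :: semiring_0"
  by (rule poly_mapping_eqI) (simp add: lookup_add distrib_left)

lemma free_smult_single:
  "Poly_Mapping.map ((*) c) (Poly_Mapping.single w d) = Poly_Mapping.single w (c * d)"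
  for c :: "'b :: semiring_0"
  by (rule poly_mapping_eqI) (simp add: lookup_single when_def)

text \<open>Homomorphism laws are available for sums and scalar multiples; differences are reduced
  to these.\<close>

lemma minus_eq_add_free_smult: "x - y = x + Poly_Mapping.map ((*) (- 1)) y"
  for x y :: "'w \<Rightarrow>\<^sub>0 'b :: ring_1"
  by (rule poly_mapping_eqI) (simp add: lookup_add lookup_minus)

lemma letter_adj_simps [simp]:
  "letter_adj (letter_adj l) = l" "letter_gen (letter_adj l) = letter_gen l"
  by (cases l; simp)+

lemma word_adj_word_adj [simp]: "word_adj (word_adj w) = w"
  by (cases w) (simp add: word_adj_def rev_map o_def)

lemma letters_word_adj: "letters (word_adj w) = rev (map letter_adj (letters w))"
  by (simp add: word_adj_def)

lemma letters_plus [simp]: "letters (v + w) = letters v @ letters w"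
  by (simp add: plus_star_word_def)

text \<open>\<open>word_adj\<close> is an involution, so at most one summand of the defining sum
  contributes to a given word. With this the laws of the star can be checked
  coefficientwise.\<close>

lemma lookup_free_star [simp]:
  "Poly_Mapping.lookup (star (free_star_algebra G) x) w = cnj (Poly_Mapping.lookup x (word_adj w))"
proof -
  have eq: "word_adj k = w \<longleftrightarrow> k = word_adj w" for k
    by auto
  show ?thesis
    by (simp add: free_star_algebra_def lookup_sum lookup_single eq when_def in_keys_iff)
qed

lemma keys_free_star: "Poly_Mapping.keys (star (free_star_algebra G) x) = word_adj ` Poly_Mapping.keys x"
proof -
  have "w \<in> word_adj ` Poly_Mapping.keys x \<longleftrightarrow> word_adj w \<in> Poly_Mapping.keys x" for w
    by (metis image_eqI image_iff word_adj_word_adj)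
  then show ?thesis
    by (auto simp: in_keys_iff)
qed

lemma free_star_add:
  "star (free_star_algebra G) (x + y) = star (free_star_algebra G) x + star (free_star_algebra G) y"
  by (rule poly_mapping_eqI) (simp add: lookup_add)

lemma free_star_single:
  "star (free_star_algebra G) (Poly_Mapping.single w c) = Poly_Mapping.single (word_adj w) (cnj c)"
  by (rule poly_mapping_eqI) (auto simp: lookup_single when_def)

lemma free_star_gen:
  "star (free_star_algebra G) (free_gen i) = Poly_Mapping.single (Word [Adj i]) 1"
  by (simp add: free_gen_def free_star_single word_adj_def)

lemma free_closed:
  "0 \<in> carrier (free_star_algebra G)"
  "x \<in> carrier (free_star_algebra G) \<Longrightarrow> y \<in> carrier (free_star_algebra G) \<Longrightarrow>
    x + y \<in> carrier (free_star_algebra G)"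
  "x \<in> carrier (free_star_algebra G) \<Longrightarrow> y \<in> carrier (free_star_algebra G) \<Longrightarrow>
    x - y \<in> carrier (free_star_algebra G)"
  "x \<in> carrier (free_star_algebra G) \<Longrightarrow> y \<in> carrier (free_star_algebra G) \<Longrightarrow>
    x * y \<in> carrier (free_star_algebra G)"
  "x \<in> carrier (free_star_algebra G) \<Longrightarrow>
    Poly_Mapping.map ((*) c) x \<in> carrier (free_star_algebra G)"
  "x \<in> carrier (free_star_algebra G) \<Longrightarrow>
    star (free_star_algebra G) x \<in> carrier (free_star_algebra G)"
  "letters w \<noteq> [] \<Longrightarrow> letter_gen ` set (letters w) \<subseteq> G \<Longrightarrow>
    Poly_Mapping.single w c \<in> carrier (free_star_algebra G)"
  "i \<in> G \<Longrightarrow> free_gen i \<in> carrier (free_star_algebra G)"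
proof -
  show "0 \<in> carrier (free_star_algebra G)"
    by simp
  assume x: "x \<in> carrier (free_star_algebra G)"
  show sm: "Poly_Mapping.map ((*) c) x \<in> carrier (free_star_algebra G)" for c
    using x by (simp add: in_keys_iff)
  show "star (free_star_algebra G) x \<in> carrier (free_star_algebra G)"
    using x by (simp add: keys_free_star letters_word_adj image_image)
  assume y: "y \<in> carrier (free_star_algebra G)"
  show "x + y \<in> carrier (free_star_algebra G)"
    using x y keys_add[of x y] by (simp add: subset_iff) blast
  show "x - y \<in> carrier (free_star_algebra G)"
    using x y keys_diff[of x y] by (simp add: subset_iff) blast
  show "x * y \<in> carrier (free_star_algebra G)"
    unfolding carrier_free
  proof
    fix w assume "w \<in> Poly_Mapping.keys (x * y)"
    then obtain u v where "u \<in> Poly_Mapping.keys x" "v \<in> Poly_Mapping.keys y" "w = u + v"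
      using keys_mult[of x y] by blast
    with x y show "letters w \<noteq> [] \<and> letter_gen ` set (letters w) \<subseteq> G"
      by (simp add: image_Un)
  qed
next
  show "letters w \<noteq> [] \<Longrightarrow> letter_gen ` set (letters w) \<subseteq> G \<Longrightarrow>
      Poly_Mapping.single w c \<in> carrier (free_star_algebra G)"
    by simp
  show "i \<in> G \<Longrightarrow> free_gen i \<in> carrier (free_star_algebra G)"
    by (simp add: free_gen_def)
qed

lemma poly_mapping_eq_sum_single:
  "x = (\<Sum>w\<in>Poly_Mapping.keys x. Poly_Mapping.single w (Poly_Mapping.lookup x w))"
  by (rule poly_mapping_eqI) (simp add: lookup_sum lookup_single when_def in_keys_iff)

text \<open>The element is rebuilt by adding its terms one at a time; every partial sum stays in the
  free algebra because its words are among those of \<open>x\<close>.\<close>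

lemma free_induct_words [consumes 1, case_names zero add]:
  assumes "x \<in> carrier (free_star_algebra G)" and "P 0"
    and step: "\<And>w c x. letters w \<noteq> [] \<Longrightarrow> letter_gen ` set (letters w) \<subseteq> G \<Longrightarrow>
      x \<in> carrier (free_star_algebra G) \<Longrightarrow> P x \<Longrightarrow> P (Poly_Mapping.single w c + x)"
  shows "P x"
proof -
  let ?s = "\<lambda>K. \<Sum>w\<in>K. Poly_Mapping.single w (Poly_Mapping.lookup x w)"
  have "?s K \<in> carrier (free_star_algebra G) \<and> P (?s K)"
    if "finite K" "K \<subseteq> Poly_Mapping.keys x" for K
    using that
  proof (induction K)
    case empty
    then show ?case using \<open>P 0\<close> by simp
  next
    case (insert w K)
    then have "w \<in> Poly_Mapping.keys x" and K: "?s K \<in> carrier (free_star_algebra G)" "P (?s K)"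
      by simp_all
    then have w: "letters w \<noteq> []" "letter_gen ` set (letters w) \<subseteq> G"
      using assms(1) by simp_all
    show ?case
      using step[OF w K] free_closed(2)[OF free_closed(7)[OF w] K(1)] insert.hyps
      by (simp del: carrier_free)
  qed
  from this[of "Poly_Mapping.keys x"] show ?thesis
    by (simp flip: poly_mapping_eq_sum_single)
qed

lemma free_carrier_mono:
  "F \<subseteq> G \<Longrightarrow> carrier (free_star_algebra F) \<subseteq> carrier (free_star_algebra G)"
  unfolding subset_iff carrier_free by (meson subset_iff)

text \<open>Two sets are kept apart: the letters of \<open>x\<close> come from \<open>F\<close>,
  typically its finite support, while the intermediate elements only need to lie in the algebra over
  \<open>G\<close>. Thus hypotheses on finitely many generators suffice. There is no case for a unit
  because words are nonempty.\<close>

lemma free_induct_gens [consumes 2, case_names zero gen adj add mult smult]: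
  assumes "x \<in> carrier (free_star_algebra F)" and FG: "F \<subseteq> G" and "P 0"
    and gen: "\<And>i. i \<in> F \<Longrightarrow> P (free_gen i)"
    and adj: "\<And>i. i \<in> F \<Longrightarrow> P (star (free_star_algebra G) (free_gen i))"
    and add: "\<And>x y. x \<in> carrier (free_star_algebra G) \<Longrightarrow> y \<in> carrier (free_star_algebra G) \<Longrightarrow>
      P x \<Longrightarrow> P y \<Longrightarrow> P (x + y)"
    and mult: "\<And>x y. x \<in> carrier (free_star_algebra G) \<Longrightarrow> y \<in> carrier (free_star_algebra G) \<Longrightarrow>
      P x \<Longrightarrow> P y \<Longrightarrow> P (x * y)"
    and smult: "\<And>c x. x \<in> carrier (free_star_algebra G) \<Longrightarrow> P x \<Longrightarrow>
      P (Poly_Mapping.map ((*) c) x)"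
  shows "P x"
  using assms(1)
proof (induction rule: free_induct_words)
  case zero
  show ?case by fact
next
  case (add w c x)
  have letter: "P (Poly_Mapping.single (Word [l]) 1)" if "letter_gen l \<in> F" for l
    using that gen[unfolded free_gen_def] adj[unfolded free_star_gen] by (cases l) simp_all
  have "P (Poly_Mapping.single (Word ls) 1)" if "ls \<noteq> []" "letter_gen ` set ls \<subseteq> F" for ls
    using that
  proof (induction ls rule: list_nonempty_induct)
    case (single l)
    then show ?case using letter by simp
  next
    case (cons l ls)
    have "P (Poly_Mapping.single (Word [l]) 1 * Poly_Mapping.single (Word ls) 1)"
      using cons.hyps cons.prems cons.IH letter[of l] FG
      by (intro mult free_closed(7)) (simp_all add: subset_iff)
    then show ?case
      by (simp add: mult_single plus_star_word_def)
  qed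
  then have "P (Poly_Mapping.single w 1)"
    using add(1,2) by (metis star_word.collapse)
  moreover have w: "letter_gen ` set (letters w) \<subseteq> G"
    using add(2) FG by (rule order_trans)
  ultimately have "P (Poly_Mapping.map ((*) c) (Poly_Mapping.single w 1))"
    using add(1) by (intro smult free_closed(7))
  moreover have "x \<in> carrier (free_star_algebra G)"
    using free_carrier_mono[OF FG] add(3) by blast
  ultimately show ?case
    using add(1,4) w by (intro assms(6)) (simp_all add: free_smult_single)
qed

lemma monomial_free_gen:
  "w \<noteq> [] \<Longrightarrow> monomial (free_star_algebra G) free_gen w = Poly_Mapping.single (Word (map Gen w)) 1"
  by (induction w rule: list_nonempty_induct)
    (auto simp: free_gen_def mult_single plus_star_word_def neq_Nil_conv)

lemma evaluate_free_closed:
  "e \<in> expressions G \<Longrightarrow> evaluate (free_star_algebra G) free_gen e \<in> carrier (free_star_algebra G)"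
proof (induction e)
  case (Cons p e)
  obtain c w where p: "p = (c, w)" by force
  have w: "w \<noteq> []" "set w \<subseteq> G" and e: "e \<in> expressions G"
    using Cons.prems by (auto simp: p expressions_def)
  have "Poly_Mapping.single (Word (map Gen w)) c \<in> carrier (free_star_algebra G)"
    using w by (intro free_closed(7)) auto
  then show ?case
    using free_closed(2) Cons.IH[OF e] w
    by (simp add: p monomial_free_gen free_smult_single del: carrier_free)
qed simp

section \<open>The evaluation homomorphism given by a family of projections\<close>

locale projection_family = commutative_cstar_algebra A
  for A :: "('a, 'm) normed_star_algebra_scheme" (structure) +
  fixes I :: "'i set" and q :: "'i \<Rightarrow> 'a"
  assumes proj: "i \<in> I \<Longrightarrow> is_projection A (q i)"
begin

lemma q_simps [simp]:
  "i \<in> I \<Longrightarrow> q i \<in> carrier A" "i \<in> I \<Longrightarrow> star A (q i) = q i" "i \<in> I \<Longrightarrow> q i \<otimes> q i = q i"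
  using proj by (simp_all add: is_projection_def)

lemma monomial_closed: "w \<noteq> [] \<Longrightarrow> set w \<subseteq> I \<Longrightarrow> monomial A q w \<in> carrier A"
  by (induction w rule: list_nonempty_induct) (auto simp: neq_Nil_conv mult_closed)

lemma monomial_Cons:
  "w \<noteq> [] \<Longrightarrow> monomial A q (i # w) = q i \<otimes> monomial A q w"
  by (cases w) auto

lemma monomial_append:
  "v \<noteq> [] \<Longrightarrow> w \<noteq> [] \<Longrightarrow> set v \<subseteq> I \<Longrightarrow> set w \<subseteq> I \<Longrightarrow>
    monomial A q (v @ w) = monomial A q v \<otimes> monomial A q w"
  by (induction v rule: list_nonempty_induct)
    (auto simp: monomial_Cons monomial_closed mult_assoc)

lemma monomial_rev: "w \<noteq> [] \<Longrightarrow> set w \<subseteq> I \<Longrightarrow> monomial A q (rev w) = monomial A q w"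
  by (induction w rule: list_nonempty_induct)
    (auto simp: monomial_append monomial_Cons monomial_closed mult_commute)

lemma star_monomial: "w \<noteq> [] \<Longrightarrow> set w \<subseteq> I \<Longrightarrow> star A (monomial A q w) = monomial A q w"
  by (induction w rule: list_nonempty_induct)
    (auto simp: monomial_Cons monomial_closed star_mult mult_commute)

text \<open>The letters \<open>Gen i\<close> and \<open>Adj i\<close> both go to \<open>q i\<close>,
  as they must since \<open>q i\<close> is selfadjoint.\<close>

definition word_val :: "'i star_word \<Rightarrow> 'a" where
  "word_val w = monomial A q (map letter_gen (letters w))"

lemma word_val_simps:
  assumes "letters w \<noteq> []" "letter_gen ` set (letters w) \<subseteq> I"
  shows "word_val w \<in> carrier A" "word_val (word_adj w) = word_val w"
    "star A (word_val w) = word_val w"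
    "letters v \<noteq> [] \<Longrightarrow> letter_gen ` set (letters v) \<subseteq> I \<Longrightarrow> word_val (w + v) = word_val w \<otimes> word_val v"
proof -
  have "map letter_gen (rev (map letter_adj ls)) = rev (map letter_gen ls)" for ls :: "'i letter list"
    by (simp add: rev_map o_def)
  then show "word_val (word_adj w) = word_val w"
    using assms by (simp add: word_val_def letters_word_adj monomial_rev)
qed (use assms in \<open>simp_all add: word_val_def monomial_closed star_monomial monomial_append\<close>)

text \<open>This is the homomorphism \<pi> of the overview, summed over the words that actually
  occur.\<close>

definition free_eval :: "'i star_poly \<Rightarrow> 'a" where
  "free_eval x = (\<Oplus>w\<in>Poly_Mapping.keys x. Poly_Mapping.lookup x w \<odot> word_val w)"

text \<open>Cancellation can remove words from a sum, so \<open>x\<close>, \<open>y\<close> and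
  \<open>x + y\<close> may have different sets of keys. Summing all three over one larger set makes
  the coefficients comparable.\<close>

lemma free_eval_superset:
  assumes "x \<in> carrier (free_star_algebra I)" "finite K" "Poly_Mapping.keys x \<subseteq> K"
    "\<And>w. w \<in> K \<Longrightarrow> word_val w \<in> carrier A"
  shows "free_eval x = (\<Oplus>w\<in>K. Poly_Mapping.lookup x w \<odot> word_val w)"
  unfolding free_eval_def
  using assms by (intro M.add.finprod_mono_neutral_cong_left) (auto simp: in_keys_iff)

lemma free_eval_closed [simp]: "x \<in> carrier (free_star_algebra I) \<Longrightarrow> free_eval x \<in> carrier A"
  unfolding free_eval_def by (intro finsum_closed) (auto simp: word_val_simps)

lemma free_eval_0 [simp]: "free_eval 0 = \<zero>"
  by (simp add: free_eval_def)

lemma free_eval_add: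
  assumes x: "x \<in> carrier (free_star_algebra I)" and y: "y \<in> carrier (free_star_algebra I)"
  shows "free_eval (x + y) = free_eval x \<oplus> free_eval y"
proof -
  let ?K = "Poly_Mapping.keys x \<union> Poly_Mapping.keys y"
  have K: "word_val w \<in> carrier A" if "w \<in> ?K" for w
    using that x y by (auto simp: word_val_simps)
  have "free_eval (x + y) = (\<Oplus>w\<in>?K. Poly_Mapping.lookup (x + y) w \<odot> word_val w)"
    using x y keys_add[of x y] by (intro free_eval_superset free_closed(2) K) auto
  also have "\<dots> = (\<Oplus>w\<in>?K. Poly_Mapping.lookup x w \<odot> word_val w \<oplus> Poly_Mapping.lookup y w \<odot> word_val w)"
    using K by (intro M.finsum_cong') (auto simp: lookup_add smult_add_left)
  also have "\<dots> = (\<Oplus>w\<in>?K. Poly_Mapping.lookup x w \<odot> word_val w) \<oplus>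
      (\<Oplus>w\<in>?K. Poly_Mapping.lookup y w \<odot> word_val w)"
    using K by (intro M.finsum_addf) auto
  also have "\<dots> = free_eval x \<oplus> free_eval y"
    using free_eval_superset[of x ?K, OF x _ _ K] free_eval_superset[of y ?K, OF y _ _ K] by simp
  finally show ?thesis .
qed

lemma free_eval_single:
  assumes "letters w \<noteq> []" "letter_gen ` set (letters w) \<subseteq> I"
  shows "free_eval (Poly_Mapping.single w c) = c \<odot> word_val w"
  using free_eval_superset[of "Poly_Mapping.single w c" "{w}"] assms
  by (simp add: word_val_simps)

lemma free_eval_single_add:
  assumes "letters w \<noteq> []" "letter_gen ` set (letters w) \<subseteq> I" "x \<in> carrier (free_star_algebra I)"
  shows "free_eval (Poly_Mapping.single w c + x) = c \<odot> word_val w \<oplus> free_eval x"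
  using free_eval_add[OF free_closed(7)[OF assms(1,2)] assms(3)] free_eval_single[OF assms(1,2)]
  by simp

lemma free_eval_smult:
  assumes "x \<in> carrier (free_star_algebra I)"
  shows "free_eval (Poly_Mapping.map ((*) c) x) = c \<odot> free_eval x"
  using assms
proof (induction rule: free_induct_words)
  case zero
  have "Poly_Mapping.map ((*) c) (0 :: 'i star_poly) = 0"
    by (rule poly_mapping_eqI) simp
  then show ?case by simp
next
  case (add w d x)
  then show ?case
    by (simp add: free_smult_add free_smult_single free_eval_single_add free_closed(5)
        smult_add_right smult_smult word_val_simps del: carrier_free)
qed

text \<open>Two inductions multiply out the product: the inner one over the right factor with a
  single word on the left, the outer one over the left factor. The core is that
  \<open>word_val\<close> turns concatenation into the product of \<open>A\<close>.\<close>

lemma free_eval_mult: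
  assumes x: "x \<in> carrier (free_star_algebra I)" and y: "y \<in> carrier (free_star_algebra I)"
  shows "free_eval (x * y) = free_eval x \<otimes> free_eval y"
proof -
  have single: "free_eval (Poly_Mapping.single w c * y) = (c \<odot> word_val w) \<otimes> free_eval y"
    if w: "letters w \<noteq> []" "letter_gen ` set (letters w) \<subseteq> I" for w c
    using y
  proof (induction rule: free_induct_words)
    case zero
    then show ?case using w by (simp add: word_val_simps)
  next
    case (add v d y)
    have "Poly_Mapping.single w c * (Poly_Mapping.single v d + y) =
        Poly_Mapping.single (w + v) (c * d) + Poly_Mapping.single w c * y"
      by (simp add: distrib_left mult_single)
    moreover have "Poly_Mapping.single w c * y \<in> carrier (free_star_algebra I)"
      using w add by (intro free_closed(4,7))
    moreover have "letters (w + v) \<noteq> []" "letter_gen ` set (letters (w + v)) \<subseteq> I"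
      using w add by auto
    ultimately show ?case
      using w add by (simp add: free_eval_single_add word_val_simps mult_add_right smult_mult_left
          smult_mult_right smult_smult mult_closed mult.commute[of d c] del: carrier_free)
  qed
  show ?thesis
    using x
  proof (induction rule: free_induct_words)
    case zero
    then show ?case using y by (simp del: carrier_free)
  next
    case (add w c x)
    have "free_eval ((Poly_Mapping.single w c + x) * y) =
        free_eval (Poly_Mapping.single w c * y) \<oplus> free_eval (x * y)"
      unfolding distrib_right using add y by (intro free_eval_add free_closed(4,7))
    then show ?case
      using add y by (simp add: single free_eval_single_add mult_add_left word_val_simps
          del: carrier_free)
  qed
qed

lemma free_eval_star:
  assumes "x \<in> carrier (free_star_algebra I)"
  shows "free_eval (star (free_star_algebra I) x) = star A (free_eval x)"
  using assms
proof (induction rule: free_induct_words)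
  case zero
  have "star (free_star_algebra I) 0 = 0"
    by (rule poly_mapping_eqI) simp
  then show ?case by simp
next
  case (add w c x)
  moreover have "letters (word_adj w) \<noteq> []" "letter_gen ` set (letters (word_adj w)) \<subseteq> I"
    using add by (auto simp: letters_word_adj)
  ultimately show ?case
    by (simp add: free_star_add free_star_single free_eval_single_add free_closed(6) star_add
        star_smult word_val_simps del: carrier_free)
qed

lemma free_eval_gen:
  "i \<in> I \<Longrightarrow> free_eval (free_gen i) = q i"
  "i \<in> I \<Longrightarrow> free_eval (star (free_star_algebra I) (free_gen i)) = q i"
  unfolding free_star_gen by (simp_all add: free_gen_def free_eval_single word_val_def)

lemma free_eval_diff:
  assumes "x \<in> carrier (free_star_algebra I)" "y \<in> carrier (free_star_algebra I)"
  shows "free_eval (x - y) = free_eval x \<ominus> free_eval y"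
  using assms unfolding minus_eq_add_free_smult
  by (simp add: free_eval_add free_eval_smult free_closed(5) smult_minus_1 a_minus_def
      del: carrier_free)

text \<open>Translates membership in \<open>R0\<close>, which speaks of formal expressions, into the
  vanishing of \<open>free_eval\<close>.\<close>

lemma free_eval_evaluate:
  "e \<in> expressions I \<Longrightarrow> free_eval (evaluate (free_star_algebra I) free_gen e) = evaluate A q e"
proof (induction e)
  case (Cons p e)
  obtain c w where p: "p = (c, w)" by force
  have w: "w \<noteq> []" "set w \<subseteq> I" and e: "e \<in> expressions I"
    using Cons.prems by (auto simp: p expressions_def)
  have v: "letters (Word (map Gen w)) \<noteq> []" "letter_gen ` set (letters (Word (map Gen w))) \<subseteq> I"
    using w by auto
  have "word_val (Word (map Gen w)) = monomial A q w"
    by (simp add: word_val_def o_def)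
  then show ?case
    using free_eval_single_add[OF v evaluate_free_closed[OF e], of c] w Cons.IH[OF e]
    by (simp add: p monomial_free_gen free_smult_single)
qed simp

text \<open>The projections \<open>q i\<close> themselves satisfy \<open>R1\<close> and
  \<open>R2\<close>. Consequently any bound of the form constant times
  \<open>nrm A (free_eval x)\<close> is 0 on all relations, which is how representations are
  verified later.\<close>

lemma relations_vanish:
  assumes "(x, \<eta>) \<in> R1 I \<union> R2 A I q"
  shows "x \<in> carrier (free_star_algebra I)" "free_eval x = \<zero>" "\<eta> = 0"
proof -
  have diff: "u - v \<in> carrier (free_star_algebra I) \<and> free_eval (u - v) = \<zero>"
    if "u \<in> carrier (free_star_algebra I)" "v \<in> carrier (free_star_algebra I)"
      "free_eval u = free_eval v" for u v
    using that by (simp add: free_closed(3) free_eval_diff minus_eq_iff del: carrier_free)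
  have "x \<in> carrier (free_star_algebra I) \<and> free_eval x = \<zero> \<and> \<eta> = 0"
  proof -
    note [simp] = free_eval_gen free_eval_mult mult_commute free_closed free_eval_evaluate
      evaluate_free_closed and [simp del] = carrier_free
    consider i where "i \<in> I" "x = free_gen i - star (free_star_algebra I) (free_gen i)" "\<eta> = 0"
      | i where "i \<in> I" "x = star (free_star_algebra I) (free_gen i) - free_gen i * free_gen i" "\<eta> = 0"
      | i j where "i \<in> I" "j \<in> I" "x = free_gen i * free_gen j - free_gen j * free_gen i" "\<eta> = 0"
      | e where "e \<in> expressions I" "evaluate A q e = \<zero>"
          "x = evaluate (free_star_algebra I) free_gen e - 0" "\<eta> = 0"
      using assms unfolding R1_def R2_def R0_def eq_relation_def by blast
    then show ?thesis
    proof cases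
      case 1
      then show ?thesis using diff[of "free_gen i" "star (free_star_algebra I) (free_gen i)"] by simp
    next
      case 2
      then show ?thesis
        using diff[of "star (free_star_algebra I) (free_gen i)" "free_gen i * free_gen i"] by simp
    next
      case 3
      then show ?thesis
        using diff[of "free_gen i * free_gen j" "free_gen j * free_gen i"] by simp
    next
      case 4
      then show ?thesis by simp
    qed
  qed
  then show "x \<in> carrier (free_star_algebra I)" "free_eval x = \<zero>" "\<eta> = 0"
    by blast+
qed

end

section \<open>Characters of commutative C*-algebras\<close>

text \<open>Taking roots of order 2^n makes the factor 2 disappear in the limit: otherwise the
  powers of x / M, being larger than 1, would be unbounded.\<close>

lemma pow_two_pow_bounded_imp_le:
  fixes x M :: real
  assumes "0 \<le> M" and "\<And>n. x ^ (2 ^ n) \<le> 2 * M ^ (2 ^ n)"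
  shows "x \<le> M"
proof (rule ccontr)
  assume "\<not> x \<le> M"
  then have x: "M < x" by simp
  \<comment> \<open>The case n = 0 reads x \<le> 2 M, which excludes M = 0 when M < x.\<close>
  have "M \<noteq> 0"
    using assms(2)[of 0] x by auto
  then have M: "0 < M" using assms(1) by simp
  define r where "r = x / M"
  have r: "1 < r" using x M by (simp add: r_def)
  obtain n where n: "2 < r ^ n"
    using real_arch_pow[OF r] by blast
  have "r ^ n \<le> r ^ (2 ^ n)"
    using r by (intro power_increasing) (auto intro: less_imp_le)
  also have "\<dots> \<le> 2"
    using assms(2)[of n] M by (simp add: r_def power_divide field_simps)
  finally show False using n by simp
qed

context commutative_cstar_algebra
begin

lemma mult_lcomm: "x \<in> carrier A \<Longrightarrow> y \<in> carrier A \<Longrightarrow> z \<in> carrier A \<Longrightarrow> x \<otimes> (y \<otimes> z) = y \<otimes> (x \<otimes> z)"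
  by (metis mult_assoc mult_commute)

lemmas mult_ac = mult_assoc mult_commute mult_lcomm

text \<open>Squaring preserves the assumptions on \<open>h\<close> and \<open>k\<close> while the constant \<open>2\<close> stays put, so the
  crude triangle inequality improves to a bound by the maximum.\<close>

lemma nrm_add_orthogonal_selfadjoint:
  assumes "h \<in> carrier A" "k \<in> carrier A" "star A h = h" "star A k = k" "h \<otimes> k = \<zero>"
    and "nrm A h \<le> M" "nrm A k \<le> M"
  shows "nrm A (h \<oplus> k) \<le> M"
proof (rule pow_two_pow_bounded_imp_le)
  show "0 \<le> M" using assms nrm_nonneg by fastforce
  show "nrm A (h \<oplus> k) ^ (2 ^ n) \<le> 2 * M ^ (2 ^ n)" for n
    using assms
  proof (induction n arbitrary: h k M)
    case 0
    then show ?case using nrm_triangle[of h k] by simp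
  next
    case (Suc n)
    note [simp] = Suc.prems(1-4)
    have kh: "k \<otimes> h = \<zero>" using Suc.prems(5) by (simp add: mult_commute)
    have sq: "nrm A x ^ 2 = nrm A (x \<otimes> x)" if "x \<in> carrier A" "star A x = x" for x
      using cstar_identity[OF that(1)] that(2) by simp
    have "(h \<oplus> k) \<otimes> (h \<oplus> k) = h \<otimes> h \<oplus> k \<otimes> k"
      by (simp add: mult_add_left mult_add_right Suc.prems(5) kh mult_closed)
    then have "nrm A (h \<oplus> k) ^ 2 = nrm A (h \<otimes> h \<oplus> k \<otimes> k)"
      using sq[of "h \<oplus> k"] by (simp add: star_add)
    moreover have "nrm A (h \<otimes> h \<oplus> k \<otimes> k) ^ 2 ^ n \<le> 2 * (M\<^sup>2) ^ 2 ^ n"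
    proof (rule Suc.IH)
      have "h \<otimes> h \<otimes> (k \<otimes> k) = h \<otimes> (h \<otimes> k) \<otimes> k"
        by (simp add: mult_assoc mult_closed)
      then show "h \<otimes> h \<otimes> (k \<otimes> k) = \<zero>"
        by (simp add: Suc.prems(5))
      show "nrm A (h \<otimes> h) \<le> M\<^sup>2" "nrm A (k \<otimes> k) \<le> M\<^sup>2"
        using Suc.prems(6,7) by (auto simp: sq[symmetric] nrm_nonneg intro!: power_mono)
    qed (simp_all add: mult_closed star_mult)
    ultimately show ?case
      by (metis power_Suc power_mult)
  qed
qed

text \<open>By the C*-identity the claim is the selfadjoint one for a* a and b* b. The hypothesis
  removes the cross terms, and commutativity regroups the product of the two squares so that a* b
  appears in it.\<close>

lemma nrm_add_orthogonal:
  assumes a: "a \<in> carrier A" and b: "b \<in> carrier A" and ab: "star A a \<otimes> b = \<zero>"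
    and "nrm A a \<le> M" "nrm A b \<le> M"
  shows "nrm A (a \<oplus> b) \<le> M"
proof -
  note [simp] = a b star_closed mult_closed
  have ba: "star A b \<otimes> a = \<zero>"
    using star_mult[of "star A a" b] ab by (simp add: star_star)
  have "star A (a \<oplus> b) \<otimes> (a \<oplus> b) = star A a \<otimes> a \<oplus> star A b \<otimes> b"
    by (simp add: star_add mult_add_left mult_add_right ab ba)
  then have "(nrm A (a \<oplus> b))\<^sup>2 = nrm A (star A a \<otimes> a \<oplus> star A b \<otimes> b)"
    using cstar_identity[of "a \<oplus> b"] by simp
  also have "\<dots> \<le> M\<^sup>2"
  proof (rule nrm_add_orthogonal_selfadjoint)
    have "star A a \<otimes> a \<otimes> (star A b \<otimes> b) = (star A a \<otimes> b) \<otimes> (a \<otimes> star A b)"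
      by (simp add: mult_ac)
    then show "star A a \<otimes> a \<otimes> (star A b \<otimes> b) = \<zero>"
      by (simp add: ab)
  qed (use assms in \<open>simp_all add: star_mult star_star cstar_identity nrm_nonneg power_mono\<close>)
  finally show ?thesis
    using nrm_nonneg[OF a] assms(4) by (meson order_trans power2_le_imp_le)
qed

lemma projection_mult:
  assumes "is_projection A p" "is_projection A r"
  shows "is_projection A (p \<otimes> r)"
  using assms unfolding is_projection_def
  by (simp add: mult_closed star_mult mult_commute) (metis mult_assoc mult_closed mult_commute)

text \<open>The relative complement of \<open>r\<close> in \<open>p\<close>, which stands in for p
  (1 - r) where \<open>A\<close> has no unit.\<close>

lemma projection_diff:
  assumes "is_projection A p" "is_projection A r"
  shows "is_projection A (p \<ominus> p \<otimes> r)"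
proof -
  have p: "p \<in> carrier A" "star A p = p" "p \<otimes> p = p" and r: "r \<in> carrier A" "star A r = r" "r \<otimes> r = r"
    using assms by (auto simp: is_projection_def)
  note [simp] = p r mult_closed
  have "p \<otimes> r \<otimes> p = p \<otimes> r" "p \<otimes> r \<otimes> (p \<otimes> r) = p \<otimes> r" "p \<otimes> (p \<otimes> r) = p \<otimes> r"
    using projection_mult[OF assms] by (auto simp: is_projection_def mult_commute[of _ p] simp flip: mult_assoc)
  then have "(p \<ominus> p \<otimes> r) \<otimes> (p \<ominus> p \<otimes> r) = p \<ominus> p \<otimes> r"
    by (simp add: mult_diff_left mult_diff_right) (simp add: a_minus_def M.r_neg M.minus_add)
  then show ?thesis
    by (simp add: is_projection_def star_diff star_mult mult_commute)
qed

text \<open>By the C*-identity the norm of a projection solves t * t = t.\<close>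

lemma nrm_projection_le_1:
  assumes "is_projection A p"
  shows "nrm A p \<le> 1"
proof -
  have "nrm A p * nrm A p = nrm A p"
    using assms cstar_identity[of p] by (simp add: is_projection_def power2_eq_square)
  then show ?thesis
    by (metis mult_cancel_right1 order.refl zero_le_one)
qed

text \<open>A family \<open>M\<close> of nonzero projections closed under products plays the role of a filter; an
  element that is a scalar multiple of the identity on some member of \<open>M\<close> gets that scalar as its
  value.\<close>

definition projection_filter :: "'a set \<Rightarrow> bool" where
  "projection_filter M \<longleftrightarrow> M \<noteq> {} \<and> (\<forall>m\<in>M. is_projection A m \<and> m \<noteq> \<zero>) \<and> (\<forall>m\<in>M. \<forall>n\<in>M. m \<otimes> n \<in> M)"

definition filter_value :: "'a set \<Rightarrow> 'a \<Rightarrow> complex" where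
  "filter_value M d = (THE c. \<exists>m\<in>M. d \<otimes> m = c \<odot> m)"

lemma projection_filterD:
  assumes "projection_filter M" "m \<in> M"
  shows "m \<in> carrier A" "star A m = m" "m \<otimes> m = m" "m \<noteq> \<zero>" "\<And>n. n \<in> M \<Longrightarrow> m \<otimes> n \<in> M"
  using assms by (auto simp: projection_filter_def is_projection_def)

text \<open>Uniqueness of the value: scalars obtained at \<open>m\<close> and at \<open>n\<close>
  both describe the action on \<open>m \<otimes> n\<close>, which is again in the filter and hence
  nonzero.\<close>

lemma filter_value_eq:
  assumes M: "projection_filter M" and d: "d \<in> carrier A" and m: "m \<in> M" and dm: "d \<otimes> m = c \<odot> m"
  shows "filter_value M d = c"
  unfolding filter_value_def
proof (rule the_equality)
  show "\<exists>m\<in>M. d \<otimes> m = c \<odot> m" using m dm by blast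
  fix c' assume "\<exists>n\<in>M. d \<otimes> n = c' \<odot> n"
  then obtain n where n: "n \<in> M" "d \<otimes> n = c' \<odot> n" by blast
  note [simp] = projection_filterD(1)[OF M m] projection_filterD(1)[OF M n(1)] d mult_closed
  have "c \<odot> (m \<otimes> n) = d \<otimes> m \<otimes> n" by (simp add: dm smult_mult_left)
  also have "\<dots> = m \<otimes> (d \<otimes> n)" by (simp add: mult_ac)
  also have "\<dots> = c' \<odot> (m \<otimes> n)" by (simp add: n smult_mult_right)
  finally have "(c - c') \<odot> (m \<otimes> n) = \<zero>"
    using smult_add_left[of "m \<otimes> n" "c - c'" c'] smult_add_left[of "m \<otimes> n" "c'" "-c'"]
      smult_add_left[of "m \<otimes> n" "c" "-c'"] by (simp del: M.add.r_cancel_one M.add.r_cancel_one')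
  then have "cmod (c - c') * nrm A (m \<otimes> n) = 0"
    using nrm_smult[of "m \<otimes> n" "c - c'"] by simp
  moreover have "m \<otimes> n \<noteq> \<zero>"
    using projection_filterD[OF M] m n by blast
  ultimately show "c' = c"
    by (simp add: nrm_eq_0_iff)
qed

text \<open>Zorn's lemma gives a filter maximal among those containing \<open>e\<close>. A
  projection meeting every member of it in a nonzero product could be adjoined, so each projection
  outside is annihilated by some member: the ultrafilter property.\<close>

lemma ex_maximal_projection_filter:
  assumes e: "is_projection A e" "e \<noteq> \<zero>"
  obtains M where "projection_filter M" "e \<in> M"
    "\<And>p. is_projection A p \<Longrightarrow> p \<notin> M \<Longrightarrow> \<exists>m\<in>M. p \<otimes> m = \<zero>"
proof -
  let ?F = "{M. projection_filter M \<and> e \<in> M}"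
  have "{e} \<in> ?F"
    using e by (simp add: projection_filter_def is_projection_def)
  then have "?F \<noteq> {}" by blast
  moreover have "\<Union>C \<in> ?F" if C: "C \<noteq> {}" "subset.chain ?F C" for C
  proof -
    have F: "projection_filter M" "e \<in> M" if "M \<in> C" for M
      using C that by (auto simp: subset.chain_def)
    have "m \<otimes> n \<in> \<Union>C" if mn: "m \<in> \<Union>C" "n \<in> \<Union>C" for m n
    proof -
      obtain X Y where XY: "X \<in> C" "Y \<in> C" "m \<in> X" "n \<in> Y" using mn by blast
      then have "X \<subseteq> Y \<or> Y \<subseteq> X"
        using C by (auto simp: subset.chain_def)
      then show ?thesis
        using XY F(1)[unfolded projection_filter_def] by blast
    qed
    moreover have "e \<in> \<Union>C" using C F by blast
    ultimately show ?thesis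
      using F(1) by (auto simp: projection_filter_def)
  qed
  ultimately obtain M where M: "projection_filter M" "e \<in> M"
    and max: "\<And>X. projection_filter X \<Longrightarrow> e \<in> X \<Longrightarrow> M \<subseteq> X \<Longrightarrow> X = M"
    using subset_Zorn_nonempty[of ?F] by auto
  show ?thesis
  proof (rule that[OF M])
    fix p assume p: "is_projection A p" "p \<notin> M"
    show "\<exists>m\<in>M. p \<otimes> m = \<zero>"
    proof (rule ccontr)
      assume nz: "\<not> ?thesis"
      \<comment> \<open>The multiplicatively closed set generated by \<open>M\<close> and
        \<open>p\<close>; \<open>p\<close> and the elements of \<open>M\<close> are idempotent and
        commute, so no further products arise.\<close>
      let ?X = "M \<union> {p} \<union> (\<lambda>m. p \<otimes> m) ` M"
      note mD = projection_filterD[OF M(1)]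
      have pc: "p \<in> carrier A" "p \<otimes> p = p" using p by (auto simp: is_projection_def)
      have "p \<noteq> \<zero>"
        using nz mD(1) M(2) zero_mult by metis
      have proj: "is_projection A m" if "m \<in> M" for m
        using M(1) that by (simp add: projection_filter_def)
      have XE: "m \<in> M \<or> m = p \<or> (\<exists>m'\<in>M. m = p \<otimes> m')" if "m \<in> ?X" for m using that by blast
      have "projection_filter ?X"
        unfolding projection_filter_def
      proof (intro conjI ballI)
        show "?X \<noteq> {}" by blast
        fix m assume "m \<in> ?X"
        then consider "m \<in> M" | "m = p" | m' where "m' \<in> M" "m = p \<otimes> m'" using XE by blast
        then have "is_projection A m \<and> m \<noteq> \<zero>"
        proof cases
          case 1
          then show ?thesis using proj mD(4) by simp
        next
          case 2
          then show ?thesis using p \<open>p \<noteq> \<zero>\<close> by simp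
        next
          case 3
          then show ?thesis using projection_mult[OF p(1) proj] nz by auto
        qed
        then show "is_projection A m" "m \<noteq> \<zero>" by simp_all
      next
        fix m n assume mn: "m \<in> ?X" "n \<in> ?X"
        have 1: "p \<otimes> m' \<in> ?X" if "m' \<in> M" for m'
          using that by blast
        have 2: "p \<otimes> m' \<otimes> n' = p \<otimes> (m' \<otimes> n')" "m' \<otimes> (p \<otimes> n') = p \<otimes> (m' \<otimes> n')"
           "p \<otimes> m' \<otimes> (p \<otimes> n') = p \<otimes> (m' \<otimes> n')"
          if mn': "m' \<in> M" "n' \<in> M" for m' n'
        proof -
          note [simp] = mD(1)[OF mn'(1)] mD(1)[OF mn'(2)] pc mult_closed
          show "p \<otimes> m' \<otimes> n' = p \<otimes> (m' \<otimes> n')" "m' \<otimes> (p \<otimes> n') = p \<otimes> (m' \<otimes> n')"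
            by (simp_all add: mult_assoc mult_lcomm)
          have "p \<otimes> m' \<otimes> (p \<otimes> n') = p \<otimes> (p \<otimes> (m' \<otimes> n'))"
            by (simp add: mult_assoc mult_lcomm[of m' p])
          also have "\<dots> = (p \<otimes> p) \<otimes> (m' \<otimes> n')"
            by (rule mult_assoc[symmetric]) simp_all
          finally show "p \<otimes> m' \<otimes> (p \<otimes> n') = p \<otimes> (m' \<otimes> n')" by simp
        qed
        have 3: "m' \<otimes> p = p \<otimes> m'" "p \<otimes> (p \<otimes> m') = p \<otimes> m'" "p \<otimes> m' \<otimes> p = p \<otimes> m'" if m': "m' \<in> M" for m'
        proof -
          note [simp] = mD(1)[OF m'] pc mult_closed
          show *: "m' \<otimes> p = p \<otimes> m'" by (simp add: mult_commute)
          show "p \<otimes> (p \<otimes> m') = p \<otimes> m'" by (simp flip: mult_assoc)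
          then show "p \<otimes> m' \<otimes> p = p \<otimes> m'" by (simp add: mult_assoc *)
        qed
        consider "m \<in> M" | "m = p" | m' where "m' \<in> M" "m = p \<otimes> m'" using XE mn by blast
        then show "m \<otimes> n \<in> ?X"
        proof cases
          assume m: "m \<in> M"
          consider "n \<in> M" | "n = p" | n' where "n' \<in> M" "n = p \<otimes> n'" using XE mn by blast
          then show ?thesis
            using m 2 3 1 mD(5) by cases auto
        next
          assume m: "m = p"
          consider "n \<in> M" | "n = p" | n' where "n' \<in> M" "n = p \<otimes> n'" using XE mn by blast
          then show ?thesis
            using m 2 3 1 mD(5) pc by cases auto
        next
          fix m' assume m: "m' \<in> M" "m = p \<otimes> m'"
          consider "n \<in> M" | "n = p" | n' where "n' \<in> M" "n = p \<otimes> n'" using XE mn by blast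
          then show ?thesis
            using m 2 3 1 mD(5) pc by cases auto
        qed
      qed
      then have "?X = M" by (rule max) (use M in auto)
      then show False using p by blast
    qed
  qed
qed

text \<open>The domain is a parameter because characters are only constructed on the dense image of
  evaluation. The zero functional is included; it makes the set whose supremum is the universal
  seminorm nonempty.\<close>

definition character_on :: "'a set \<Rightarrow> ('a \<Rightarrow> complex) \<Rightarrow> bool" where
  "character_on D f \<longleftrightarrow>
    (\<forall>x\<in>D. \<forall>y\<in>D. f (x \<oplus> y) = f x + f y \<and> f (x \<otimes> y) = f x * f y) \<and>
    (\<forall>c. \<forall>x\<in>D. f (c \<odot> x) = c * f x) \<and> (\<forall>x\<in>D. f (star A x) = cnj (f x))"

text \<open>Two elements that are scalar on \<open>m\<close> and on \<open>n\<close> are both scalar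
  on \<open>m \<otimes> n\<close>, where sums and products of scalars can be read off.\<close>

lemma filter_value_character:
  assumes M: "projection_filter M" and D: "D \<subseteq> carrier A"
    and ex: "\<And>d. d \<in> D \<Longrightarrow> \<exists>c. \<exists>m\<in>M. d \<otimes> m = c \<odot> m"
  shows "character_on D (filter_value M)"
  unfolding character_on_def
proof (intro conjI ballI allI)
  have val: "\<exists>m\<in>M. d \<otimes> m = filter_value M d \<odot> m" if "d \<in> D" for d
    using ex[OF that] filter_value_eq[OF M] D that by (metis subsetD)
  note mD = projection_filterD[OF M]
  fix x y assume x: "x \<in> D" and y: "y \<in> D"
  obtain m where m: "m \<in> M" "x \<otimes> m = filter_value M x \<odot> m" using val x by blast
  obtain n where n: "n \<in> M" "y \<otimes> n = filter_value M y \<odot> n" using val y by blast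
  note [simp] = mD(1)[OF m(1)] mD(1)[OF n(1)] subsetD[OF D x] subsetD[OF D y] mult_closed
  have 1: "x \<otimes> (m \<otimes> n) = filter_value M x \<odot> (m \<otimes> n)"
    by (simp add: smult_mult_left m flip: mult_assoc)
  have 2: "y \<otimes> (m \<otimes> n) = filter_value M y \<odot> (m \<otimes> n)"
    using mult_lcomm[of y m n] by (simp add: smult_mult_right n)
  have mn: "m \<otimes> n \<in> M" using mD(5) m n by blast
  show "filter_value M (x \<oplus> y) = filter_value M x + filter_value M y"
    by (rule filter_value_eq[OF M _ mn]) (simp_all add: mult_add_left smult_add_left 1 2)
  show "filter_value M (x \<otimes> y) = filter_value M x * filter_value M y"
    by (rule filter_value_eq[OF M _ mn])
      (simp_all add: mult_assoc 2 smult_mult_right 1 smult_smult mult.commute)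
next
  have val: "\<exists>m\<in>M. d \<otimes> m = filter_value M d \<odot> m" if "d \<in> D" for d
    using ex[OF that] filter_value_eq[OF M] D that by (metis subsetD)
  note mD = projection_filterD[OF M]
  fix c x assume x: "x \<in> D"
  obtain m where m: "m \<in> M" "x \<otimes> m = filter_value M x \<odot> m" using val x by blast
  note [simp] = mD(1)[OF m(1)] subsetD[OF D x]
  show "filter_value M (c \<odot> x) = c * filter_value M x"
    by (rule filter_value_eq[OF M _ m(1)]) (simp_all add: smult_mult_left m smult_smult)
  have "star A (x \<otimes> m) = star A (filter_value M x \<odot> m)" by (simp add: m)
  then have "star A x \<otimes> m = cnj (filter_value M x) \<odot> m"
    by (simp add: star_mult star_smult mD(2)[OF m(1)] mult_commute star_closed)
  then show "filter_value M (star A x) = cnj (filter_value M x)"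
    by (intro filter_value_eq[OF M _ m(1)]) (simp_all add: star_closed)
qed

end

section \<open>Characters through a given projection, and the norm on the image of
  evaluation\<close>

definition free_support :: "'i star_poly \<Rightarrow> 'i set" where
  "free_support x = (\<Union>w\<in>Poly_Mapping.keys x. letter_gen ` set (letters w))"

lemma free_support:
  assumes "x \<in> carrier (free_star_algebra G)"
  shows "finite (free_support x)" "free_support x \<subseteq> G"
    "x \<in> carrier (free_star_algebra (free_support x))"
  using assms unfolding free_support_def carrier_free by (simp_all add: UN_subset_iff) blast

context projection_family
begin

text \<open>The elements for which \<open>e\<close> is an eigenvector of multiplication are closed
  under sums, products and scalar multiples, so it is enough to look at the generators occurring in
  \<open>x\<close>.\<close>

lemma free_eval_scalar_on:
  assumes "x \<in> carrier (free_star_algebra F)" and FI: "F \<subseteq> I" and e: "e \<in> carrier A"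
    and F: "\<And>i. i \<in> F \<Longrightarrow> \<exists>c. q i \<otimes> e = c \<odot> e"
  shows "\<exists>c. free_eval x \<otimes> e = c \<odot> e"
  using assms(1) FI
proof (induction rule: free_induct_gens)
  case zero
  show ?case using e by (intro exI[of _ 0]) simp
next
  case (gen i)
  then show ?case using F FI by (simp add: free_eval_gen subsetD)
next
  case (adj i)
  then show ?case using F FI by (simp add: free_eval_gen subsetD)
next
  case (add x y)
  then obtain c d where "free_eval x \<otimes> e = c \<odot> e" "free_eval y \<otimes> e = d \<odot> e" by blast
  with add(1,2) e show ?case
    by (intro exI[of _ "c + d"]) (simp add: free_eval_add mult_add_left smult_add_left del: carrier_free)
next
  case (mult x y)
  then obtain c d where "free_eval x \<otimes> e = c \<odot> e" "free_eval y \<otimes> e = d \<odot> e" by blast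
  with mult(1,2) e show ?case
    by (intro exI[of _ "d * c"])
      (simp add: free_eval_mult mult_assoc smult_mult_right smult_smult del: carrier_free)
next
  case (smult a x)
  then obtain c where "free_eval x \<otimes> e = c \<odot> e" by blast
  with smult(1) e show ?case
    by (intro exI[of _ "a * c"])
      (simp add: free_eval_smult smult_mult_left smult_smult del: carrier_free)
qed

lemma free_eval_unit:
  assumes "x \<in> carrier (free_star_algebra F)" and FI: "F \<subseteq> I" and e: "e \<in> carrier A"
    and F: "\<And>i. i \<in> F \<Longrightarrow> q i \<otimes> e = q i"
  shows "free_eval x \<otimes> e = free_eval x"
  using assms(1) FI
proof (induction rule: free_induct_gens)
  case (gen i)
  then show ?case using F FI by (simp add: free_eval_gen subsetD)
next
  case (adj i)
  then show ?case using F FI by (simp add: free_eval_gen subsetD)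
qed (use e in \<open>simp_all add: free_eval_add free_eval_mult free_eval_smult mult_add_left mult_assoc
  smult_mult_left del: carrier_free\<close>)

text \<open>A substitute for the unit on finitely many generators: the join of projections, built by
  adding to \<open>u\<close> the part of \<open>q j\<close> outside \<open>u\<close>. That part is
  orthogonal to \<open>u\<close>, so the sum is again a projection.\<close>

lemma ex_joint_unit:
  assumes "finite F" "F \<subseteq> I"
  shows "\<exists>u. is_projection A u \<and> (\<forall>i\<in>F. q i \<otimes> u = q i)"
  using assms
proof (induction F)
  case empty
  show ?case by (intro exI[of _ \<zero>]) (simp add: is_projection_def)
next
  case (insert j F)
  then obtain u where u: "is_projection A u" "\<And>i. i \<in> F \<Longrightarrow> q i \<otimes> u = q i" by blast
  have j: "j \<in> I" "is_projection A (q j)" using insert proj by auto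
  let ?r = "q j \<ominus> q j \<otimes> u"
  have r: "is_projection A ?r" using projection_diff[OF j(2) u(1)] .
  have uD: "u \<in> carrier A" "star A u = u" "u \<otimes> u = u" using u by (auto simp: is_projection_def)
  have rD: "?r \<in> carrier A" "star A ?r = ?r" "?r \<otimes> ?r = ?r" using r by (auto simp: is_projection_def)
  note [simp] = uD rD j(1) mult_closed
  have ru: "?r \<otimes> u = \<zero>"
    by (simp add: mult_diff_left mult_assoc del: rD) (simp add: a_minus_def M.r_neg)
  have ur: "u \<otimes> ?r = \<zero>" using ru by (simp add: mult_commute)
  have "is_projection A (u \<oplus> ?r)"
    by (simp add: is_projection_def star_add mult_add_left mult_add_right ru ur)
  moreover have "q i \<otimes> (u \<oplus> ?r) = q i" if i: "i \<in> insert j F" for i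
  proof (cases "i = j")
    case True
    have "q j \<otimes> ?r = ?r"
      by (simp add: mult_diff_right del: rD) (simp flip: mult_assoc)
    then have "q j \<otimes> (u \<oplus> ?r) = q j \<otimes> u \<oplus> ?r" by (simp add: mult_add_right)
    also have "\<dots> = q j"
      using diff_add_cancel[of "q j" "q j \<otimes> u"] M.a_comm[of "q j \<otimes> u" ?r] by simp
    finally show ?thesis using True by simp
  next
    case False
    then have iF: "i \<in> F" and [simp]: "i \<in> I" using i insert by auto
    have "q i \<otimes> ?r = q i \<otimes> u \<otimes> ?r" using u(2)[OF iF] by simp
    also have "\<dots> = \<zero>" by (simp add: mult_assoc ur del: u)
    finally show ?thesis using u(2)[OF iF] by (simp add: mult_add_right)
  qed
  ultimately show ?case by blast
qed

abbreviation "free_image \<equiv> free_eval ` carrier (free_star_algebra I)"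

text \<open>Take a maximal filter containing \<open>e\<close>. Each \<open>q i\<close> either
  belongs to it, and then has value 1 on itself, or is annihilated by a member, and then has value 0
  there. So every element of the image of evaluation has a value, and a scalar action on
  \<open>e\<close> is recorded because \<open>e\<close> is in the filter.\<close>

lemma ex_character:
  assumes e: "is_projection A e" "e \<noteq> \<zero>"
  obtains f where "character_on free_image f"
    "\<And>d c. d \<in> carrier A \<Longrightarrow> d \<otimes> e = c \<odot> e \<Longrightarrow> f d = c"
proof -
  obtain M where M: "projection_filter M" "e \<in> M"
    and max: "\<And>p. is_projection A p \<Longrightarrow> p \<notin> M \<Longrightarrow> \<exists>m\<in>M. p \<otimes> m = \<zero>"
    using ex_maximal_projection_filter[OF e] by blast
  note mD = projection_filterD[OF M(1)]
  have q: "\<exists>m\<in>M. \<exists>c. q i \<otimes> m = c \<odot> m" if iI: "i \<in> I" for i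
  proof (cases "q i \<in> M")
    case True
    then show ?thesis using that by (intro bexI[of _ "q i"] exI[of _ 1]) simp_all
  next
    case False
    then obtain m where "m \<in> M" "q i \<otimes> m = \<zero>" using max[OF proj[OF iI]] False by blast
    then show ?thesis using mD(1) by (intro bexI[of _ m] exI[of _ 0]) simp_all
  qed
  \<comment> \<open>Multiplying the members found for the single generators gives one member on
    which finitely many generators act as scalars at once.\<close>
  have "\<exists>m\<in>M. \<forall>i\<in>F. \<exists>c. q i \<otimes> m = c \<odot> m" if "finite F" "F \<subseteq> I" for F
    using that
  proof (induction F)
    case empty
    then show ?case using M by blast
  next
    case (insert j F)
    then obtain m where m: "m \<in> M" "\<And>i. i \<in> F \<Longrightarrow> \<exists>c. q i \<otimes> m = c \<odot> m" by blast
    obtain n where n: "n \<in> M" "\<exists>c. q j \<otimes> n = c \<odot> n" using q[of j] insert by blast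
    note [simp] = mD(1)[OF m(1)] mD(1)[OF n(1)]
    have "\<exists>c. q i \<otimes> (m \<otimes> n) = c \<odot> (m \<otimes> n)" if i: "i \<in> insert j F" for i
    proof -
      have iI [simp]: "i \<in> I" using i insert by auto
      show ?thesis
      proof (cases "i = j")
        case True
        have [simp]: "j \<in> I" using insert by simp
        obtain c where "q j \<otimes> n = c \<odot> n" using n by blast
        then have "q i \<otimes> (m \<otimes> n) = c \<odot> (m \<otimes> n)"
          using True mult_lcomm[of "q i" m n] by (simp add: smult_mult_right)
        then show ?thesis by blast
      next
        case False
        then obtain c where "q i \<otimes> m = c \<odot> m" using m i by blast
        then have "q i \<otimes> (m \<otimes> n) = c \<odot> (m \<otimes> n)"
          by (simp add: smult_mult_left flip: mult_assoc)
        then show ?thesis by blast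
      qed
    qed
    then show ?case using mD(5) m n by blast
  qed
  note common = this
  have "\<exists>c. \<exists>m\<in>M. free_eval x \<otimes> m = c \<odot> m" if x: "x \<in> carrier (free_star_algebra I)" for x
  proof -
    let ?F = "free_support x"
    note F = free_support[OF x]
    obtain m where "m \<in> M" "\<And>i. i \<in> ?F \<Longrightarrow> \<exists>c. q i \<otimes> m = c \<odot> m" using common[OF F(1,2)] by blast
    then show ?thesis
      using free_eval_scalar_on[OF F(3,2) mD(1)] by blast
  qed
  then have "character_on free_image (filter_value M)"
    using M(1) by (intro filter_value_character) auto
  then show ?thesis
    by (rule that) (rule filter_value_eq[OF M(1) _ M(2)])
qed

text \<open>Orthogonal sums have norm at most the larger of the two norms, so it suffices to bound
  pieces \<open>free_eval x \<otimes> e\<close>. Where every generator of \<open>x\<close> acts on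
  \<open>e\<close> as 0 or 1, the piece is a multiple of \<open>e\<close>, and if \<open>e\<close>
  is nonzero the multiple is the value of a character at \<open>free_eval x\<close>.\<close>

theorem nrm_free_eval_le:
  assumes x: "x \<in> carrier (free_star_algebra I)" and K: "0 \<le> K"
    and f: "\<And>f. character_on free_image f \<Longrightarrow> cmod (f (free_eval x)) \<le> K"
  shows "nrm A (free_eval x) \<le> K"
proof -
  let ?F = "free_support x"
  note F = free_support[OF x]
  let ?X = "free_eval x"
  note [simp] = free_eval_closed[OF x] mult_closed star_closed
  \<comment> \<open>\<open>F'\<close> holds the generators still to be split; the others already act
    on \<open>e\<close> as 0 or 1. At \<open>F' = {}\<close> the projection is a joint eigenvector;
    at the full support the last premise is vacuous, so any projection may enter.\<close>
  have main: "nrm A (?X \<otimes> e) \<le> K" if "finite F'" "F' \<subseteq> ?F" "is_projection A e"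
    "\<And>i. i \<in> ?F - F' \<Longrightarrow> q i \<otimes> e = e \<or> q i \<otimes> e = \<zero>" for F' e
    using that
  proof (induction F' arbitrary: e)
    case empty
    have e [simp]: "e \<in> carrier A" using empty by (simp add: is_projection_def)
    show ?case
    proof (cases "e = \<zero>")
      case True
      then show ?thesis using K by simp
    next
      case False
      have "\<exists>c. q i \<otimes> e = c \<odot> e" if "i \<in> ?F" for i
      proof (cases "q i \<otimes> e = e")
        case True
        then show ?thesis by (intro exI[of _ 1]) simp
      next
        case False
        then have "q i \<otimes> e = \<zero>" using empty(3)[of i] that by blast
        then show ?thesis by (intro exI[of _ 0]) simp
      qed
      then obtain c where c: "?X \<otimes> e = c \<odot> e"
        using free_eval_scalar_on[OF F(3,2) e] by blast
      obtain g where g: "character_on free_image g"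
        and ge: "\<And>d c. d \<in> carrier A \<Longrightarrow> d \<otimes> e = c \<odot> e \<Longrightarrow> g d = c"
        using ex_character[OF empty(2) False] by blast
      have "cmod c \<le> K" using f[OF g] ge[OF _ c] by simp
      moreover have "nrm A e \<le> 1" using nrm_projection_le_1 empty by blast
      ultimately have "cmod c * nrm A e \<le> K * 1"
        by (intro mult_mono) (auto simp: nrm_nonneg K)
      then show ?thesis by (simp add: c nrm_smult)
    qed
  next
    case (insert j F')
    have jI [simp]: "j \<in> I" using insert.prems F(2) by blast
    have e: "e \<in> carrier A" "star A e = e" "e \<otimes> e = e" using insert by (auto simp: is_projection_def)
    let ?e1 = "e \<otimes> q j" and ?e2 = "e \<ominus> e \<otimes> q j"
    have p1: "is_projection A ?e1" and p2: "is_projection A ?e2"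
      using insert.prems(2) proj[OF jI] projection_mult projection_diff by blast+
    note [simp] = e
    have zz: "a \<ominus> a = \<zero>" if "a \<in> carrier A" for a
      using that by (simp add: a_minus_def M.r_neg)
    have j1: "q j \<otimes> ?e1 = ?e1"
      using mult_lcomm[of "q j" e "q j"] by simp
    have j2: "q j \<otimes> ?e2 = \<zero>"
      using mult_commute[of "q j" e] by (simp add: mult_diff_right j1 zz)
    have step: "(q i \<otimes> ?e1 = ?e1 \<or> q i \<otimes> ?e1 = \<zero>) \<and> (q i \<otimes> ?e2 = ?e2 \<or> q i \<otimes> ?e2 = \<zero>)"
      if i: "i \<in> ?F - F'" for i
    proof (cases "i = j")
      case True
      then show ?thesis using j1 j2 by simp
    next
      case False
      have [simp]: "i \<in> I" using i F(2) by blast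
      have *: "q i \<otimes> ?e1 = (q i \<otimes> e) \<otimes> q j" by (simp add: mult_assoc)
      have "q i \<otimes> e = e \<or> q i \<otimes> e = \<zero>" using insert.prems(3)[of i] i False by blast
      then show ?thesis
        by (auto simp: mult_diff_right * zz)
    qed
    have n1: "nrm A (?X \<otimes> ?e1) \<le> K" and n2: "nrm A (?X \<otimes> ?e2) \<le> K"
      using insert.prems(1) p1 p2 step by (auto intro!: insert.IH)
    have e12: "?e1 \<otimes> ?e2 = \<zero>"
      using j2 by (simp add: mult_assoc)
    \<comment> \<open>Commutativity brings the two halves of \<open>e\<close> together, whose
      product is zero; this is the orthogonality required for the sum of the two pieces.\<close>
    have "star A (?X \<otimes> ?e1) \<otimes> (?X \<otimes> ?e2) = star A ?X \<otimes> (?X \<otimes> (?e1 \<otimes> ?e2))"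
    proof -
      have "star A (?X \<otimes> ?e1) = star A ?X \<otimes> ?e1"
        using p1 by (simp add: star_mult is_projection_def mult_commute)
      moreover have "?e1 \<otimes> (?X \<otimes> ?e2) = ?X \<otimes> (?e1 \<otimes> ?e2)"
        by (rule mult_lcomm) simp_all
      ultimately show ?thesis by (simp add: mult_assoc)
    qed
    then have "nrm A (?X \<otimes> ?e1 \<oplus> ?X \<otimes> ?e2) \<le> K"
      using n1 n2 by (intro nrm_add_orthogonal) (simp_all add: e12)
    moreover have "?X \<otimes> ?e1 \<oplus> ?X \<otimes> ?e2 = ?X \<otimes> e"
      using diff_add_cancel[of e ?e1] M.a_comm[of ?e2 ?e1] by (simp flip: mult_add_right)
    ultimately show ?case by simp
  qed
  \<comment> \<open>The unit of the finitely many generators that occur in \<open>x\<close> is a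
    first projection on which no part of \<open>free_eval x\<close> is lost.\<close>
  obtain u where u: "is_projection A u" "\<And>i. i \<in> ?F \<Longrightarrow> q i \<otimes> u = q i"
    using ex_joint_unit[OF F(1,2)] by blast
  have "nrm A (?X \<otimes> u) \<le> K"
    using F(1) u(1) by (intro main[of ?F]) auto
  moreover have "?X \<otimes> u = ?X"
    using u by (intro free_eval_unit[OF F(3,2)]) (auto simp: is_projection_def)
  ultimately show ?thesis by simp
qed

end

section \<open>Hilbert spaces and representations of the relations\<close>

text \<open>Separated from completeness because the direct sum and the one-dimensional space need
  the norm and its metric before they can be shown to be complete.\<close>

locale pre_hilbert_space = complex_space H
  for H :: "('h, 'm) inner_space_scheme" (structure) +
  assumes inner_add: "u \<in> carrier H \<Longrightarrow> v \<in> carrier H \<Longrightarrow> w \<in> carrier H \<Longrightarrow>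
      inner_prod H (u \<oplus> v) w = inner_prod H u w + inner_prod H v w"
    and inner_smult: "u \<in> carrier H \<Longrightarrow> v \<in> carrier H \<Longrightarrow>
      inner_prod H (c \<odot> u) v = c * inner_prod H u v"
    and inner_commute: "u \<in> carrier H \<Longrightarrow> v \<in> carrier H \<Longrightarrow>
      inner_prod H u v = cnj (inner_prod H v u)"
    and inner_nonneg: "u \<in> carrier H \<Longrightarrow> 0 \<le> Re (inner_prod H u u)"
    and inner_eq_0: "u \<in> carrier H \<Longrightarrow> inner_prod H u u = 0 \<Longrightarrow> u = \<zero>"
begin

lemma inner_add_right:
  "u \<in> carrier H \<Longrightarrow> v \<in> carrier H \<Longrightarrow> w \<in> carrier H \<Longrightarrow>
    inner_prod H u (v \<oplus> w) = inner_prod H u v + inner_prod H u w"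
  using inner_commute[of u "v \<oplus> w"] inner_commute[of u v] inner_commute[of u w]
  by (simp add: inner_add)

lemma inner_smult_right:
  "u \<in> carrier H \<Longrightarrow> v \<in> carrier H \<Longrightarrow> inner_prod H u (c \<odot> v) = cnj c * inner_prod H u v"
  using inner_commute[of u "c \<odot> v"] inner_commute[of u v] by (simp add: inner_smult)

lemma inner_zero_right [simp]: "u \<in> carrier H \<Longrightarrow> inner_prod H u \<zero> = 0"
  using inner_smult_right[of u \<zero> 0] by simp

lemma inner_diff_left:
  "u \<in> carrier H \<Longrightarrow> v \<in> carrier H \<Longrightarrow> w \<in> carrier H \<Longrightarrow>
    inner_prod H (u \<ominus> v) w = inner_prod H u w - inner_prod H v w"
  using inner_smult[of v w "-1"] by (simp add: a_minus_def inner_add smult_minus_1)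

lemma inner_diff_right:
  "u \<in> carrier H \<Longrightarrow> v \<in> carrier H \<Longrightarrow> w \<in> carrier H \<Longrightarrow>
    inner_prod H u (v \<ominus> w) = inner_prod H u v - inner_prod H u w"
  using inner_smult_right[of u w "-1"] by (simp add: a_minus_def inner_add_right smult_minus_1)

lemma vec_norm_nonneg [simp]: "v \<in> carrier H \<Longrightarrow> 0 \<le> vec_norm H v"
  by (simp add: vec_norm_def inner_nonneg)

lemma vec_norm_sq: "v \<in> carrier H \<Longrightarrow> (vec_norm H v)\<^sup>2 = Re (inner_prod H v v)"
  by (simp add: vec_norm_def inner_nonneg)

lemma inner_self: 
  assumes "v \<in> carrier H"
  shows "inner_prod H v v = complex_of_real ((vec_norm H v)\<^sup>2)"
proof (rule complex_eqI)
  have "Im (inner_prod H v v) = - Im (inner_prod H v v)"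
    using arg_cong[OF inner_commute[OF assms assms], of Im] by simp
  then show "Im (inner_prod H v v) = Im (complex_of_real ((vec_norm H v)\<^sup>2))"
    by simp
qed (simp add: vec_norm_sq assms)

lemma vec_norm_eq_0_iff: "v \<in> carrier H \<Longrightarrow> vec_norm H v = 0 \<longleftrightarrow> v = \<zero>"
  using inner_self[of v] inner_eq_0[of v] by (auto simp: vec_norm_def)

lemma vec_norm_zero [simp]: "vec_norm H \<zero> = 0"
  by (simp add: vec_norm_eq_0_iff)

lemma vec_norm_smult: "v \<in> carrier H \<Longrightarrow> vec_norm H (c \<odot> v) = cmod c * vec_norm H v"
proof -
  assume v: "v \<in> carrier H"
  have "inner_prod H (c \<odot> v) (c \<odot> v) = (c * cnj c) * inner_prod H v v"
    using v by (simp add: inner_smult inner_smult_right)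
  also have "\<dots> = complex_of_real ((cmod c * vec_norm H v)\<^sup>2)"
    using v by (simp add: inner_self power_mult_distrib flip: complex_norm_square)
  finally have "(vec_norm H (c \<odot> v))\<^sup>2 = (cmod c * vec_norm H v)\<^sup>2"
    using v by (simp add: vec_norm_sq)
  then show ?thesis
    using v by (simp add: power2_eq_iff_nonneg)
qed

lemma cauchy_schwarz:
  assumes u: "u \<in> carrier H" and v: "v \<in> carrier H"
  shows "cmod (inner_prod H u v) \<le> vec_norm H u * vec_norm H v"
proof (cases "v = \<zero>")
  case True
  then show ?thesis using u by simp
next
  case False
  define a where "a = inner_prod H u v"
  define n where "n = (vec_norm H v)\<^sup>2"
  have n: "0 < n" using False v by (simp add: n_def vec_norm_eq_0_iff)
  have "inner_prod H v u = cnj a" using inner_commute[OF v u] by (simp add: a_def)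
  \<comment> \<open>With this coefficient \<open>?c \<odot> v\<close> is the orthogonal projection
    of \<open>u\<close> to the line through \<open>v\<close>; the squared norm of the remainder is
    the defect in the inequality divided by \<open>n\<close>.\<close>
  let ?c = "a / complex_of_real n"
  have "inner_prod H (u \<ominus> ?c \<odot> v) (u \<ominus> ?c \<odot> v) =
      inner_prod H u u - cnj ?c * a - ?c * (cnj a - cnj ?c * inner_prod H v v)"
    using u v \<open>inner_prod H v u = cnj a\<close>
    by (simp add: inner_diff_left inner_diff_right inner_smult inner_smult_right a_def[symmetric] algebra_simps)
  also have "\<dots> = inner_prod H u u - (a * cnj a) / complex_of_real n"
    using n by (simp add: inner_self[OF v] n_def[symmetric])
  also have "\<dots> = complex_of_real ((vec_norm H u)\<^sup>2 - (cmod a)\<^sup>2 / n)"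
    by (simp add: inner_self[OF u] flip: complex_norm_square)
  finally have "Re (inner_prod H (u \<ominus> ?c \<odot> v) (u \<ominus> ?c \<odot> v)) = (vec_norm H u)\<^sup>2 - (cmod a)\<^sup>2 / n"
    by simp
  then have "(cmod a)\<^sup>2 / n \<le> (vec_norm H u)\<^sup>2"
    using inner_nonneg[of "u \<ominus> ?c \<odot> v"] u v by simp
  then have "(cmod a)\<^sup>2 \<le> (vec_norm H u * vec_norm H v)\<^sup>2"
    using n by (simp add: divide_le_eq power_mult_distrib n_def)
  then show ?thesis
    using u v by (simp add: a_def power2_le_iff_abs_le)
qed

lemma vec_norm_triangle:
  assumes u: "u \<in> carrier H" and v: "v \<in> carrier H"
  shows "vec_norm H (u \<oplus> v) \<le> vec_norm H u + vec_norm H v"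
proof -
  have "Re (inner_prod H u v) \<le> vec_norm H u * vec_norm H v"
    using cauchy_schwarz[OF u v] complex_Re_le_cmod order_trans by blast
  moreover have "Re (inner_prod H v u) = Re (inner_prod H u v)"
    using inner_commute[OF u v] by simp
  ultimately have "(vec_norm H (u \<oplus> v))\<^sup>2 \<le> (vec_norm H u + vec_norm H v)\<^sup>2"
    using u v by (simp add: vec_norm_sq inner_add inner_add_right power2_sum)
  then show ?thesis
    using u v by (simp add: power2_le_iff_abs_le)
qed

lemma vec_norm_minus: "v \<in> carrier H \<Longrightarrow> vec_norm H (\<ominus> v) = vec_norm H v"
  using vec_norm_smult[of v "-1"] by (simp add: smult_minus_1)

lemma Metric_space_vec_dist: "Metric_space (carrier H) (vec_dist H)"
proof
  fix x y z
  have comm: "vec_norm H (x \<ominus> y) = vec_norm H (y \<ominus> x)" if "x \<in> carrier H" "y \<in> carrier H"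
    using vec_norm_minus[of "x \<ominus> y"] diff_swap[of x y] that by simp
  then show "0 \<le> vec_dist H x y" "vec_dist H x y = vec_dist H y x"
    by (simp_all add: vec_dist_def)
  show "x \<in> carrier H \<Longrightarrow> y \<in> carrier H \<Longrightarrow> (vec_dist H x y = 0) = (x = y)"
    by (simp add: vec_dist_def vec_norm_eq_0_iff minus_eq_iff)
  show "x \<in> carrier H \<Longrightarrow> y \<in> carrier H \<Longrightarrow> z \<in> carrier H \<Longrightarrow>
    vec_dist H x z \<le> vec_dist H x y + vec_dist H y z"
    using vec_norm_triangle[of "x \<ominus> y" "y \<ominus> z"] by (simp add: vec_dist_def minus_add_minus)
qed

lemma op_norm_le:
  assumes "\<And>v. v \<in> carrier H \<Longrightarrow> vec_norm H (T v) \<le> K * vec_norm H v" and "0 \<le> K"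
  shows "op_norm H T \<le> K"
  unfolding op_norm_def
proof (rule cSup_least)
  show "{vec_norm H (T v) | v. v \<in> carrier H \<and> vec_norm H v \<le> 1} \<noteq> {}"
    by (auto intro!: exI[of _ \<zero>])
  fix r assume "r \<in> {vec_norm H (T v) | v. v \<in> carrier H \<and> vec_norm H v \<le> 1}"
  then obtain v where v: "v \<in> carrier H" "vec_norm H v \<le> 1" "r = vec_norm H (T v)" by blast
  show "r \<le> K"
    using assms(1)[OF v(1)] mult_left_mono[OF v(2) assms(2)] v(3) by simp
qed

lemma vec_norm_le_op_norm:
  assumes T: "bounded_operator H T" and v: "v \<in> carrier H"
  shows "vec_norm H (T v) \<le> op_norm H T * vec_norm H v"
proof -
  obtain K where K: "\<And>v. v \<in> carrier H \<Longrightarrow> vec_norm H (T v) \<le> K * vec_norm H v"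
    using T unfolding bounded_operator_def by blast
  have smult: "T (c \<odot> v) = c \<odot> T v" and closed: "T v \<in> carrier H" if "v \<in> carrier H" for c v
    using T that by (auto simp: bounded_operator_def)
  have "bdd_above {vec_norm H (T v) | v. v \<in> carrier H \<and> vec_norm H v \<le> 1}"
  proof (rule bdd_aboveI)
    fix r assume "r \<in> {vec_norm H (T v) | v. v \<in> carrier H \<and> vec_norm H v \<le> 1}"
    then obtain w where w: "w \<in> carrier H" "vec_norm H w \<le> 1" "r = vec_norm H (T w)" by blast
    \<comment> \<open>The constant in \<open>bounded_operator\<close> may be negative, hence the
      absolute value.\<close>
    have "K * vec_norm H w \<le> \<bar>K\<bar> * 1"
      using w by (intro mult_mono) auto
    then show "r \<le> \<bar>K\<bar>" using K[OF w(1)] w by simp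
  qed
  then have le: "vec_norm H (T w) \<le> op_norm H T" if "w \<in> carrier H" "vec_norm H w \<le> 1" for w
    unfolding op_norm_def using that by (intro cSup_upper) blast
  show ?thesis
  proof (cases "v = \<zero>")
    case True
    then have "T v = \<zero>" using smult[OF v, of 0] closed[OF v] by simp
    then show ?thesis using True by simp
  next
    case False
    define r where "r = vec_norm H v"
    have r: "0 < r" using False v vec_norm_eq_0_iff[OF v] vec_norm_nonneg[OF v] unfolding r_def by linarith
    have "vec_norm H (T (complex_of_real (inverse r) \<odot> v)) \<le> op_norm H T"
      using r v by (intro le) (simp_all add: vec_norm_smult norm_inverse r_def)
    then have "inverse r * vec_norm H (T v) \<le> op_norm H T"
      using r v closed[OF v] by (simp add: smult vec_norm_smult norm_inverse)
    then show ?thesis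
      using r by (simp add: r_def[symmetric] field_simps)
  qed
qed

end

sublocale hilbert_space \<subseteq> pre_hilbert_space
  by unfold_locales (fact inner_add inner_smult inner_commute inner_nonneg inner_eq_0)+

lemma (in pre_hilbert_space) hilbert_spaceI:
  assumes "Metric_space.mcomplete (carrier H) (vec_dist H)"
  shows "hilbert_space H"
  by unfold_locales (fact assms inner_add inner_smult inner_commute inner_nonneg inner_eq_0)+

section \<open>Representations of the relations and their comparison with evaluation\<close>

locale relation_representation = projection_family A I q + H: hilbert_space H
  for A :: "('a, 'm) normed_star_algebra_scheme" and I :: "'i set" and q :: "'i \<Rightarrow> 'a"
    and H :: "('h, 'n) inner_space_scheme" +
  fixes \<rho> :: "'i star_poly \<Rightarrow> 'h \<Rightarrow> 'h"
  assumes representation: "representation I (R1 I \<union> R2 A I q) H \<rho>"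
begin

abbreviation "B \<equiv> carrier (free_star_algebra I)"

lemma rep_bounded: "x \<in> B \<Longrightarrow> bounded_operator H (\<rho> x)"
  using representation by (simp add: representation_def Let_def del: carrier_free)

lemma rep_closed [simp]: "x \<in> B \<Longrightarrow> v \<in> carrier H \<Longrightarrow> \<rho> x v \<in> carrier H"
  using rep_bounded[of x] by (auto simp: bounded_operator_def simp del: carrier_free)

lemma rep_vec_add:
  "x \<in> B \<Longrightarrow> u \<in> carrier H \<Longrightarrow> v \<in> carrier H \<Longrightarrow> \<rho> x (u \<oplus>\<^bsub>H\<^esub> v) = \<rho> x u \<oplus>\<^bsub>H\<^esub> \<rho> x v"
  using rep_bounded[of x] by (simp add: bounded_operator_def del: carrier_free)

lemma rep_vec_smult: "x \<in> B \<Longrightarrow> v \<in> carrier H \<Longrightarrow> \<rho> x (c \<odot>\<^bsub>H\<^esub> v) = c \<odot>\<^bsub>H\<^esub> \<rho> x v"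
  using rep_bounded[of x] by (simp add: bounded_operator_def del: carrier_free)

lemma rep_vec_zero [simp]: "x \<in> B \<Longrightarrow> \<rho> x \<zero>\<^bsub>H\<^esub> = \<zero>\<^bsub>H\<^esub>"
  using rep_vec_smult[of x "\<zero>\<^bsub>H\<^esub>" 0] by (simp del: carrier_free)

lemma rep_vec_diff:
  "x \<in> B \<Longrightarrow> u \<in> carrier H \<Longrightarrow> v \<in> carrier H \<Longrightarrow> \<rho> x (u \<ominus>\<^bsub>H\<^esub> v) = \<rho> x u \<ominus>\<^bsub>H\<^esub> \<rho> x v"
  using rep_vec_smult[of x v "-1"] by (simp add: a_minus_def rep_vec_add H.smult_minus_1 del: carrier_free)

lemma rep_add: "x \<in> B \<Longrightarrow> y \<in> B \<Longrightarrow> v \<in> carrier H \<Longrightarrow> \<rho> (x + y) v = \<rho> x v \<oplus>\<^bsub>H\<^esub> \<rho> y v"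
  and rep_mult: "x \<in> B \<Longrightarrow> y \<in> B \<Longrightarrow> v \<in> carrier H \<Longrightarrow> \<rho> (x * y) v = \<rho> x (\<rho> y v)"
  and rep_smult: "x \<in> B \<Longrightarrow> v \<in> carrier H \<Longrightarrow> \<rho> (Poly_Mapping.map ((*) c) x) v = c \<odot>\<^bsub>H\<^esub> \<rho> x v"
  and rep_adjoint: "x \<in> B \<Longrightarrow> u \<in> carrier H \<Longrightarrow> v \<in> carrier H \<Longrightarrow>
    inner_prod H (\<rho> x u) v = inner_prod H u (\<rho> (star (free_star_algebra I) x) v)"
  using representation by (simp_all add: representation_def Let_def is_adjoint_def del: carrier_free)

lemma rep_zero [simp]: "v \<in> carrier H \<Longrightarrow> \<rho> 0 v = \<zero>\<^bsub>H\<^esub>"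
proof -
  assume v: "v \<in> carrier H"
  have "Poly_Mapping.map ((*) 0) (0 :: 'i star_poly) = 0"
    by (rule poly_mapping_eqI) simp
  then show ?thesis
    using rep_smult[of 0 v 0] rep_closed[of 0 v] v by simp
qed

lemma rep_diff: "x \<in> B \<Longrightarrow> y \<in> B \<Longrightarrow> v \<in> carrier H \<Longrightarrow> \<rho> (x - y) v = \<rho> x v \<ominus>\<^bsub>H\<^esub> \<rho> y v"
  unfolding minus_eq_add_free_smult
  by (simp add: rep_add rep_smult free_closed(5) H.smult_minus_1 a_minus_def del: carrier_free)

text \<open>All norm bounds in the relations are 0, so each relation says that an operator
  vanishes.\<close>

lemma rep_relation:
  assumes "(x, \<eta>) \<in> R1 I \<union> R2 A I q" and v: "v \<in> carrier H"
  shows "\<rho> x v = \<zero>\<^bsub>H\<^esub>"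
proof -
  note x = relations_vanish[OF assms(1)]
  have "op_norm H (\<rho> x) \<le> 0"
    using representation assms(1) x(3) by (auto simp: representation_def Let_def)
  then have "op_norm H (\<rho> x) * vec_norm H v \<le> 0"
    using v by (intro mult_nonpos_nonneg) simp_all
  then have "vec_norm H (\<rho> x v) = 0"
    using H.vec_norm_le_op_norm[OF rep_bounded[OF x(1)] v] H.vec_norm_nonneg[OF rep_closed[OF x(1) v]]
    by linarith
  then show ?thesis
    using H.vec_norm_eq_0_iff[OF rep_closed[OF x(1) v]] by simp
qed

lemma rep_eq_relation:
  assumes "eq_relation x y \<in> R1 I \<union> R2 A I q" "x \<in> B" "y \<in> B" "v \<in> carrier H"
  shows "\<rho> x v = \<rho> y v"
  using rep_relation[of "x - y" 0 v] assms rep_diff[of x y v]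
  by (simp add: eq_relation_def H.minus_eq_iff del: carrier_free)

lemma rep_star_gen:
  "i \<in> I \<Longrightarrow> v \<in> carrier H \<Longrightarrow> \<rho> (star (free_star_algebra I) (free_gen i)) v = \<rho> (free_gen i) v"
  by (rule rep_eq_relation[symmetric]) (auto simp: R1_def intro!: free_closed(6,8) simp del: carrier_free)

lemma rep_gen_idem:
  assumes i: "i \<in> I" and v: "v \<in> carrier H"
  shows "\<rho> (free_gen i) (\<rho> (free_gen i) v) = \<rho> (free_gen i) v"
proof -
  have "\<rho> (star (free_star_algebra I) (free_gen i)) v = \<rho> (free_gen i * free_gen i) v"
    using i v by (intro rep_eq_relation) (auto simp: R1_def intro!: free_closed(4,6,8) simp del: carrier_free)
  then show ?thesis
    using i v by (simp add: rep_star_gen rep_mult free_closed(8) del: carrier_free)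
qed

text \<open>Adjoint letters may be replaced by generators one by one, since \<open>R1\<close> makes
  them act alike. The expressions behind \<open>R2\<close> contain no adjoint letters.\<close>

lemma rep_single:
  assumes "ls \<noteq> []" "letter_gen ` set ls \<subseteq> I" "v \<in> carrier H"
  shows "\<rho> (Poly_Mapping.single (Word ls) 1) v =
    \<rho> (Poly_Mapping.single (Word (map Gen (map letter_gen ls))) 1) v"
  using assms
proof (induction ls rule: list_nonempty_induct)
  case (single l)
  then show ?case
    using rep_star_gen[of "letter_gen l" v, unfolded free_star_gen]
    by (cases l) (simp_all add: free_gen_def)
next
  case (cons l ls)
  have split: "Poly_Mapping.single (Word (k # ks)) (1 :: complex) =
      Poly_Mapping.single (Word [k]) 1 * Poly_Mapping.single (Word ks) 1" for k :: "'i letter" and ks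
    by (simp add: mult_single plus_star_word_def)
  have B: "Poly_Mapping.single (Word [l]) 1 \<in> B" "Poly_Mapping.single (Word ls) 1 \<in> B"
    "Poly_Mapping.single (Word [Gen (letter_gen l)]) 1 \<in> B"
    "Poly_Mapping.single (Word (map Gen (map letter_gen ls))) 1 \<in> B"
    using cons.hyps cons.prems by (intro free_closed(7); simp add: image_image)+
  have 1: "\<rho> (Poly_Mapping.single (Word [l]) 1) w = \<rho> (Poly_Mapping.single (Word [Gen (letter_gen l)]) 1) w"
    if "w \<in> carrier H" for w
    using that cons.prems(1) rep_star_gen[of "letter_gen l" w, unfolded free_star_gen]
    by (cases l) (simp_all add: free_gen_def)
  show ?case
    unfolding list.map(2) split[of l ls] split[of "Gen (letter_gen l)" "map Gen (map letter_gen ls)"]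
    using B cons.hyps cons.prems cons.IH by (simp add: rep_mult 1 del: carrier_free)
qed

text \<open>Every element of the free algebra agrees, both under evaluation and under
  \<open>\<rho>\<close>, with a formal expression in the generators. This puts arbitrary elements
  within reach of \<open>R2\<close>.\<close>

lemma rep_expression:
  assumes "x \<in> B"
  shows "\<exists>e\<in>expressions I. evaluate A q e = free_eval x \<and>
    (\<forall>v\<in>carrier H. \<rho> (evaluate (free_star_algebra I) free_gen e) v = \<rho> x v)"
  using assms
proof (induction rule: free_induct_words)
  case zero
  show ?case by (intro bexI[of _ "[]"]) (simp_all add: expressions_def)
next
  case (add w c x)
  then obtain e where e: "e \<in> expressions I" "evaluate A q e = free_eval x"
    "\<And>v. v \<in> carrier H \<Longrightarrow> \<rho> (evaluate (free_star_algebra I) free_gen e) v = \<rho> x v" by blast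
  let ?u = "map letter_gen (letters w)"
  let ?s = "Poly_Mapping.single (Word (map Gen ?u)) (1 :: complex)"
  have s: "?s \<in> B" "Poly_Mapping.single w 1 \<in> B"
    using add(1,2) by (intro free_closed(7); simp add: image_image)+
  have "\<rho> (evaluate (free_star_algebra I) free_gen ((c, ?u) # e)) v = \<rho> (Poly_Mapping.single w c + x) v"
    if v: "v \<in> carrier H" for v
  proof -
    have scale: "\<rho> (Poly_Mapping.single u c + y) v = c \<odot>\<^bsub>H\<^esub> \<rho> (Poly_Mapping.single u 1) v \<oplus>\<^bsub>H\<^esub> \<rho> y v"
      if "Poly_Mapping.single u 1 \<in> B" "y \<in> B" for u y
      using rep_smult[OF that(1) v, of c] rep_add[OF free_closed(5)[OF that(1)] that(2) v, of c]
      by (simp only: free_smult_single) simp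
    have "\<rho> (evaluate (free_star_algebra I) free_gen ((c, ?u) # e)) v
        = \<rho> (Poly_Mapping.single (Word (map Gen ?u)) c + evaluate (free_star_algebra I) free_gen e) v"
      using add(1) by (simp add: monomial_free_gen free_smult_single)
    also have "\<dots> = c \<odot>\<^bsub>H\<^esub> \<rho> ?s v \<oplus>\<^bsub>H\<^esub> \<rho> x v"
      using scale[OF s(1) evaluate_free_closed[OF e(1)]] e(3)[OF v] by simp
    also have "\<rho> ?s v = \<rho> (Poly_Mapping.single w 1) v"
      using rep_single[OF add(1,2) v] by simp
    also have "c \<odot>\<^bsub>H\<^esub> \<rho> (Poly_Mapping.single w 1) v \<oplus>\<^bsub>H\<^esub> \<rho> x v = \<rho> (Poly_Mapping.single w c + x) v"
      using scale[OF s(2) add(3)] by simp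
    finally show ?thesis .
  qed
  moreover have "(c, ?u) # e \<in> expressions I"
    using e(1) add by (auto simp: expressions_def)
  moreover have "evaluate A q ((c, ?u) # e) = free_eval (Poly_Mapping.single w c + x)"
    using add e(2) by (simp add: free_eval_single_add word_val_def del: carrier_free)
  ultimately show ?case by blast
qed

text \<open>An expression with value zero in \<open>A\<close> belongs to \<open>R0\<close>, so
  \<open>R2\<close> lists it as a relation. Hence \<open>\<rho>\<close> depends on evaluations only,
  by algebra alone and before any norm estimate.\<close>

lemma rep_kernel:
  assumes x: "x \<in> B" and "free_eval x = \<zero>\<^bsub>A\<^esub>" and v: "v \<in> carrier H"
  shows "\<rho> x v = \<zero>\<^bsub>H\<^esub>"
proof -
  obtain e where e: "e \<in> expressions I" "evaluate A q e = free_eval x"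
    "\<rho> (evaluate (free_star_algebra I) free_gen e) v = \<rho> x v"
    using rep_expression[OF x] v by blast
  have "(evaluate (free_star_algebra I) free_gen e, 0) \<in> R1 I \<union> R2 A I q"
    using e(1,2) assms(2) by (auto simp: R2_def R0_def eq_relation_def)
  from rep_relation[OF this v] show ?thesis using e(3) by simp
qed

text \<open>Identities of \<open>A\<close> hold for the operators as well; the one used below is
  that \<open>\<rho> x\<close> commutes with the operators of the generators.\<close>

lemma rep_cong:
  assumes "x \<in> B" "y \<in> B" "free_eval x = free_eval y" "v \<in> carrier H"
  shows "\<rho> x v = \<rho> y v"
  using rep_kernel[of "x - y" v] rep_diff[of x y v] assms
  by (simp add: free_closed(3) free_eval_diff minus_eq_iff H.minus_eq_iff del: carrier_free)

text \<open>A selfadjoint idempotent p satisfies <p v, v> = <p v, p v>, so p v and v - p v are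
  orthogonal.\<close>

lemma rep_gen_pythagoras:
  assumes i: "i \<in> I" and v: "v \<in> carrier H"
  shows "(vec_norm H v)\<^sup>2 =
    (vec_norm H (\<rho> (free_gen i) v))\<^sup>2 + (vec_norm H (v \<ominus>\<^bsub>H\<^esub> \<rho> (free_gen i) v))\<^sup>2"
proof -
  let ?p = "\<rho> (free_gen i) v"
  have g: "free_gen i \<in> B" using i by (rule free_closed(8))
  have p: "?p \<in> carrier H" using g v by (rule rep_closed)
  have 1: "inner_prod H ?p v = inner_prod H v ?p"
    using rep_adjoint[OF g v v] i v by (simp add: rep_star_gen)
  have 2: "inner_prod H ?p ?p = inner_prod H v ?p"
    using rep_adjoint[OF g v p] i v p by (simp add: rep_star_gen rep_gen_idem)
  show ?thesis
    using v p 1 2 by (simp add: H.vec_norm_sq H.inner_diff_left H.inner_diff_right)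
qed

text \<open>Both actions are followed in parallel, on \<open>v\<close> through \<open>\<rho>\<close>
  and on \<open>y\<close> by multiplication, so that one scalar serves for both.\<close>

lemma rep_common_scalar:
  assumes "x \<in> carrier (free_star_algebra F)" and FI: "F \<subseteq> I"
    and v: "v \<in> carrier H" and y: "y \<in> carrier A"
    and F: "\<And>i. i \<in> F \<Longrightarrow> \<exists>c. \<rho> (free_gen i) v = c \<odot>\<^bsub>H\<^esub> v \<and> q i \<otimes>\<^bsub>A\<^esub> y = c \<odot>\<^bsub>A\<^esub> y"
  shows "\<exists>c. \<rho> x v = c \<odot>\<^bsub>H\<^esub> v \<and> free_eval x \<otimes>\<^bsub>A\<^esub> y = c \<odot>\<^bsub>A\<^esub> y"
  using assms(1) FI
proof (induction rule: free_induct_gens)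
  case zero
  show ?case using v y by (intro exI[of _ 0]) simp
next
  case (gen i)
  then show ?case using F FI by (simp add: free_eval_gen subsetD)
next
  case (adj i)
  then show ?case using F FI v by (simp add: free_eval_gen rep_star_gen subsetD)
next
  case (add x z)
  then obtain c d where "\<rho> x v = c \<odot>\<^bsub>H\<^esub> v" "free_eval x \<otimes>\<^bsub>A\<^esub> y = c \<odot>\<^bsub>A\<^esub> y"
    "\<rho> z v = d \<odot>\<^bsub>H\<^esub> v" "free_eval z \<otimes>\<^bsub>A\<^esub> y = d \<odot>\<^bsub>A\<^esub> y" by blast
  with add(1,2) v y show ?case
    by (intro exI[of _ "c + d"])
      (simp add: free_eval_add mult_add_left smult_add_left rep_add H.smult_add_left del: carrier_free)
next
  case (mult x z)
  then obtain c d where "\<rho> x v = c \<odot>\<^bsub>H\<^esub> v" "free_eval x \<otimes>\<^bsub>A\<^esub> y = c \<odot>\<^bsub>A\<^esub> y"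
    "\<rho> z v = d \<odot>\<^bsub>H\<^esub> v" "free_eval z \<otimes>\<^bsub>A\<^esub> y = d \<odot>\<^bsub>A\<^esub> y" by blast
  with mult(1,2) v y show ?case
    by (intro exI[of _ "d * c"])
      (simp add: free_eval_mult mult_assoc smult_mult_right smult_smult rep_mult rep_vec_smult
        H.smult_smult del: carrier_free)
next
  case (smult a x)
  then obtain c where "\<rho> x v = c \<odot>\<^bsub>H\<^esub> v" "free_eval x \<otimes>\<^bsub>A\<^esub> y = c \<odot>\<^bsub>A\<^esub> y" by blast
  with smult(1) v y show ?case
    by (intro exI[of _ "a * c"])
      (simp add: free_eval_smult smult_mult_left smult_smult rep_smult H.smult_smult del: carrier_free)
qed

text \<open>The witness starts as the generator \<open>s\<close>, which fixes \<open>v\<close> and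
  replaces a unit. For each \<open>j\<close> it is multiplied by the generator if that fixes
  \<open>v\<close>, and by its complement if that annihilates \<open>v\<close>. The result still
  fixes \<open>v\<close>, while its evaluation has the same eigenvalues as \<open>v\<close>; by
  \<open>rep_kernel\<close> that evaluation is nonzero when \<open>v\<close> is.\<close>

lemma rep_ex_support:
  assumes "finite F" "F \<subseteq> I" and s: "s \<in> I" "\<rho> (free_gen s) v = v" and v: "v \<in> carrier H"
    and "\<And>i. i \<in> F \<Longrightarrow> \<rho> (free_gen i) v = v \<or> \<rho> (free_gen i) v = \<zero>\<^bsub>H\<^esub>"
  shows "\<exists>y\<in>B. \<rho> y v = v \<and> (\<forall>i\<in>F. \<exists>c. \<rho> (free_gen i) v = c \<odot>\<^bsub>H\<^esub> v \<and>
    q i \<otimes>\<^bsub>A\<^esub> free_eval y = c \<odot>\<^bsub>A\<^esub> free_eval y)"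
  using assms(1,2,6)
proof (induction F)
  case empty
  then show ?case using s free_closed(8)[of s I] by blast
next
  case (insert j F)
  then obtain y where y: "y \<in> B" "\<rho> y v = v" "\<And>i. i \<in> F \<Longrightarrow> \<exists>c. \<rho> (free_gen i) v = c \<odot>\<^bsub>H\<^esub> v \<and>
    q i \<otimes>\<^bsub>A\<^esub> free_eval y = c \<odot>\<^bsub>A\<^esub> free_eval y" by blast
  have j [simp]: "j \<in> I" using insert by simp
  let ?Y = "free_eval y" and ?g = "free_gen j"
  note [simp] = free_eval_closed[OF y(1)] mult_closed v
  have g: "?g \<in> B" "?g * y \<in> B" "y - ?g * y \<in> B"
    using y(1) by (auto intro!: free_closed(3,4,8) simp del: carrier_free)
  have gy: "free_eval (?g * y) = q j \<otimes>\<^bsub>A\<^esub> ?Y"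
    using y(1) g(1) by (simp add: free_eval_mult free_eval_gen del: carrier_free)
  have jj: "q j \<otimes>\<^bsub>A\<^esub> (q j \<otimes>\<^bsub>A\<^esub> ?Y) = q j \<otimes>\<^bsub>A\<^esub> ?Y"
    by (simp flip: mult_assoc)
  have comm: "q i \<otimes>\<^bsub>A\<^esub> (q j \<otimes>\<^bsub>A\<^esub> ?Y) = c \<odot>\<^bsub>A\<^esub> (q j \<otimes>\<^bsub>A\<^esub> ?Y)"
    if "i \<in> I" "q i \<otimes>\<^bsub>A\<^esub> ?Y = c \<odot>\<^bsub>A\<^esub> ?Y" for i c
    using that mult_lcomm[of "q i" "q j" ?Y] by (simp add: smult_mult_right)
  have FI: "i \<in> I" if "i \<in> F" for i using insert that by auto
  show ?case
  proof (cases "\<rho> ?g v = v")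
    case True
    show ?thesis
    proof (intro bexI[of _ "?g * y"] conjI ballI)
      show "\<rho> (?g * y) v = v" using g(1) y(1,2) True by (simp add: rep_mult del: carrier_free)
      fix i assume i: "i \<in> insert j F"
      show "\<exists>c. \<rho> (free_gen i) v = c \<odot>\<^bsub>H\<^esub> v \<and>
        q i \<otimes>\<^bsub>A\<^esub> free_eval (?g * y) = c \<odot>\<^bsub>A\<^esub> free_eval (?g * y)"
      proof (cases "i = j")
        case True
        then show ?thesis using \<open>\<rho> ?g v = v\<close> by (intro exI[of _ 1]) (simp add: gy jj)
      next
        case False
        then show ?thesis using y(3)[of i] comm FI i unfolding gy by blast
      qed
    qed (rule g)
  next
    case False
    then have 0: "\<rho> ?g v = \<zero>\<^bsub>H\<^esub>" using insert.prems(2)[of j] by blast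
    have ev: "free_eval (y - ?g * y) = ?Y \<ominus>\<^bsub>A\<^esub> q j \<otimes>\<^bsub>A\<^esub> ?Y"
      using y(1) g by (simp add: free_eval_diff gy del: carrier_free)
    show ?thesis
    proof (intro bexI[of _ "y - ?g * y"] conjI ballI)
      show "\<rho> (y - ?g * y) v = v"
        using g y(1,2) 0 by (simp add: rep_diff rep_mult a_minus_def del: carrier_free)
      fix i assume i: "i \<in> insert j F"
      show "\<exists>c. \<rho> (free_gen i) v = c \<odot>\<^bsub>H\<^esub> v \<and>
        q i \<otimes>\<^bsub>A\<^esub> free_eval (y - ?g * y) = c \<odot>\<^bsub>A\<^esub> free_eval (y - ?g * y)"
      proof (cases "i = j")
        case True
        then show ?thesis
          using 0 by (intro exI[of _ 0]) (simp add: ev mult_diff_right jj minus_eq_iff)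
      next
        case False
        then obtain c where c: "\<rho> (free_gen i) v = c \<odot>\<^bsub>H\<^esub> v" "q i \<otimes>\<^bsub>A\<^esub> ?Y = c \<odot>\<^bsub>A\<^esub> ?Y"
          using y(3)[of i] i by blast
        have [simp]: "i \<in> I" using False i FI by blast
        show ?thesis
          using c comm[of i c] by (intro exI[of _ c]) (simp add: ev mult_diff_right smult_diff)
      qed
    qed (rule g)
  qed
qed

text \<open>The operators of the generators commute with \<open>\<rho> x\<close>, so both
  \<open>v\<close> and its image split orthogonally along them and the estimate follows from that
  for the pieces, with the same constant.\<close>

theorem rep_norm_le:
  assumes x: "x \<in> B" and v: "v \<in> carrier H"
  shows "vec_norm H (\<rho> x v) \<le> nrm A (free_eval x) * vec_norm H v"
proof -
  let ?F = "free_support x" and ?K = "nrm A (free_eval x)"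
  note F = free_support[OF x]
  have K: "0 \<le> ?K" using x by (intro nrm_nonneg free_eval_closed)
  \<comment> \<open>\<open>F'\<close> holds the generators along which \<open>v\<close> is still to
    be split; all others occurring in \<open>x\<close> already fix or annihilate
    \<open>v\<close>.\<close>
  have "vec_norm H (\<rho> x v) \<le> ?K * vec_norm H v"
    if "finite F'" "F' \<subseteq> ?F" "v \<in> carrier H"
      "\<And>i. i \<in> ?F - F' \<Longrightarrow> \<rho> (free_gen i) v = v \<or> \<rho> (free_gen i) v = \<zero>\<^bsub>H\<^esub>" for F' v
    using that
  proof (induction F' arbitrary: v)
    case empty
    note v [simp] = empty(2)
    show ?case
    proof (cases "\<exists>s\<in>?F. \<rho> (free_gen s) v = v")
      case True
      then obtain s where s: "s \<in> I" "\<rho> (free_gen s) v = v" using F(2) by blast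
      have "\<exists>y\<in>B. \<rho> y v = v \<and> (\<forall>i\<in>?F. \<exists>c. \<rho> (free_gen i) v = c \<odot>\<^bsub>H\<^esub> v \<and>
          q i \<otimes>\<^bsub>A\<^esub> free_eval y = c \<odot>\<^bsub>A\<^esub> free_eval y)"
        using empty(3) by (intro rep_ex_support[OF F(1,2) s v]) simp
      then obtain y where y: "y \<in> B" "\<rho> y v = v"
        "\<And>i. i \<in> ?F \<Longrightarrow> \<exists>c. \<rho> (free_gen i) v = c \<odot>\<^bsub>H\<^esub> v \<and>
          q i \<otimes>\<^bsub>A\<^esub> free_eval y = c \<odot>\<^bsub>A\<^esub> free_eval y" by blast
      have Y: "free_eval y \<in> carrier A" using y(1) by (rule free_eval_closed)
      obtain c where c: "\<rho> x v = c \<odot>\<^bsub>H\<^esub> v" "free_eval x \<otimes>\<^bsub>A\<^esub> free_eval y = c \<odot>\<^bsub>A\<^esub> free_eval y"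
        using rep_common_scalar[OF F(3,2) v Y y(3)] by blast
      show ?thesis
      proof (cases "v = \<zero>\<^bsub>H\<^esub>")
        case True
        then show ?thesis using x by (simp del: carrier_free)
      next
        case False
        then have "free_eval y \<noteq> \<zero>\<^bsub>A\<^esub>" using rep_kernel[OF y(1) _ v] y(2) by metis
        then have nz: "0 < nrm A (free_eval y)"
          using nrm_nonneg[OF Y] nrm_eq_0_iff[OF Y] by linarith
        \<comment> \<open>The eigenvalue \<open>c\<close> of \<open>\<rho> x\<close> at
          \<open>v\<close> is an eigenvalue of multiplication by \<open>free_eval x\<close> at the
          nonzero element \<open>free_eval y\<close>; submultiplicativity bounds it.\<close>
        have "cmod c * nrm A (free_eval y) \<le> ?K * nrm A (free_eval y)"
          using nrm_mult[OF free_eval_closed[OF x] Y] by (simp add: c nrm_smult Y)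
        then have "cmod c \<le> ?K" using nz by simp
        then show ?thesis
          by (simp add: c H.vec_norm_smult mult_right_mono)
      qed
    next
      case False
      then have 0: "\<rho> (free_gen i) v = \<zero>\<^bsub>H\<^esub>" if "i \<in> ?F" for i using empty(3) that by blast
      \<comment> \<open>All generators in the support annihilate \<open>v\<close>, and
        \<open>x\<close> has no constant term.\<close>
      have "\<rho> x v = \<zero>\<^bsub>H\<^esub>"
        using F(3,2)
      proof (induction rule: free_induct_gens)
        case (gen i)
        then show ?case by (rule 0)
      next
        case (adj i)
        then show ?case using F(2) v rep_star_gen[of i v] 0 by auto
      qed (use v in \<open>simp_all add: rep_add rep_mult rep_smult del: carrier_free\<close>)
      then show ?thesis using K by simp
    qed
  next
    case (insert j F')
    have j: "j \<in> I" using insert.prems F(2) by blast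
    note v = insert.prems(2)
    have g: "free_gen j \<in> B" using j by (rule free_closed(8))
    let ?P = "\<lambda>v. \<rho> (free_gen j) v"
    let ?v1 = "?P v" and ?v2 = "v \<ominus>\<^bsub>H\<^esub> ?P v" and ?w = "\<rho> x v"
    have cl: "?v1 \<in> carrier H" "?v2 \<in> carrier H" "?w \<in> carrier H" "?P ?w \<in> carrier H"
      "?w \<ominus>\<^bsub>H\<^esub> ?P ?w \<in> carrier H"
      using g v x by (auto simp del: carrier_free)
    have comm: "\<rho> y (?P u) = ?P (\<rho> y u)" if "y \<in> B" "u \<in> carrier H" for y u
    proof -
      have "\<rho> (y * free_gen j) u = \<rho> (free_gen j * y) u"
        using that g j
        by (intro rep_cong free_closed(4)) (simp_all add: free_eval_mult mult_commute del: carrier_free)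
      then show ?thesis using that g by (simp add: rep_mult del: carrier_free)
    qed
    have P2: "?P ?v2 = \<zero>\<^bsub>H\<^esub>"
      using g v j by (simp add: rep_vec_diff rep_gen_idem H.minus_eq_iff del: carrier_free)
    have step: "(\<rho> (free_gen i) ?v1 = ?v1 \<or> \<rho> (free_gen i) ?v1 = \<zero>\<^bsub>H\<^esub>) \<and>
        (\<rho> (free_gen i) ?v2 = ?v2 \<or> \<rho> (free_gen i) ?v2 = \<zero>\<^bsub>H\<^esub>)" if i: "i \<in> ?F - F'" for i
    proof (cases "i = j")
      case True
      then show ?thesis using P2 rep_gen_idem[OF j v] by simp
    next
      case False
      have gi: "free_gen i \<in> B" using i F(2) by (intro free_closed(8)) blast
      have "\<rho> (free_gen i) v = v \<or> \<rho> (free_gen i) v = \<zero>\<^bsub>H\<^esub>"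
        using insert.prems(3)[of i] i False by blast
      then show ?thesis
        using gi g v cl by (auto simp: comm rep_vec_diff H.minus_eq_iff simp del: carrier_free)
    qed
    have n1: "vec_norm H (\<rho> x ?v1) \<le> ?K * vec_norm H ?v1"
      and n2: "vec_norm H (\<rho> x ?v2) \<le> ?K * vec_norm H ?v2"
      using insert.prems(1) cl step by (auto intro!: insert.IH)
    \<comment> \<open>Pythagoras is applied to the image of \<open>v\<close>; commutation turns its
      two components into the images of \<open>?v1\<close> and \<open>?v2\<close>.\<close>
    have "(vec_norm H ?w)\<^sup>2 = (vec_norm H (\<rho> x ?v1))\<^sup>2 + (vec_norm H (\<rho> x ?v2))\<^sup>2"
      using rep_gen_pythagoras[OF j cl(3)] x v cl by (simp add: comm rep_vec_diff del: carrier_free)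
    also have "\<dots> \<le> (?K * vec_norm H ?v1)\<^sup>2 + (?K * vec_norm H ?v2)\<^sup>2"
      using n1 n2 x cl by (intro add_mono power_mono) (simp_all del: carrier_free)
    also have "\<dots> = (?K * vec_norm H v)\<^sup>2"
      using rep_gen_pythagoras[OF j v] by (simp add: power_mult_distrib distrib_left)
    finally show ?case
      by (rule power2_le_imp_le) (use K v in simp)
  qed
  from this[OF F(1) subset_refl v] show ?thesis by blast
qed

corollary op_norm_rep_le: "x \<in> B \<Longrightarrow> op_norm H (\<rho> x) \<le> nrm A (free_eval x)"
  by (rule H.op_norm_le) (simp_all add: rep_norm_le nrm_nonneg del: carrier_free)

end

section \<open>Direct sums\<close>

locale hilbert_family =
  fixes J :: "'j set" and H :: "'j \<Rightarrow> 'h inner_space"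
  assumes hilbert: "j \<in> J \<Longrightarrow> hilbert_space (H j)"
begin

abbreviation "S \<equiv> direct_sum J H"

lemma direct_sum_simps:
  "zero S = (\<lambda>j\<in>J. \<zero>\<^bsub>H j\<^esub>)" "add S f g = (\<lambda>j\<in>J. f j \<oplus>\<^bsub>H j\<^esub> g j)"
  "smult S c f = (\<lambda>j\<in>J. c \<odot>\<^bsub>H j\<^esub> f j)"
  "inner_prod S f g = (\<Sum>\<^sub>\<infinity>j\<in>J. inner_prod (H j) (f j) (g j))"
  by (simp_all add: direct_sum_def)

lemma carrier_direct_sum:
  "f \<in> carrier S \<longleftrightarrow> (\<forall>j\<in>J. f j \<in> carrier (H j)) \<and> f \<in> extensional J \<and>
    (\<lambda>j. (vec_norm (H j) (f j))\<^sup>2) summable_on J"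
  by (auto simp: direct_sum_def PiE_iff)

lemma closedD: "f \<in> carrier S \<Longrightarrow> j \<in> J \<Longrightarrow> f j \<in> carrier (H j)"
  by (simp add: carrier_direct_sum)

lemma direct_sum_eqI:
  assumes "f \<in> carrier S" "g \<in> carrier S" "\<And>j. j \<in> J \<Longrightarrow> f j = g j"
  shows "f = g"
  using assms by (auto simp: carrier_direct_sum intro: extensionalityI)

text \<open>Comparison test: membership in the direct sum follows from a summable bound on the
  squared norms of the components.\<close>

lemma closed_of_bound:
  assumes cl: "\<And>j. j \<in> J \<Longrightarrow> f j \<in> carrier (H j)" and ext: "f \<in> extensional J"
    and g: "g summable_on J" and le: "\<And>j. j \<in> J \<Longrightarrow> (vec_norm (H j) (f j))\<^sup>2 \<le> g j"
  shows "f \<in> carrier S"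
  unfolding carrier_direct_sum using cl ext summable_on_comparison_test[OF g le] by simp

lemma zero_closed: "\<zero>\<^bsub>S\<^esub> \<in> carrier S"
proof (rule closed_of_bound[where g = "\<lambda>_. 0"])
  fix j assume "j \<in> J"
  then interpret hilbert_space "H j" by (rule hilbert)
  show "\<zero>\<^bsub>S\<^esub> j \<in> carrier (H j)" "(vec_norm (H j) (\<zero>\<^bsub>S\<^esub> j))\<^sup>2 \<le> 0"
    using \<open>j \<in> J\<close> by (simp_all add: direct_sum_simps)
qed (simp_all add: direct_sum_simps)

lemma add_closed:
  assumes f: "f \<in> carrier S" and g: "g \<in> carrier S"
  shows "f \<oplus>\<^bsub>S\<^esub> g \<in> carrier S"
proof (rule closed_of_bound)
  show "(\<lambda>j. 2 * (vec_norm (H j) (f j))\<^sup>2 + 2 * (vec_norm (H j) (g j))\<^sup>2) summable_on J"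
    using f g by (intro summable_on_add summable_on_cmult_right) (simp_all add: carrier_direct_sum)
  fix j assume j: "j \<in> J"
  then interpret hilbert_space "H j" by (rule hilbert)
  have cl: "f j \<in> carrier (H j)" "g j \<in> carrier (H j)"
    using f g j by (simp_all add: carrier_direct_sum)
  then show "(f \<oplus>\<^bsub>S\<^esub> g) j \<in> carrier (H j)"
    using j by (simp add: direct_sum_simps)
  have "(vec_norm (H j) (f j \<oplus>\<^bsub>H j\<^esub> g j))\<^sup>2 \<le> (vec_norm (H j) (f j) + vec_norm (H j) (g j))\<^sup>2"
    using cl by (intro power_mono vec_norm_triangle) simp_all
  also have "\<dots> \<le> 2 * (vec_norm (H j) (f j))\<^sup>2 + 2 * (vec_norm (H j) (g j))\<^sup>2"
    using sum_squares_bound[of "vec_norm (H j) (f j)" "vec_norm (H j) (g j)"]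
    by (simp add: power2_sum)
  finally show "(vec_norm (H j) ((f \<oplus>\<^bsub>S\<^esub> g) j))\<^sup>2 \<le>
      2 * (vec_norm (H j) (f j))\<^sup>2 + 2 * (vec_norm (H j) (g j))\<^sup>2"
    using j by (simp add: direct_sum_simps)
qed (simp add: direct_sum_simps)

lemma smult_closed:
  assumes f: "f \<in> carrier S"
  shows "c \<odot>\<^bsub>S\<^esub> f \<in> carrier S"
proof (rule closed_of_bound)
  show "(\<lambda>j. (cmod c)\<^sup>2 * (vec_norm (H j) (f j))\<^sup>2) summable_on J"
    using f by (intro summable_on_cmult_right) (simp_all add: carrier_direct_sum)
  fix j assume j: "j \<in> J"
  then interpret hilbert_space "H j" by (rule hilbert)
  have cl: "f j \<in> carrier (H j)"
    using f j by (simp_all add: carrier_direct_sum)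
  then show "(c \<odot>\<^bsub>S\<^esub> f) j \<in> carrier (H j)"
    "(vec_norm (H j) ((c \<odot>\<^bsub>S\<^esub> f) j))\<^sup>2 \<le> (cmod c)\<^sup>2 * (vec_norm (H j) (f j))\<^sup>2"
    using j by (simp_all add: direct_sum_simps vec_norm_smult power_mult_distrib)
qed (simp add: direct_sum_simps)

text \<open>Cauchy-Schwarz in each component and 2 a b \<le> a^2 + b^2 dominate the terms by a
  summable family.\<close>

lemma inner_summable:
  assumes f: "f \<in> carrier S" and g: "g \<in> carrier S"
  shows "(\<lambda>j. inner_prod (H j) (f j) (g j)) summable_on J"
proof (rule Infinite_Sum.abs_summable_summable, rule Infinite_Sum.abs_summable_on_comparison_test')
  show "(\<lambda>j. (vec_norm (H j) (f j))\<^sup>2 + (vec_norm (H j) (g j))\<^sup>2) summable_on J"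
    using f g by (intro summable_on_add) (simp_all add: carrier_direct_sum)
  fix j assume j: "j \<in> J"
  then interpret hilbert_space "H j" by (rule hilbert)
  have cl: "f j \<in> carrier (H j)" "g j \<in> carrier (H j)"
    using f g j by (simp_all add: carrier_direct_sum)
  have "0 \<le> (vec_norm (H j) (f j))\<^sup>2 + (vec_norm (H j) (g j))\<^sup>2" by simp
  then show "cmod (inner_prod (H j) (f j) (g j)) \<le> (vec_norm (H j) (f j))\<^sup>2 + (vec_norm (H j) (g j))\<^sup>2"
    using cauchy_schwarz[OF cl] sum_squares_bound[of "vec_norm (H j) (f j)" "vec_norm (H j) (g j)"]
    by linarith
qed

text \<open>Moves the complex sum of the inner products to a real sum, where positivity and
  comparison of sums are available.\<close>

lemma inner_self_direct_sum:
  assumes f: "f \<in> carrier S"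
  shows "inner_prod S f f = complex_of_real (\<Sum>\<^sub>\<infinity>j\<in>J. (vec_norm (H j) (f j))\<^sup>2)"
proof -
  have "inner_prod S f f = (\<Sum>\<^sub>\<infinity>j\<in>J. complex_of_real ((vec_norm (H j) (f j))\<^sup>2))"
    unfolding direct_sum_simps
  proof (rule infsum_cong)
    fix j assume j: "j \<in> J"
    then interpret hilbert_space "H j" by (rule hilbert)
    show "inner_prod (H j) (f j) (f j) = complex_of_real ((vec_norm (H j) (f j))\<^sup>2)"
      using f j by (intro inner_self) (simp add: carrier_direct_sum)
  qed
  moreover have "((\<lambda>j. complex_of_real ((vec_norm (H j) (f j))\<^sup>2)) has_sum
      complex_of_real (\<Sum>\<^sub>\<infinity>j\<in>J. (vec_norm (H j) (f j))\<^sup>2)) J"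
    using f by (intro has_sum_of_real has_sum_infsum) (simp add: carrier_direct_sum)
  ultimately show ?thesis by (simp add: infsumI)
qed

lemma abelian_group_direct_sum: "abelian_group S"
proof (rule abelian_groupI)
  fix f g h assume f: "f \<in> carrier S" and g: "g \<in> carrier S" and h: "h \<in> carrier S"
  show "f \<oplus>\<^bsub>S\<^esub> g \<in> carrier S" using f g by (rule add_closed)
  show "f \<oplus>\<^bsub>S\<^esub> g \<oplus>\<^bsub>S\<^esub> h = f \<oplus>\<^bsub>S\<^esub> (g \<oplus>\<^bsub>S\<^esub> h)"
  proof (rule direct_sum_eqI)
    fix j assume j: "j \<in> J"
    then interpret hilbert_space "H j" by (rule hilbert)
    show "(f \<oplus>\<^bsub>S\<^esub> g \<oplus>\<^bsub>S\<^esub> h) j = (f \<oplus>\<^bsub>S\<^esub> (g \<oplus>\<^bsub>S\<^esub> h)) j"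
      using f g h j by (simp add: direct_sum_simps closedD M.a_assoc)
  qed (intro add_closed f g h)+
  show "f \<oplus>\<^bsub>S\<^esub> g = g \<oplus>\<^bsub>S\<^esub> f"
  proof (rule direct_sum_eqI)
    fix j assume j: "j \<in> J"
    then interpret hilbert_space "H j" by (rule hilbert)
    show "(f \<oplus>\<^bsub>S\<^esub> g) j = (g \<oplus>\<^bsub>S\<^esub> f) j"
      using f g j by (simp add: direct_sum_simps closedD M.a_comm)
  qed (intro add_closed f g)+
next
  fix f assume f: "f \<in> carrier S"
  show "\<zero>\<^bsub>S\<^esub> \<oplus>\<^bsub>S\<^esub> f = f"
  proof (rule direct_sum_eqI)
    fix j assume j: "j \<in> J"
    then interpret hilbert_space "H j" by (rule hilbert)
    show "(\<zero>\<^bsub>S\<^esub> \<oplus>\<^bsub>S\<^esub> f) j = f j"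
      using f j by (simp add: direct_sum_simps closedD)
  qed (intro add_closed zero_closed f)+
  have "((- 1) \<odot>\<^bsub>S\<^esub> f) \<oplus>\<^bsub>S\<^esub> f = \<zero>\<^bsub>S\<^esub>"
  proof (rule direct_sum_eqI)
    fix j assume j: "j \<in> J"
    then interpret hilbert_space "H j" by (rule hilbert)
    show "(((- 1) \<odot>\<^bsub>S\<^esub> f) \<oplus>\<^bsub>S\<^esub> f) j = \<zero>\<^bsub>S\<^esub> j"
      using f j by (simp add: direct_sum_simps closedD smult_minus_1 M.l_neg)
  qed (intro add_closed smult_closed zero_closed f)+
  then show "\<exists>g\<in>carrier S. g \<oplus>\<^bsub>S\<^esub> f = \<zero>\<^bsub>S\<^esub>"
    using smult_closed[OF f] by blast
qed (rule zero_closed)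

lemma module_direct_sum: "Module.module complex_field S"
proof (rule moduleI[OF cring_complex_field abelian_group_direct_sum])
  fix a b :: complex and f g assume f: "f \<in> carrier S" and g: "g \<in> carrier S"
  show "a \<odot>\<^bsub>S\<^esub> f \<in> carrier S" using f by (rule smult_closed)
  show "a \<odot>\<^bsub>S\<^esub> (f \<oplus>\<^bsub>S\<^esub> g) = a \<odot>\<^bsub>S\<^esub> f \<oplus>\<^bsub>S\<^esub> a \<odot>\<^bsub>S\<^esub> g"
  proof (rule direct_sum_eqI)
    fix j assume j: "j \<in> J"
    then interpret hilbert_space "H j" by (rule hilbert)
    show "(a \<odot>\<^bsub>S\<^esub> (f \<oplus>\<^bsub>S\<^esub> g)) j = (a \<odot>\<^bsub>S\<^esub> f \<oplus>\<^bsub>S\<^esub> a \<odot>\<^bsub>S\<^esub> g) j"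
      using f g j by (simp add: direct_sum_simps closedD smult_add_right)
  qed (intro add_closed smult_closed f g)+
next
  fix a b :: complex and f assume f: "f \<in> carrier S"
  show "(a \<oplus>\<^bsub>complex_field\<^esub> b) \<odot>\<^bsub>S\<^esub> f = a \<odot>\<^bsub>S\<^esub> f \<oplus>\<^bsub>S\<^esub> b \<odot>\<^bsub>S\<^esub> f"
  proof (rule direct_sum_eqI)
    fix j assume j: "j \<in> J"
    then interpret hilbert_space "H j" by (rule hilbert)
    show "((a \<oplus>\<^bsub>complex_field\<^esub> b) \<odot>\<^bsub>S\<^esub> f) j = (a \<odot>\<^bsub>S\<^esub> f \<oplus>\<^bsub>S\<^esub> b \<odot>\<^bsub>S\<^esub> f) j"
      using f j by (simp add: direct_sum_simps closedD smult_add_left)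
  qed (intro add_closed smult_closed f)+
  show "(a \<otimes>\<^bsub>complex_field\<^esub> b) \<odot>\<^bsub>S\<^esub> f = a \<odot>\<^bsub>S\<^esub> (b \<odot>\<^bsub>S\<^esub> f)"
  proof (rule direct_sum_eqI)
    fix j assume j: "j \<in> J"
    then interpret hilbert_space "H j" by (rule hilbert)
    show "((a \<otimes>\<^bsub>complex_field\<^esub> b) \<odot>\<^bsub>S\<^esub> f) j = (a \<odot>\<^bsub>S\<^esub> (b \<odot>\<^bsub>S\<^esub> f)) j"
      using f j by (simp add: direct_sum_simps closedD smult_smult)
  qed (intro add_closed smult_closed f)+
  show "\<one>\<^bsub>complex_field\<^esub> \<odot>\<^bsub>S\<^esub> f = f"
  proof (rule direct_sum_eqI)
    fix j assume j: "j \<in> J"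
    then interpret hilbert_space "H j" by (rule hilbert)
    show "(\<one>\<^bsub>complex_field\<^esub> \<odot>\<^bsub>S\<^esub> f) j = f j"
      using f j by (simp add: direct_sum_simps closedD)
  qed (intro add_closed smult_closed f)+
qed

lemma pre_hilbert_space_direct_sum: "pre_hilbert_space S"
proof (rule pre_hilbert_space.intro[OF complex_space.intro[OF module_direct_sum]], unfold_locales)
  fix f g h c assume f: "f \<in> carrier S" and g: "g \<in> carrier S" and h: "h \<in> carrier S"
  have "inner_prod S (f \<oplus>\<^bsub>S\<^esub> g) h =
      (\<Sum>\<^sub>\<infinity>j\<in>J. inner_prod (H j) (f j) (h j) + inner_prod (H j) (g j) (h j))"
    unfolding direct_sum_simps(4)
  proof (rule infsum_cong)
    fix j assume j: "j \<in> J"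
    then interpret hilbert_space "H j" by (rule hilbert)
    show "inner_prod (H j) ((f \<oplus>\<^bsub>S\<^esub> g) j) (h j) = inner_prod (H j) (f j) (h j) + inner_prod (H j) (g j) (h j)"
      using f g h j by (simp add: direct_sum_simps closedD inner_add)
  qed
  also have "\<dots> = inner_prod S f h + inner_prod S g h"
    unfolding direct_sum_simps(4) by (intro infsum_add inner_summable f g h)
  finally show "inner_prod S (f \<oplus>\<^bsub>S\<^esub> g) h = inner_prod S f h + inner_prod S g h" .
next
  fix f g c assume f: "f \<in> carrier S" and g: "g \<in> carrier S"
  have "inner_prod S (c \<odot>\<^bsub>S\<^esub> f) g = (\<Sum>\<^sub>\<infinity>j\<in>J. c * inner_prod (H j) (f j) (g j))"
    unfolding direct_sum_simps(4)
  proof (rule infsum_cong)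
    fix j assume j: "j \<in> J"
    then interpret hilbert_space "H j" by (rule hilbert)
    show "inner_prod (H j) ((c \<odot>\<^bsub>S\<^esub> f) j) (g j) = c * inner_prod (H j) (f j) (g j)"
      using f g j by (simp add: direct_sum_simps closedD inner_smult)
  qed
  then show "inner_prod S (c \<odot>\<^bsub>S\<^esub> f) g = c * inner_prod S f g"
    by (simp add: infsum_cmult_right' direct_sum_simps(4))
  have "inner_prod S f g = (\<Sum>\<^sub>\<infinity>j\<in>J. cnj (inner_prod (H j) (g j) (f j)))"
    unfolding direct_sum_simps(4)
  proof (rule infsum_cong)
    fix j assume j: "j \<in> J"
    then interpret hilbert_space "H j" by (rule hilbert)
    show "inner_prod (H j) (f j) (g j) = cnj (inner_prod (H j) (g j) (f j))"
      using f g j by (intro inner_commute closedD)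
  qed
  then show "inner_prod S f g = cnj (inner_prod S g f)"
    by (simp add: direct_sum_simps(4))
next
  fix f assume f: "f \<in> carrier S"
  show "0 \<le> Re (inner_prod S f f)"
    using f by (simp add: inner_self_direct_sum infsum_nonneg)
  assume "inner_prod S f f = 0"
  then have 0: "(\<Sum>\<^sub>\<infinity>j\<in>J. (vec_norm (H j) (f j))\<^sup>2) = 0"
    using f by (simp add: inner_self_direct_sum)
  show "f = \<zero>\<^bsub>S\<^esub>"
  proof (rule direct_sum_eqI[OF f zero_closed])
    fix j assume j: "j \<in> J"
    then interpret hilbert_space "H j" by (rule hilbert)
    have "(vec_norm (H j) (f j))\<^sup>2 = 0"
      using f by (intro nonneg_infsum_le_0D[OF _ _ _ j]) (simp_all add: 0 carrier_direct_sum)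
    then show "f j = \<zero>\<^bsub>S\<^esub> j"
      using f j by (simp add: direct_sum_simps closedD vec_norm_eq_0_iff)
  qed
qed

sublocale S: pre_hilbert_space S by (rule pre_hilbert_space_direct_sum)

lemma vec_norm_direct_sum_sq:
  "f \<in> carrier S \<Longrightarrow> (vec_norm S f)\<^sup>2 = (\<Sum>\<^sub>\<infinity>j\<in>J. (vec_norm (H j) (f j))\<^sup>2)"
  by (simp add: S.vec_norm_sq inner_self_direct_sum)

lemma direct_sum_diff:
  assumes f: "f \<in> carrier S" and g: "g \<in> carrier S" and j: "j \<in> J"
  shows "(f \<ominus>\<^bsub>S\<^esub> g) j = f j \<ominus>\<^bsub>H j\<^esub> g j"
proof -
  interpret hilbert_space "H j" using j by (rule hilbert)
  have "f \<ominus>\<^bsub>S\<^esub> g = f \<oplus>\<^bsub>S\<^esub> (- 1) \<odot>\<^bsub>S\<^esub> g"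
    using g by (simp add: a_minus_def S.smult_minus_1)
  then show ?thesis
    using f g j by (simp add: direct_sum_simps closedD smult_minus_1 a_minus_def)
qed

lemma sum_sq_le_vec_norm:
  assumes f: "f \<in> carrier S" and F: "finite F" "F \<subseteq> J"
  shows "(\<Sum>j\<in>F. (vec_norm (H j) (f j))\<^sup>2) \<le> (vec_norm S f)\<^sup>2"
  unfolding vec_norm_direct_sum_sq[OF f]
  using f F by (intro finite_sum_le_infsum) (simp_all add: carrier_direct_sum)

lemma vec_norm_component_le:
  assumes f: "f \<in> carrier S" and j: "j \<in> J"
  shows "vec_norm (H j) (f j) \<le> vec_norm S f"
proof (rule power2_le_imp_le)
  show "(vec_norm (H j) (f j))\<^sup>2 \<le> (vec_norm S f)\<^sup>2"
    using sum_sq_le_vec_norm[OF f, of "{j}"] j by simp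
qed (simp add: f)

text \<open>The completeness argument for square-summable families: componentwise limits exist, and
  bounds uniform over finite sets of indices give convergence in the norm of the sum.\<close>

theorem hilbert_space_direct_sum: "hilbert_space S"
proof (rule S.hilbert_spaceI)
  interpret dS: Metric_space "carrier S" "vec_dist S" by (rule S.Metric_space_vec_dist)
  show "dS.mcomplete"
  proof (rule dS.mcompleteI_tendsto)
    fix \<sigma> :: "nat \<Rightarrow> 'j \<Rightarrow> 'h"
    assume r: "range \<sigma> \<subseteq> carrier S"
      and cauchy: "\<And>\<epsilon>. \<epsilon> > 0 \<Longrightarrow> \<exists>N. \<forall>m\<ge>N. \<forall>n\<ge>N. vec_dist S (\<sigma> m) (\<sigma> n) < \<epsilon>"
    have \<sigma> [simp]: "\<sigma> n \<in> carrier S" for n using r by blast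
    have dist: "vec_dist S (\<sigma> m) (\<sigma> n) = vec_norm S (\<sigma> m \<ominus>\<^bsub>S\<^esub> \<sigma> n)" for m n
      by (simp add: vec_dist_def)
    have "\<exists>x\<in>carrier (H j). (\<lambda>n. vec_norm (H j) (\<sigma> n j \<ominus>\<^bsub>H j\<^esub> x)) \<longlonglongrightarrow> 0" if j: "j \<in> J" for j
    proof -
      interpret H: hilbert_space "H j" using j by (rule hilbert)
      interpret d: Metric_space "carrier (H j)" "vec_dist (H j)" by (rule H.Metric_space_vec_dist)
      have cl: "\<sigma> n j \<in> carrier (H j)" for n using closedD[OF \<sigma> j] .
      have "\<exists>N. \<forall>m\<ge>N. \<forall>n\<ge>N. vec_dist (H j) (\<sigma> m j) (\<sigma> n j) < \<epsilon>" if \<epsilon>: "\<epsilon> > 0" for \<epsilon>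
      proof -
        obtain N where N: "\<forall>m\<ge>N. \<forall>n\<ge>N. vec_dist S (\<sigma> m) (\<sigma> n) < \<epsilon>" using cauchy[OF \<epsilon>] by blast
        have "vec_dist (H j) (\<sigma> m j) (\<sigma> n j) \<le> vec_dist S (\<sigma> m) (\<sigma> n)" for m n
          using vec_norm_component_le[OF S.minus_closed[OF \<sigma> \<sigma>] j, of m n]
          by (simp add: vec_dist_def cl direct_sum_diff[OF \<sigma> \<sigma> j])
        then show ?thesis using N order.strict_trans1 by blast
      qed
      then obtain x where "x \<in> carrier (H j)" "(\<lambda>n. vec_dist (H j) (\<sigma> n j) x) \<longlonglongrightarrow> 0"
        using d.mcompleteD_tendsto[OF H.complete, of "\<lambda>n. \<sigma> n j"] cl by (metis image_subsetI)
      then show ?thesis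
        using cl by (intro bexI[of _ x]) (simp_all add: vec_dist_def)
    qed
    then obtain g0 where g0: "\<And>j. j \<in> J \<Longrightarrow> g0 j \<in> carrier (H j)"
      "\<And>j. j \<in> J \<Longrightarrow> (\<lambda>n. vec_norm (H j) (\<sigma> n j \<ominus>\<^bsub>H j\<^esub> g0 j)) \<longlonglongrightarrow> 0" by metis
    \<comment> \<open>The limit is known only componentwise, so the error is formed componentwise;
      the restriction to \<open>J\<close> makes it extensional, as elements of the direct sum have
      to be.\<close>
    define h where "h n = (\<lambda>j\<in>J. \<sigma> n j \<ominus>\<^bsub>H j\<^esub> g0 j)" for n
    have hcl: "h n j \<in> carrier (H j)" if j: "j \<in> J" for n j
    proof -
      interpret H: hilbert_space "H j" using j by (rule hilbert)
      show ?thesis using g0(1)[OF j] closedD[OF \<sigma> j] j by (simp add: h_def)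
    qed
    have lim: "(\<lambda>m. vec_norm (H j) (\<sigma> n j \<ominus>\<^bsub>H j\<^esub> \<sigma> m j)) \<longlonglongrightarrow> vec_norm (H j) (h n j)" if j: "j \<in> J" for n j
    proof -
      interpret H: hilbert_space "H j" using j by (rule hilbert)
      interpret d: Metric_space "carrier (H j)" "vec_dist (H j)" by (rule H.Metric_space_vec_dist)
      note cl = closedD[OF \<sigma> j] g0(1)[OF j]
      have "(\<lambda>m. vec_dist (H j) (\<sigma> n j) (\<sigma> m j) - vec_dist (H j) (\<sigma> n j) (g0 j)) \<longlonglongrightarrow> 0"
      proof (rule tendsto_0_le[where K = 1])
        show "(\<lambda>m. vec_dist (H j) (\<sigma> m j) (g0 j)) \<longlonglongrightarrow> 0"
          using g0(2)[OF j] cl by (simp add: vec_dist_def)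
        have "\<bar>vec_dist (H j) (\<sigma> n j) (\<sigma> m j) - vec_dist (H j) (\<sigma> n j) (g0 j)\<bar> \<le> vec_dist (H j) (\<sigma> m j) (g0 j)" for m
          using d.triangle[OF cl(1)[of n] cl(1)[of m] cl(2)] d.triangle[OF cl(1)[of n] cl(2) cl(1)[of m]]
            d.commute[of "\<sigma> m j" "g0 j"] by linarith
        then show "\<forall>\<^sub>F m in sequentially. norm (vec_dist (H j) (\<sigma> n j) (\<sigma> m j) - vec_dist (H j) (\<sigma> n j) (g0 j))
            \<le> norm (vec_dist (H j) (\<sigma> m j) (g0 j)) * 1"
          by (intro always_eventually allI) (simp add: d.nonneg)
      qed
      then have "(\<lambda>m. vec_dist (H j) (\<sigma> n j) (\<sigma> m j)) \<longlonglongrightarrow> vec_dist (H j) (\<sigma> n j) (g0 j)"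
        by (rule LIM_zero_cancel)
      then show ?thesis using cl j by (simp add: vec_dist_def h_def)
    qed
    \<comment> \<open>For a fixed finite \<open>F\<close> the Cauchy estimate survives the limit in
      \<open>m\<close>; only afterwards is \<open>F\<close> allowed to exhaust
      \<open>J\<close>.\<close>
    have part: "(\<Sum>j\<in>F. (vec_norm (H j) (h n j))\<^sup>2) \<le> \<epsilon>\<^sup>2"
      if N: "\<forall>m\<ge>N. \<forall>n\<ge>N. vec_dist S (\<sigma> m) (\<sigma> n) < \<epsilon>" and n: "N \<le> n" and F: "finite F" "F \<subseteq> J" for N n F \<epsilon>
    proof (rule LIMSEQ_le_const2)
      show "(\<lambda>m. \<Sum>j\<in>F. (vec_norm (H j) (\<sigma> n j \<ominus>\<^bsub>H j\<^esub> \<sigma> m j))\<^sup>2) \<longlonglongrightarrow> (\<Sum>j\<in>F. (vec_norm (H j) (h n j))\<^sup>2)"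
        using F by (intro tendsto_sum tendsto_power lim) blast
      have "(\<Sum>j\<in>F. (vec_norm (H j) (\<sigma> n j \<ominus>\<^bsub>H j\<^esub> \<sigma> m j))\<^sup>2) \<le> \<epsilon>\<^sup>2" if m: "N \<le> m" for m
      proof -
        have "(\<Sum>j\<in>F. (vec_norm (H j) (\<sigma> n j \<ominus>\<^bsub>H j\<^esub> \<sigma> m j))\<^sup>2) = (\<Sum>j\<in>F. (vec_norm (H j) ((\<sigma> n \<ominus>\<^bsub>S\<^esub> \<sigma> m) j))\<^sup>2)"
          using F by (intro sum.cong refl) (auto simp: direct_sum_diff)
        also have "\<dots> \<le> (vec_norm S (\<sigma> n \<ominus>\<^bsub>S\<^esub> \<sigma> m))\<^sup>2"
          using F by (intro sum_sq_le_vec_norm S.minus_closed) simp_all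
        also have "\<dots> \<le> \<epsilon>\<^sup>2"
          using N n m by (intro power_mono) (simp_all flip: dist add: less_imp_le)
        finally show ?thesis .
      qed
      then show "\<exists>M. \<forall>m\<ge>M. (\<Sum>j\<in>F. (vec_norm (H j) (\<sigma> n j \<ominus>\<^bsub>H j\<^esub> \<sigma> m j))\<^sup>2) \<le> \<epsilon>\<^sup>2" by blast
    qed
    have hS: "h n \<in> carrier S \<and> vec_norm S (h n) \<le> \<epsilon>"
      if N: "\<forall>m\<ge>N. \<forall>n\<ge>N. vec_dist S (\<sigma> m) (\<sigma> n) < \<epsilon>" and n: "N \<le> n" and \<epsilon>: "\<epsilon> > 0" for N n \<epsilon>
    proof
      have "(\<lambda>j. (vec_norm (H j) (h n j))\<^sup>2) summable_on J"
        using part[OF N n] by (intro nonneg_bdd_above_summable_on bdd_aboveI2[where M = "\<epsilon>\<^sup>2"]) auto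
      then show h: "h n \<in> carrier S"
        using hcl by (simp add: carrier_direct_sum h_def)
      have "(vec_norm S (h n))\<^sup>2 \<le> \<epsilon>\<^sup>2"
        unfolding vec_norm_direct_sum_sq[OF h]
        using part[OF N n] h by (intro infsum_le_finite_sums) (simp_all add: carrier_direct_sum)
      then show "vec_norm S (h n) \<le> \<epsilon>"
        by (rule power2_le_imp_le) (use \<epsilon> in simp)
    qed
    obtain N1 where N1: "\<forall>m\<ge>N1. \<forall>n\<ge>N1. vec_dist S (\<sigma> m) (\<sigma> n) < 1" using cauchy[of 1] by auto
    \<comment> \<open>The error \<open>h N1\<close> is already known to be square-summable, so this
      difference is an element of the direct sum, and its components are those of
      \<open>g0\<close>.\<close>
    define g where "g = \<sigma> N1 \<ominus>\<^bsub>S\<^esub> h N1"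
    have hN1: "h N1 \<in> carrier S" using hS[OF N1 order.refl] by simp
    have g: "g \<in> carrier S"
      unfolding g_def using hN1 by (intro S.minus_closed \<sigma>)
    have gj: "g j = g0 j" if j: "j \<in> J" for j
    proof -
      interpret H: hilbert_space "H j" using j by (rule hilbert)
      note cl = closedD[OF \<sigma> j] g0(1)[OF j]
      have "g j = \<sigma> N1 j \<ominus>\<^bsub>H j\<^esub> (\<sigma> N1 j \<ominus>\<^bsub>H j\<^esub> g0 j)"
        using j hN1 unfolding g_def by (subst direct_sum_diff) (simp_all add: h_def)
      then show ?thesis
        using cl by (simp add: a_minus_def H.minus_add H.r_neg2 H.M.add.inv_inv flip: H.M.a_assoc)
           (simp add: H.r_neg)
    qed
    have hg: "h n = \<sigma> n \<ominus>\<^bsub>S\<^esub> g" if "h n \<in> carrier S" for n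
      using that g by (intro direct_sum_eqI S.minus_closed \<sigma>) (simp_all add: direct_sum_diff gj h_def)
    have "(\<lambda>n. vec_dist S (\<sigma> n) g) \<longlonglongrightarrow> 0"
    proof (rule LIMSEQ_I)
      fix r :: real assume r: "0 < r"
      then obtain N where N: "\<forall>m\<ge>N. \<forall>n\<ge>N. vec_dist S (\<sigma> m) (\<sigma> n) < r / 2"
        using cauchy[of "r / 2"] by auto
      have "vec_norm S (\<sigma> n \<ominus>\<^bsub>S\<^esub> g) < r" if n: "N \<le> n" for n
        using hS[OF N n] hg[of n] r by simp
      then show "\<exists>no. \<forall>n\<ge>no. norm (vec_dist S (\<sigma> n) g - 0) < r"
        using g by (intro exI[of _ N]) (simp add: vec_dist_def)
    qed
    then show "\<exists>x\<in>carrier S. (\<lambda>n. vec_dist S (\<sigma> n) x) \<longlonglongrightarrow> 0" using g by blast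
  qed
qed

end

section \<open>Admissibility\<close>

context projection_family
begin

text \<open>\<open>nrm A (free_eval x)\<close> bounds every \<open>\<rho> j x\<close>
  simultaneously, so images remain square-summable and the sum is bounded by the same number. For a
  relation that number is 0. The algebraic laws are inherited component by component.\<close>

theorem representation_direct_sum:
  fixes J :: "'j set" and H :: "'j \<Rightarrow> 'h inner_space"
  assumes "\<And>j. j \<in> J \<Longrightarrow> hilbert_space (H j) \<and> representation I (R1 I \<union> R2 A I q) (H j) (\<rho> j)"
  shows "representation I (R1 I \<union> R2 A I q) (direct_sum J H) (direct_sum_rep J \<rho>)"
proof -
  interpret hilbert_family J H
    using assms by (intro hilbert_family.intro) blast
  have rep: "relation_representation A I q (H j) (\<rho> j)" if "j \<in> J" for j
    using assms[OF that]
    by (intro relation_representation.intro relation_representation_axioms.intro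
        projection_family_axioms) simp_all
  let ?B = "carrier (free_star_algebra I)" and ?R = "direct_sum_rep J \<rho>"
  have at: "?R x f j = \<rho> j x (f j)" if "j \<in> J" for x f j
    using that by (simp add: direct_sum_rep_def)
  have closed: "?R x f \<in> carrier S" and
    le: "(vec_norm S (?R x f))\<^sup>2 \<le> (nrm A (free_eval x) * vec_norm S f)\<^sup>2"
    if x: "x \<in> ?B" and f: "f \<in> carrier S" for x f
  proof -
    have sm: "(\<lambda>j. (nrm A (free_eval x))\<^sup>2 * (vec_norm (H j) (f j))\<^sup>2) summable_on J"
      using f by (intro summable_on_cmult_right) (simp add: carrier_direct_sum)
    have b: "(vec_norm (H j) (?R x f j))\<^sup>2 \<le> (nrm A (free_eval x))\<^sup>2 * (vec_norm (H j) (f j))\<^sup>2"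
      and cl: "?R x f j \<in> carrier (H j)" if j: "j \<in> J" for j
    proof -
      interpret \<rho>: relation_representation A I q "H j" "\<rho> j" using j by (rule rep)
      show "?R x f j \<in> carrier (H j)"
        using x closedD[OF f j] by (simp add: at[OF j] del: carrier_free)
      then show "(vec_norm (H j) (?R x f j))\<^sup>2 \<le> (nrm A (free_eval x))\<^sup>2 * (vec_norm (H j) (f j))\<^sup>2"
        using \<rho>.rep_norm_le[OF x closedD[OF f j]] unfolding power_mult_distrib[symmetric]
        by (intro power_mono) (simp_all add: at[OF j])
    qed
    show cS: "?R x f \<in> carrier S"
      by (rule closed_of_bound[OF cl _ sm b]) (simp_all add: direct_sum_rep_def extensional_def)
    have "(vec_norm S (?R x f))\<^sup>2 \<le> (\<Sum>\<^sub>\<infinity>j\<in>J. (nrm A (free_eval x))\<^sup>2 * (vec_norm (H j) (f j))\<^sup>2)"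
      unfolding vec_norm_direct_sum_sq[OF cS]
      using cS b sm by (intro infsum_mono) (simp_all add: carrier_direct_sum)
    then show "(vec_norm S (?R x f))\<^sup>2 \<le> (nrm A (free_eval x) * vec_norm S f)\<^sup>2"
      using f by (simp add: infsum_cmult_right' vec_norm_direct_sum_sq power_mult_distrib)
  qed
  have norm_le: "vec_norm S (?R x f) \<le> nrm A (free_eval x) * vec_norm S f" if "x \<in> ?B" "f \<in> carrier S" for x f
    using le[OF that] by (rule power2_le_imp_le) (simp add: that nrm_nonneg del: carrier_free)
  have eq: "u = v" if "u \<in> carrier S" "v \<in> carrier S" "\<And>j. j \<in> J \<Longrightarrow> u j = v j" for u v
    using that by (rule direct_sum_eqI)
  note B = free_closed(2,4,5,6)[where G = I]
  show ?thesis
    unfolding representation_def Let_def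
  proof (intro conjI ballI allI)
    fix x assume x: "x \<in> ?B"
    show "bounded_operator S (?R x)"
      unfolding bounded_operator_def
    proof (intro conjI ballI allI)
      show "?R x \<in> carrier S \<rightarrow> carrier S" using closed[OF x] by blast
      show "\<exists>K. \<forall>v\<in>carrier S. vec_norm S (?R x v) \<le> K * vec_norm S v" using norm_le[OF x] by blast
    next
      fix u v assume u: "u \<in> carrier S" and v: "v \<in> carrier S"
      show "?R x (u \<oplus>\<^bsub>S\<^esub> v) = ?R x u \<oplus>\<^bsub>S\<^esub> ?R x v"
      proof (rule eq)
        fix j assume j: "j \<in> J"
        interpret \<rho>: relation_representation A I q "H j" "\<rho> j" using j by (rule rep)
        show "?R x (u \<oplus>\<^bsub>S\<^esub> v) j = (?R x u \<oplus>\<^bsub>S\<^esub> ?R x v) j"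
          using x u v j by (simp add: at direct_sum_simps closedD \<rho>.rep_vec_add del: carrier_free)
      qed (intro closed x add_closed u v)+
    next
      fix c v assume v: "v \<in> carrier S"
      show "?R x (c \<odot>\<^bsub>S\<^esub> v) = c \<odot>\<^bsub>S\<^esub> ?R x v"
      proof (rule eq)
        fix j assume j: "j \<in> J"
        interpret \<rho>: relation_representation A I q "H j" "\<rho> j" using j by (rule rep)
        show "?R x (c \<odot>\<^bsub>S\<^esub> v) j = (c \<odot>\<^bsub>S\<^esub> ?R x v) j"
          using x v j by (simp add: at direct_sum_simps closedD \<rho>.rep_vec_smult del: carrier_free)
      qed (intro closed x smult_closed v)+
    qed
    show "is_adjoint S (?R x) (?R (star (free_star_algebra I) x))"
      unfolding is_adjoint_def direct_sum_simps(4)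
    proof (intro ballI infsum_cong)
      fix u v j assume u: "u \<in> carrier S" and v: "v \<in> carrier S" and j: "j \<in> J"
      interpret \<rho>: relation_representation A I q "H j" "\<rho> j" using j by (rule rep)
      show "inner_prod (H j) (?R x u j) (v j) =
          inner_prod (H j) (u j) (?R (star (free_star_algebra I) x) v j)"
        using x closedD[OF u j] closedD[OF v j] unfolding at[OF j] by (rule \<rho>.rep_adjoint)
    qed
  next
    fix x y v assume x: "x \<in> ?B" and y: "y \<in> ?B" and v: "v \<in> carrier S"
    show "?R (x \<oplus>\<^bsub>free_star_algebra I\<^esub> y) v = ?R x v \<oplus>\<^bsub>S\<^esub> ?R y v"
      unfolding free_star_algebra_simps
    proof (rule eq)
      fix j assume j: "j \<in> J"
      interpret \<rho>: relation_representation A I q "H j" "\<rho> j" using j by (rule rep)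
      show "?R (x + y) v j = (?R x v \<oplus>\<^bsub>S\<^esub> ?R y v) j"
        using x y v j by (simp add: at direct_sum_simps closedD \<rho>.rep_add del: carrier_free)
    qed (intro closed add_closed B x y v)+
    show "?R (x \<otimes>\<^bsub>free_star_algebra I\<^esub> y) v = ?R x (?R y v)"
      unfolding free_star_algebra_simps
    proof (rule eq)
      fix j assume j: "j \<in> J"
      interpret \<rho>: relation_representation A I q "H j" "\<rho> j" using j by (rule rep)
      show "?R (x * y) v j = ?R x (?R y v) j"
        using x y v j by (simp add: at direct_sum_simps closedD \<rho>.rep_mult del: carrier_free)
    qed (intro closed add_closed B x y v)+
  next
    fix c x v assume x: "x \<in> ?B" and v: "v \<in> carrier S"
    show "?R (c \<odot>\<^bsub>free_star_algebra I\<^esub> x) v = c \<odot>\<^bsub>S\<^esub> ?R x v"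
      unfolding free_star_algebra_simps
    proof (rule eq)
      fix j assume j: "j \<in> J"
      interpret \<rho>: relation_representation A I q "H j" "\<rho> j" using j by (rule rep)
      show "?R (Poly_Mapping.map ((*) c) x) v j = (c \<odot>\<^bsub>S\<^esub> ?R x v) j"
        using x v j by (simp add: at direct_sum_simps closedD \<rho>.rep_smult del: carrier_free)
    qed (intro closed smult_closed B x v)+
  next
    fix r assume r: "r \<in> R1 I \<union> R2 A I q"
    show "case r of (x, \<eta>) \<Rightarrow> op_norm S (?R x) \<le> \<eta>"
    proof (cases r)
      case (Pair x \<eta>)
      note x = relations_vanish[OF r[unfolded Pair]]
      have "op_norm S (?R x) \<le> 0"
        using norm_le[OF x(1)] x(2) by (intro S.op_norm_le) simp_all
      then show ?thesis using Pair x(3) by simp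
    qed
  qed
qed

theorem admissible_relations: "admissible TYPE('j) TYPE('h) I (R1 I \<union> R2 A I q)"
  unfolding admissible_def
proof (intro allI impI conjI)
  fix J :: "'j set" and H :: "'j \<Rightarrow> 'h inner_space" and \<rho>
  assume *: "\<forall>j\<in>J. hilbert_space (H j) \<and> representation I (R1 I \<union> R2 A I q) (H j) (\<rho> j)"
  then interpret hilbert_family J H by (intro hilbert_family.intro) blast
  show "hilbert_space (direct_sum J H)" by (rule hilbert_space_direct_sum)
  show "representation I (R1 I \<union> R2 A I q) (direct_sum J H) (direct_sum_rep J \<rho>)"
    using * by (intro representation_direct_sum) blast
qed

end

section \<open>The universal seminorm\<close>

text \<open>The one-dimensional Hilbert space, carried over by \<open>j\<close> to the type over which the universal
  seminorm takes its supremum.\<close>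

definition scalar_space :: "(complex \<Rightarrow> 'h) \<Rightarrow> 'h inner_space" where
  "scalar_space j =
    \<lparr>carrier = range j, mult = undefined, one = undefined, zero = j 0,
     add = (\<lambda>u v. j (inv_into UNIV j u + inv_into UNIV j v)), smult = (\<lambda>c v. j (c * inv_into UNIV j v)),
     inner_prod = (\<lambda>u v. inv_into UNIV j u * cnj (inv_into UNIV j v))\<rparr>"

lemma scalar_space_simps:
  assumes "inj j"
  shows "carrier (scalar_space j) = range j" "zero (scalar_space j) = j 0"
    "add (scalar_space j) (j a) (j b) = j (a + b)" "smult (scalar_space j) c (j a) = j (c * a)"
    "inner_prod (scalar_space j) (j a) (j b) = a * cnj b" "vec_norm (scalar_space j) (j a) = cmod a"
proof -
  show inner: "inner_prod (scalar_space j) (j a) (j b) = a * cnj b" for a b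
    using assms by (simp add: scalar_space_def)
  show "vec_norm (scalar_space j) (j a) = cmod a"
    by (simp add: vec_norm_def inner complex_mult_cnj cmod_def power2_eq_square)
qed (use assms in \<open>simp_all add: scalar_space_def\<close>)

text \<open>The group laws are pushed forward along \<open>j\<close>; its inverse is an isometry
  onto the complex numbers, from which completeness is pulled back.\<close>

lemma hilbert_space_scalar_space:
  assumes j: "inj j"
  shows "hilbert_space (scalar_space j)"
proof -
  note simps = scalar_space_simps[OF j]
  interpret C: cring complex_field by (rule cring_complex_field)
  have grp: "abelian_group (scalar_space j)"
    by (rule abelian_group_image[OF C.abelian_group_axioms, where S = UNIV and \<psi> = j])
      (use j in \<open>simp_all add: simps\<close>)
  have diff: "j a \<ominus>\<^bsub>scalar_space j\<^esub> j b = j (a - b)" for a b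
    using abelian_group_image(2)[OF C.abelian_group_axioms, where S = UNIV and \<psi> = j
        and U = "scalar_space j" and a = a and b = b] j
    by (simp add: simps a_minus_def[of complex_field])
  have "Module.module complex_field (scalar_space j)"
    by (rule moduleI[OF cring_complex_field grp]) (auto simp: simps algebra_simps)
  then have "pre_hilbert_space (scalar_space j)"
    by (rule pre_hilbert_space.intro[OF complex_space.intro], unfold_locales)
      (auto simp: simps algebra_simps)
  then interpret pre_hilbert_space "scalar_space j" .
  show ?thesis
  proof (rule hilbert_spaceI, rule mcomplete_pullback)
    show "Metric_space UNIV (dist :: complex \<Rightarrow> complex \<Rightarrow> real)" by (rule Met_TC.Metric_space_axioms)
    show "bij_betw (inv_into UNIV j) (carrier (scalar_space j)) UNIV"
      using j by (auto simp: simps bij_betw_def inj_on_def image_iff)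
    show "vec_dist (scalar_space j) u v = (if u \<in> carrier (scalar_space j) \<and>
        v \<in> carrier (scalar_space j) then dist (inv_into UNIV j u) (inv_into UNIV j v) else 0)" for u v
      using j by (auto simp: vec_dist_def simps diff dist_norm)
    show "Met_TC.mcomplete TYPE(complex)"
      by (simp add: complete_UNIV)
  qed
qed

context projection_family
begin

definition character_rep :: "(complex \<Rightarrow> 'h) \<Rightarrow> ('a \<Rightarrow> complex) \<Rightarrow> 'i star_poly \<Rightarrow> 'h \<Rightarrow> 'h" where
  "character_rep j f x v = j (f (free_eval x) * inv_into UNIV j v)"

text \<open>A character composed with evaluation acts by multiplication on a line. Its value at a
  relation is 0 since evaluation vanishes there, and the operator norm is attained at the vector
  \<open>j 1\<close>.\<close>

lemma character_rep:
  assumes f: "character_on free_image f" and j: "inj j"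
  shows "representation I (R1 I \<union> R2 A I q) (scalar_space j) (character_rep j f)"
    and "x \<in> carrier (free_star_algebra I) \<Longrightarrow>
      op_norm (scalar_space j) (character_rep j f x) = cmod (f (free_eval x))"
proof -
  interpret H: hilbert_space "scalar_space j" using j by (rule hilbert_space_scalar_space)
  note simps = scalar_space_simps[OF j]
  let ?B = "carrier (free_star_algebra I)"
  have fD: "f (free_eval x \<oplus> free_eval y) = f (free_eval x) + f (free_eval y)"
    "f (free_eval x \<otimes> free_eval y) = f (free_eval x) * f (free_eval y)"
    "f (c \<odot> free_eval x) = c * f (free_eval x)" "f (star A (free_eval x)) = cnj (f (free_eval x))"
    if "x \<in> ?B" "y \<in> ?B" for x y c
    using f that unfolding character_on_def by blast+
  have rep: "character_rep j f x (j a) = j (f (free_eval x) * a)" for x a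
    using j by (simp add: character_rep_def)
  have bounded: "bounded_operator (scalar_space j) (character_rep j f x)" for x
    unfolding bounded_operator_def
    by (auto simp: simps rep norm_mult algebra_simps intro!: exI[of _ "cmod (f (free_eval x))"])
  have "f \<zero> = 0"
    using fD(3)[of 0 0 0] by simp
  then have rel: "op_norm (scalar_space j) (character_rep j f x) \<le> \<eta>" if "(x, \<eta>) \<in> R1 I \<union> R2 A I q" for x \<eta>
    using relations_vanish[OF that] by (intro H.op_norm_le) (auto simp: simps rep)
  show "representation I (R1 I \<union> R2 A I q) (scalar_space j) (character_rep j f)"
    unfolding representation_def Let_def is_adjoint_def
    using bounded rel
    by (auto simp: simps rep fD free_eval_add free_eval_mult free_eval_smult free_eval_star
        algebra_simps simp del: carrier_free)
  assume x: "x \<in> ?B"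
  show "op_norm (scalar_space j) (character_rep j f x) = cmod (f (free_eval x))"
  proof (rule antisym)
    show "op_norm (scalar_space j) (character_rep j f x) \<le> cmod (f (free_eval x))"
      by (rule H.op_norm_le) (auto simp: simps rep norm_mult)
    show "cmod (f (free_eval x)) \<le> op_norm (scalar_space j) (character_rep j f x)"
      using H.vec_norm_le_op_norm[OF bounded, of "j 1" x] by (simp add: simps rep)
  qed
qed

text \<open>The upper estimate is uniform over representations; for the lower one the values of
  characters occur among the operator norms, and by \<open>nrm_free_eval_le\<close> these values
  already control the norm in \<open>A\<close>.\<close>

theorem universal_seminorm_eq:
  assumes j: "inj (j :: complex \<Rightarrow> 'h)" and x: "x \<in> carrier (free_star_algebra I)"
  shows "universal_seminorm TYPE('h) I (R1 I \<union> R2 A I q) x = nrm A (free_eval x)"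
proof -
  let ?T = "{op_norm H (\<rho> x) | (H :: 'h inner_space) \<rho>. hilbert_space H \<and>
    representation I (R1 I \<union> R2 A I q) H \<rho>}"
  have le: "r \<le> nrm A (free_eval x)" if "r \<in> ?T" for r
  proof -
    obtain H :: "'h inner_space" and \<rho> where H: "hilbert_space H"
      "representation I (R1 I \<union> R2 A I q) H \<rho>" "r = op_norm H (\<rho> x)"
      using \<open>r \<in> ?T\<close> by blast
    then interpret relation_representation A I q H \<rho>
      by (intro relation_representation.intro relation_representation_axioms.intro
          projection_family_axioms) simp_all
    show ?thesis using op_norm_rep_le[OF x] H(3) by simp
  qed
  then have bdd: "bdd_above ?T" by (rule bdd_aboveI)
  have mem: "cmod (f (free_eval x)) \<in> ?T" if "character_on free_image f" for f
    using character_rep(1)[OF that j] character_rep(2)[OF that j x] hilbert_space_scalar_space[OF j]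
    by (intro CollectI exI[of _ "scalar_space j"] exI[of _ "character_rep j f"] conjI) simp_all
  \<comment> \<open>The zero representation makes the set nonempty and its supremum nonnegative,
    also when \<open>A\<close> is trivial and no other characters exist.\<close>
  have "character_on free_image (\<lambda>_. 0)"
    by (simp add: character_on_def)
  from mem[OF this] have 0: "0 \<in> ?T" by (simp only: norm_zero)
  have "Sup ?T = nrm A (free_eval x)"
  proof (rule antisym)
    show "Sup ?T \<le> nrm A (free_eval x)"
      using 0 le by (intro cSup_least) blast+
    show "nrm A (free_eval x) \<le> Sup ?T"
    proof (rule nrm_free_eval_le[OF x cSup_upper[OF 0 bdd]])
      fix f assume "character_on free_image f"
      then show "cmod (f (free_eval x)) \<le> Sup ?T" by (rule cSup_upper[OF mem bdd])
    qed
  qed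
  then show ?thesis by (simp add: universal_seminorm_def)
qed

end

section \<open>The universal C*-algebra\<close>

context cstar_algebra
begin

lemma closure_iff_tends:
  assumes "D \<subseteq> carrier A"
  shows "a \<in> metric.mtopology closure_of D \<longleftrightarrow> (\<exists>\<sigma>. (\<forall>n. \<sigma> n \<in> D) \<and> tends \<sigma> a)"
proof
  assume "a \<in> metric.mtopology closure_of D"
  then have a: "a \<in> carrier A" and ex: "\<And>r. r > 0 \<Longrightarrow> \<exists>y\<in>D. y \<in> metric.mball a r"
    by (simp_all add: metric.metric_closure_of)
  have "\<exists>y\<in>D. nrm A (y \<ominus> a) < inverse (real (Suc n))" for n
  proof -
    obtain y where "y \<in> D" "y \<in> metric.mball a (inverse (real (Suc n)))"
      using ex[of "inverse (real (Suc n))"] by auto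
    then show ?thesis
      using a by (intro bexI[of _ y]) (auto simp: alg_dist_def nrm_diff_commute[of y])
  qed
  then obtain \<sigma> where \<sigma>: "\<And>n. \<sigma> n \<in> D" "\<And>n. nrm A (\<sigma> n \<ominus> a) < inverse (real (Suc n))"
    by metis
  have "tends \<sigma> a"
    by (rule tendsI_le[OF _ a LIMSEQ_inverse_real_of_nat less_imp_le[OF \<sigma>(2)]]) (use \<sigma>(1) assms in blast)
  with \<sigma> show "\<exists>\<sigma>. (\<forall>n. \<sigma> n \<in> D) \<and> tends \<sigma> a" by blast
next
  assume "\<exists>\<sigma>. (\<forall>n. \<sigma> n \<in> D) \<and> tends \<sigma> a"
  then obtain \<sigma> where \<sigma>: "\<And>n. \<sigma> n \<in> D" "tends \<sigma> a" by blast
  note \<sigma>D = tendsD[OF \<sigma>(2)]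
  have "\<exists>y\<in>D. y \<in> metric.mball a r" if r: "r > 0" for r
  proof -
    have "eventually (\<lambda>n. nrm A (\<sigma> n \<ominus> a) < r) sequentially"
      using \<sigma>D(3) r by (rule order_tendstoD(2))
    then obtain n where "nrm A (\<sigma> n \<ominus> a) < r"
      by (auto simp: eventually_sequentially)
    then show ?thesis
      using \<sigma>(1)[of n] \<sigma>D(1,2)
      by (intro bexI[of _ "\<sigma> n"]) (simp_all add: alg_dist_def nrm_diff_commute[of a])
  qed
  then show "a \<in> metric.mtopology closure_of D"
    using \<sigma>D(2) by (simp add: metric.metric_closure_of)
qed

text \<open>All operations are continuous, so they can be applied along approximating
  sequences.\<close>

lemma star_subalgebra_closure:
  assumes D: "star_subalgebra A D"
  shows "star_subalgebra A (metric.mtopology closure_of D)"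
proof -
  have sub: "D \<subseteq> carrier A" and z: "\<zero> \<in> D"
    and op: "\<And>x y. x \<in> D \<Longrightarrow> y \<in> D \<Longrightarrow> x \<oplus> y \<in> D \<and> x \<otimes> y \<in> D" "\<And>c x. x \<in> D \<Longrightarrow> c \<odot> x \<in> D"
      "\<And>x. x \<in> D \<Longrightarrow> star A x \<in> D"
    using D by (auto simp: star_subalgebra_def)
  note iff = closure_iff_tends[OF sub]
  show ?thesis
    unfolding star_subalgebra_def
  proof (intro conjI ballI allI)
    show "metric.mtopology closure_of D \<subseteq> carrier A"
      by (auto simp: iff dest: tendsD)
    show "\<zero> \<in> metric.mtopology closure_of D"
      unfolding iff using z tends_const[of \<zero>] by auto
  next
    fix x y assume "x \<in> metric.mtopology closure_of D" "y \<in> metric.mtopology closure_of D"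
    then obtain \<sigma> \<tau> where s: "\<And>n. \<sigma> n \<in> D" "tends \<sigma> x" and t: "\<And>n. \<tau> n \<in> D" "tends \<tau> y"
      unfolding iff by blast
    show "x \<oplus> y \<in> metric.mtopology closure_of D"
      unfolding iff using tends_add[OF s(2) t(2)] op(1) s(1) t(1) by (intro exI conjI) auto
    show "x \<otimes> y \<in> metric.mtopology closure_of D"
      unfolding iff using tends_mult[OF s(2) t(2)] op(1) s(1) t(1) by (intro exI conjI) auto
  next
    fix c x assume "x \<in> metric.mtopology closure_of D"
    then obtain \<sigma> where s: "\<And>n. \<sigma> n \<in> D" "tends \<sigma> x" unfolding iff by blast
    show "c \<odot> x \<in> metric.mtopology closure_of D"
      unfolding iff using tends_smult[OF s(2)] op(2) s(1) by (intro exI conjI) auto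
  next
    fix x assume "x \<in> metric.mtopology closure_of D"
    then obtain \<sigma> where s: "\<And>n. \<sigma> n \<in> D" "tends \<sigma> x" unfolding iff by blast
    show "star A x \<in> metric.mtopology closure_of D"
      unfolding iff using tends_star[OF s(2)] op(3) s(1) by (intro exI conjI) auto
  qed
qed

text \<open>The closure of \<open>D\<close> is one of the closed *-subalgebras whose intersection is
  the whole algebra, hence is itself everything.\<close>

lemma generates_cstar_dense:
  assumes gen: "generates_cstar A S" and D: "star_subalgebra A D" "S \<subseteq> D" and a: "a \<in> carrier A" and \<epsilon>: "0 < \<epsilon>"
  shows "\<exists>d\<in>D. nrm A (d \<ominus> a) < \<epsilon>"
proof -
  let ?C = "metric.mtopology closure_of D"
  have sub: "D \<subseteq> carrier A" using D by (simp add: star_subalgebra_def)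
  have "D \<subseteq> ?C" using sub by (intro closure_of_subset) simp
  then have "?C \<in> {B. star_subalgebra A B \<and> closedin metric.mtopology B \<and> S \<subseteq> B}"
    using star_subalgebra_closure[OF D(1)] D(2) by auto
  then have "carrier A \<subseteq> ?C"
    using gen unfolding generates_cstar_def by blast
  then obtain \<sigma> where \<sigma>: "\<And>n. \<sigma> n \<in> D" "tends \<sigma> a"
    using a closure_iff_tends[OF sub] by blast
  have "eventually (\<lambda>n. nrm A (\<sigma> n \<ominus> a) < \<epsilon>) sequentially"
    using tendsD(3)[OF \<sigma>(2)] \<epsilon> by (rule order_tendstoD(2))
  then obtain n where "nrm A (\<sigma> n \<ominus> a) < \<epsilon>"
    by (auto simp: eventually_sequentially)
  then show ?thesis using \<sigma>(1) by blast
qed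

end

section \<open>The quotient by the seminorm kernel as the image of evaluation\<close>

text \<open>The seminorm enters through its values alone, so from here on no Hilbert space
  appears.\<close>

locale generating_projections = projection_family A I q
  for A :: "('a, 'm) normed_star_algebra_scheme" (structure) and I :: "'i set" and q :: "'i \<Rightarrow> 'a" +
  fixes s :: "'i star_poly \<Rightarrow> real"
  assumes generates: "generates_cstar A (q ` I)"
    and seminorm: "x \<in> carrier (free_star_algebra I) \<Longrightarrow> s x = nrm A (free_eval x)"
begin

abbreviation "N \<equiv> seminorm_kernel (free_star_algebra I) s"
abbreviation "P \<equiv> seminorm_quotient (free_star_algebra I) s"

text \<open>Another description of the cosets of the seminorm kernel, indexed by points of
  \<open>A\<close>.\<close>

definition fibre :: "'a \<Rightarrow> 'i star_poly set" where
  "fibre d = {x \<in> carrier (free_star_algebra I). free_eval x = d}"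

lemma fibre_nonempty: "d \<in> free_image \<Longrightarrow> fibre d \<noteq> {}"
  unfolding fibre_def by blast

lemma kernel_eq: "N = fibre \<zero>"
  by (auto simp: seminorm_kernel_def fibre_def seminorm nrm_eq_0_iff
      simp del: carrier_free)

lemma coset_eq: 
  assumes y: "y \<in> carrier (free_star_algebra I)"
  shows "N +>\<^bsub>free_star_algebra I\<^esub> y = fibre (free_eval y)"
proof (intro equalityI subsetI)
  fix x assume "x \<in> N +>\<^bsub>free_star_algebra I\<^esub> y"
  then show "x \<in> fibre (free_eval y)"
    using y by (auto simp: a_r_coset_def' kernel_eq fibre_def free_eval_add free_closed(2)
        simp del: carrier_free)
next
  fix x assume "x \<in> fibre (free_eval y)"
  then have "x - y \<in> fibre \<zero>"
    using y by (auto simp: fibre_def free_eval_diff free_closed(3) minus_eq_iff simp del: carrier_free)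
  then show "x \<in> N +>\<^bsub>free_star_algebra I\<^esub> y"
    by (auto simp: a_r_coset_def' kernel_eq intro!: bexI[of _ "x - y"])
qed

text \<open>Well-definedness of an operation given as a union over representatives, as in
  \<open>UN_limit_class\<close>.\<close>

lemma UN_coset:
  assumes "d \<in> free_image" and "\<And>x. x \<in> fibre d \<Longrightarrow> f x \<in> carrier (free_star_algebra I) \<and> free_eval (f x) = e"
  shows "(\<Union>x\<in>fibre d. N +>\<^bsub>free_star_algebra I\<^esub> f x) = fibre e"
proof -
  have "N +>\<^bsub>free_star_algebra I\<^esub> f x = fibre e" if "x \<in> fibre d" for x
    using assms(2)[OF that] coset_eq by simp
  moreover have "fibre d \<noteq> {}" using assms(1) by (rule fibre_nonempty)
  ultimately show ?thesis by simp
qed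

lemma quotient_carrier: "carrier P = fibre ` free_image"
  by (auto simp: seminorm_quotient_def Let_def A_RCOSETS_def' coset_eq
      simp del: carrier_free)

lemma quotient_zero: "\<zero>\<^bsub>P\<^esub> = fibre \<zero>"
  by (simp add: seminorm_quotient_def Let_def kernel_eq)

text \<open>Addition of cosets is elementwise addition of sets, not a union of cosets, so every
  element of the target fibre must also be decomposed: x = (x - y) + y with any \<open>y\<close>
  over \<open>e\<close>.\<close>

lemma quotient_add:
  assumes d: "d \<in> free_image" and e: "e \<in> free_image"
  shows "fibre d \<oplus>\<^bsub>P\<^esub> fibre e = fibre (d \<oplus> e)"
proof -
  obtain y where y: "y \<in> carrier (free_star_algebra I)" "e = free_eval y" using e by blast
  have "(\<Union>h\<in>fibre d. \<Union>k\<in>fibre e. {h + k}) = fibre (d \<oplus> e)"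
  proof (intro equalityI subsetI)
    fix x assume "x \<in> (\<Union>h\<in>fibre d. \<Union>k\<in>fibre e. {h + k})"
    then show "x \<in> fibre (d \<oplus> e)"
      by (auto simp: fibre_def free_eval_add free_closed(2) simp del: carrier_free)
  next
    fix x assume x: "x \<in> fibre (d \<oplus> e)"
    have "d \<in> carrier A" using d free_eval_closed by blast
    moreover have "(d \<oplus> e) \<ominus> e = d" if "d \<in> carrier A" "e \<in> carrier A"
      using that by (simp add: a_minus_def M.a_assoc M.r_neg)
    ultimately have "x - y \<in> fibre d"
      using x y by (auto simp: fibre_def free_eval_diff free_closed(3) simp del: carrier_free)
    then show "x \<in> (\<Union>h\<in>fibre d. \<Union>k\<in>fibre e. {h + k})"
    proof (intro UN_I)
      show "y \<in> fibre e" using y by (simp add: fibre_def del: carrier_free)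
      show "x \<in> {(x - y) + y}" by simp
    qed
  qed
  then show ?thesis
    by (simp add: seminorm_quotient_def Let_def set_add_def')
qed

lemma quotient_mult:
  assumes d: "d \<in> free_image" and e: "e \<in> free_image"
  shows "fibre d \<otimes>\<^bsub>P\<^esub> fibre e = fibre (d \<otimes> e)"
proof -
  have "(\<Union>y\<in>fibre e. N +>\<^bsub>free_star_algebra I\<^esub> (x * y)) = fibre (d \<otimes> e)" if "x \<in> fibre d" for x
    using that by (intro UN_coset[OF e])
      (auto simp: fibre_def free_eval_mult free_closed(4) simp del: carrier_free)
  moreover have "fibre d \<noteq> {}" using d by (rule fibre_nonempty)
  ultimately show ?thesis
    by (simp add: seminorm_quotient_def Let_def rcoset_mult_def)
qed

lemma quotient_smult:
  assumes d: "d \<in> free_image"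
  shows "c \<odot>\<^bsub>P\<^esub> fibre d = fibre (c \<odot> d)"
proof -
  have "(\<Union>x\<in>fibre d. N +>\<^bsub>free_star_algebra I\<^esub> Poly_Mapping.map ((*) c) x) = fibre (c \<odot> d)"
    by (intro UN_coset[OF d])
      (auto simp: fibre_def free_eval_smult free_closed(5) simp del: carrier_free)
  then show ?thesis
    by (simp add: seminorm_quotient_def Let_def)
qed

lemma quotient_star:
  assumes d: "d \<in> free_image"
  shows "star P (fibre d) = fibre (star A d)"
proof -
  have "(\<Union>x\<in>fibre d. N +>\<^bsub>free_star_algebra I\<^esub> star (free_star_algebra I) x) = fibre (star A d)"
    by (intro UN_coset[OF d])
      (auto simp: fibre_def free_eval_star free_closed(6) simp del: carrier_free)
  then show ?thesis
    by (simp add: seminorm_quotient_def Let_def)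
qed

text \<open>The representative chosen by \<open>SOME\<close> does not matter because
  \<open>s\<close> depends on the evaluation only.\<close>

lemma quotient_nrm:
  assumes d: "d \<in> free_image"
  shows "nrm P (fibre d) = nrm A d"
proof -
  have "fibre d \<noteq> {}" using d by (rule fibre_nonempty)
  then have "(SOME x. x \<in> fibre d) \<in> fibre d" by (simp add: some_in_eq)
  then show ?thesis
    by (auto simp: seminorm_quotient_def Let_def fibre_def
        seminorm simp del: carrier_free)
qed

lemma fibre_inj: "inj_on fibre free_image"
proof
  fix d e assume "d \<in> free_image" "fibre d = fibre e"
  then obtain x where "x \<in> fibre d" "x \<in> fibre e" using fibre_nonempty by blast
  then show "d = e" by (simp add: fibre_def)
qed

lemma star_subalgebra_free_image: "star_subalgebra A free_image"
  unfolding star_subalgebra_def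
proof (intro conjI ballI allI)
  show "free_image \<subseteq> carrier A" by (auto simp del: carrier_free)
  show "\<zero> \<in> free_image" using free_closed(1) free_eval_0 by (metis image_eqI)
next
  fix d e assume "d \<in> free_image" "e \<in> free_image"
  then obtain x y where xy: "x \<in> carrier (free_star_algebra I)" "y \<in> carrier (free_star_algebra I)" "d = free_eval x" "e = free_eval y" by blast
  show "d \<oplus> e \<in> free_image"
    using xy free_eval_add free_closed(2) by (metis image_eqI)
  show "d \<otimes> e \<in> free_image"
    using xy free_eval_mult free_closed(4) by (metis image_eqI)
next
  fix c d assume "d \<in> free_image"
  then obtain x where x: "x \<in> carrier (free_star_algebra I)" "d = free_eval x" by blast
  show "c \<odot> d \<in> free_image"
    using imageI[OF free_closed(5)[OF x(1)], of free_eval c] free_eval_smult[OF x(1)] x(2)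
    by (simp del: carrier_free)
next
  fix d assume "d \<in> free_image"
  then obtain x where x: "x \<in> carrier (free_star_algebra I)" "d = free_eval x" by blast
  show "star A d \<in> free_image"
    using imageI[OF free_closed(6)[OF x(1)], of free_eval] free_eval_star[OF x(1)] x(2)
    by (simp del: carrier_free)
qed

lemma free_image_closed:
  "d \<in> free_image \<Longrightarrow> e \<in> free_image \<Longrightarrow> d \<oplus> e \<in> free_image"
  "d \<in> free_image \<Longrightarrow> e \<in> free_image \<Longrightarrow> d \<otimes> e \<in> free_image"
  "d \<in> free_image \<Longrightarrow> c \<odot> d \<in> free_image"
  "d \<in> free_image \<Longrightarrow> star A d \<in> free_image"
  using star_subalgebra_free_image unfolding star_subalgebra_def by blast+

lemma generators_in_free_image: "q ` I \<subseteq> free_image"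
  using free_eval_gen(1) free_closed(8) by (metis image_eqI image_subsetI)

text \<open>The map that \<open>free_eval\<close> induces on the quotient.\<close>

definition coset_value :: "'i star_poly set \<Rightarrow> 'a" where
  "coset_value = inv_into free_image fibre"

lemma coset_value_fibre: "d \<in> free_image \<Longrightarrow> coset_value (fibre d) = d"
  unfolding coset_value_def using fibre_inj by (rule inv_into_f_f)

sublocale dense: isometric_dense_embedding A P coset_value
proof (rule isometric_dense_embedding.intro[OF cstar_algebra_axioms],
    rule isometric_dense_embedding_axioms.intro)
  have minus: "\<ominus> d \<in> free_image" if d: "d \<in> free_image" for d
  proof -
    have "d \<in> carrier A" using d free_eval_closed by blast
    then show ?thesis using free_image_closed(3)[OF d, of "-1"] smult_minus_1 by simp
  qed
  have "free_image \<subseteq> carrier A" "\<zero> \<in> free_image"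
    using star_subalgebra_free_image by (simp_all add: star_subalgebra_def)
  then show "abelian_group P"
    \<comment> \<open>The additive structure of the quotient is that of the image of evaluation,
      carried over by \<open>fibre\<close>.\<close>
    by (rule abelian_group_image(1)[OF M.abelian_group_axioms _ _ free_image_closed(1) minus
        fibre_inj quotient_carrier quotient_zero quotient_add])
next
  fix X Y c assume X: "X \<in> carrier P" and Y: "Y \<in> carrier P"
  then obtain d e where "d \<in> free_image" "X = fibre d" "e \<in> free_image" "Y = fibre e"
    unfolding quotient_carrier by blast
  then show "X \<otimes>\<^bsub>P\<^esub> Y \<in> carrier P"
    unfolding quotient_carrier by (simp add: quotient_mult free_image_closed)
next
  fix X c assume "X \<in> carrier P"
  then obtain d where "d \<in> free_image" "X = fibre d"
    unfolding quotient_carrier by blast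
  then show "c \<odot>\<^bsub>P\<^esub> X \<in> carrier P" "star P X \<in> carrier P" "nrm P X = nrm A (coset_value X)"
    unfolding quotient_carrier
    by (simp_all add: quotient_smult quotient_star quotient_nrm coset_value_fibre
        free_image_closed)
next
  show "star_hom P A coset_value"
    unfolding star_hom_def quotient_carrier
    using star_subalgebra_free_image
    by (auto simp: quotient_add quotient_mult quotient_smult quotient_star
        coset_value_fibre free_image_closed star_subalgebra_def)
  show "inj_on coset_value (carrier P)"
    unfolding quotient_carrier by (rule inj_onI) (auto simp: coset_value_fibre)
  fix a and \<epsilon> :: real assume "a \<in> carrier A" "0 < \<epsilon>"
  then obtain d where "d \<in> free_image" "nrm A (d \<ominus> a) < \<epsilon>"
    using generates_cstar_dense[OF generates star_subalgebra_free_image generators_in_free_image]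
    by blast
  then show "\<exists>X\<in>carrier P. nrm A (coset_value X \<ominus> a) < \<epsilon>"
    unfolding quotient_carrier by (auto simp: coset_value_fibre simp del: carrier_free)
qed

theorem completion_quotient_iso:
  obtains \<Phi> where "star_iso (completion P) A \<Phi>"
    and "\<And>i. i \<in> I \<Longrightarrow> \<Phi> (null_rel P `` {\<lambda>_. N +>\<^bsub>free_star_algebra I\<^esub> free_gen i}) = q i"
proof -
  obtain \<Phi> where iso: "star_iso (completion P) A \<Phi>"
    and \<Phi>: "\<And>X. X \<in> carrier P \<Longrightarrow> \<Phi> (null_rel P `` {\<lambda>_. X}) = coset_value X"
    by (rule dense.completion_iso) blast
  have "\<Phi> (null_rel P `` {\<lambda>_. N +>\<^bsub>free_star_algebra I\<^esub> free_gen i}) = q i" if i: "i \<in> I" for i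
  proof -
    have "q i \<in> free_image" using generators_in_free_image i by blast
    moreover have "N +>\<^bsub>free_star_algebra I\<^esub> free_gen i = fibre (q i)"
      using coset_eq[OF free_closed(8)[OF i]] free_eval_gen(1)[OF i] by simp
    ultimately show ?thesis
      by (simp add: \<Phi> quotient_carrier coset_value_fibre)
  qed
  with iso that show ?thesis by blast
qed

end

theorem theorem4p2:
  fixes A :: "'a normed_star_algebra" and I :: "'i set" and q :: "'i \<Rightarrow> 'a"
  assumes "commutative_cstar_algebra A"
    and "I \<noteq> {}"
    and "\<forall>i\<in>I. is_projection A (q i)"
    and "generates_cstar A (q ` I)"
    and "\<exists>e :: ('i star_word \<Rightarrow> complex) \<Rightarrow> 'h. inj e"
  shows "admissible TYPE('j) TYPE('h) I (R1 I \<union> R2 A I q) \<and>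
    cstar_algebra (universal_cstar TYPE('h) I (R1 I \<union> R2 A I q)) \<and>
    (\<exists>\<Phi>. star_iso (universal_cstar TYPE('h) I (R1 I \<union> R2 A I q)) A \<Phi> \<and>
         (\<forall>i\<in>I. \<Phi> (universal_gen TYPE('h) I (R1 I \<union> R2 A I q) i) = q i))"
proof -
  obtain e :: "('i star_word \<Rightarrow> complex) \<Rightarrow> 'h" where e: "inj e"
    using assms(5) by blast
  \<comment> \<open>Constant functions embed the complex numbers into \<open>'h\<close>, which gives
    the one-dimensional representations room in this type.\<close>
  have "inj (\<lambda>c. e (\<lambda>_. c))"
    by (rule injI) (metis e injD)
  interpret projection_family A I q
    using assms(1,3) by (intro projection_family.intro projection_family_axioms.intro) simp_all
  let ?s = "universal_seminorm TYPE('h) I (R1 I \<union> R2 A I q)"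
  interpret generating_projections A I q ?s
    using assms(4) universal_seminorm_eq[OF \<open>inj (\<lambda>c. e (\<lambda>_. c))\<close>]
    by (intro generating_projections.intro generating_projections_axioms.intro
        projection_family_axioms) blast+
  obtain \<Phi> where "star_iso (completion P) A \<Phi>"
    "\<And>i. i \<in> I \<Longrightarrow> \<Phi> (null_rel P `` {\<lambda>_. N +>\<^bsub>free_star_algebra I\<^esub> free_gen i}) = q i"
    using completion_quotient_iso by blast
  then show ?thesis
    using admissible_relations dense.cstar_algebra_completion
    unfolding universal_cstar_def universal_gen_def pre_universal_def Let_def by blast
qed

end
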